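(* Let $1\le r\le 2$ and let $\sigma\in L^{r}(\mathbb{R}^{4},\mathbb{Q})$ be such that $\sigma(x,\xi)=\sigma(x,-\xi)$ for $x,\xi\in\mathbb{R}^2$. Then the Weyl transform $W_\sigma:L^{2}(\mathbb{R}^{2},\mathbb{Q})\to L^{2}(\mathbb{R}^{2},\mathbb{Q})$ is a compact operator.
   Context: $\mathbb{Q}$ is the algebra of Hamilton quaternions with imaginary units $i,j,k$ ($i^2=j^2=k^2=ijk=-1$), conjugation $q\mapsto\bar q$ and modulus $|q|=\sqrt{q\bar q}$. $L^r(\mathbb{R}^n,\mathbb{Q})$ is the space of $\mathbb{Q}$-valued measurable functions $f$ with $\|f\|_r=(\int|f|^r)^{1/r}<\infty$, and $\mathcal{S}(\mathbb{R}^n,\mathbb{Q})$ is the space of $\mathbb{Q}$-valued Schwartz functions. The pairing is $\langle f,g\rangle=\int f\,\overline{g}$. For $f,g\in\mathcal{S}(\mathbb{R}^2,\mathbb{Q})$ the Wigner transform is $$W(f,g)(x,\xi)=\int_{\mathbb{R}^{2}} e^{-2\pi i \xi_1 p_1} f\left(x+\tfrac{p}{2}\right)\overline{g\left(x-\tfrac{p}{2}\right)} e^{-2\pi j \xi_2 p_2}\,dp,\qquad x,\xi\in\mathbb{R}^2,$$ and it extends to a bounded bilinear map $L^2(\mathbb{R}^2,\mathbb{Q})\times L^2(\mathbb{R}^2,\mathbb{Q})\to L^{s}(\mathbb{R}^4,\mathbb{Q})$ for $2\le s\le\infty$. The Weyl transform $W_\sigma$ with symbol $\sigma$ on $\mathbb{R}^4=\mathbb{R}^2\times\mathbb{R}^2$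 is defined by $$\langle W_\sigma f,g\rangle=\int_{\mathbb{R}^2}\int_{\mathbb{R}^2}\sigma(x,\xi)\,W(f,g)(x,\xi)\,dx\,d\xi .$$
   Formalization: For some such σ no operator satisfies the identity defining W_σ; what is proved is that any W_σ satisfying it is a compact (real-linear) operator, and that a compact operator satisfying the scalar part of the identity always exists. *)

theory Defs
  imports "HOL-Analysis.Analysis"
begin

section \<open>Hamilton quaternions\<close>

codatatype quat = Quat (q1: real) (qi: real) (qj: real) (qk: real)

lemma quat_eqI: "q1 x = q1 y \<Longrightarrow> qi x = qi y \<Longrightarrow> qj x = qj y \<Longrightarrow> qk x = qk y \<Longrightarrow> x = y"
  by (rule quat.expand) simp

lemma quat_eq_iff: "x = y \<longleftrightarrow> q1 x = q1 y \<and> qi x = qi y \<and> qj x = qj y \<and> qk x = qk y"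
  by (auto intro: quat_eqI)

instantiation quat :: ab_group_add
begin

primcorec zero_quat where
  "q1 0 = 0" | "qi 0 = 0" | "qj 0 = 0" | "qk 0 = 0"

primcorec plus_quat where
  "q1 (x + y) = q1 x + q1 y"
| "qi (x + y) = qi x + qi y"
| "qj (x + y) = qj x + qj y"
| "qk (x + y) = qk x + qk y"

primcorec uminus_quat where
  "q1 (- x) = - q1 x" | "qi (- x) = - qi x" | "qj (- x) = - qj x" | "qk (- x) = - qk x"

primcorec minus_quat where
  "q1 (x - y) = q1 x - q1 y"
| "qi (x - y) = qi x - qi y"
| "qj (x - y) = qj x - qj y"
| "qk (x - y) = qk x - qk y"

instance
  by standard (simp_all add: quat_eq_iff)

end

instantiation quat :: real_algebra_1
begin

primcorec one_quat where
  "q1 1 = 1" | "qi 1 = 0" | "qj 1 = 0" | "qk 1 = 0"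

primcorec times_quat where
  "q1 (x * y) = q1 x * q1 y - qi x * qi y - qj x * qj y - qk x * qk y"
| "qi (x * y) = q1 x * qi y + qi x * q1 y + qj x * qk y - qk x * qj y"
| "qj (x * y) = q1 x * qj y - qi x * qk y + qj x * q1 y + qk x * qi y"
| "qk (x * y) = q1 x * qk y + qi x * qj y - qj x * qi y + qk x * q1 y"

primcorec scaleR_quat where
  "q1 (scaleR r x) = r * q1 x"
| "qi (scaleR r x) = r * qi x"
| "qj (scaleR r x) = r * qj x"
| "qk (scaleR r x) = r * qk x"

instance
  by standard (simp_all add: quat_eq_iff algebra_simps)

end

definition quat_i :: quat where "quat_i = Quat 0 1 0 0"
definition quat_j :: quat where "quat_j = Quat 0 0 1 0"
definition quat_k :: quat where "quat_k = Quat 0 0 0 1"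

lemma quat_units_sel [simp]:
  "q1 quat_i = 0" "qi quat_i = 1" "qj quat_i = 0" "qk quat_i = 0"
  "q1 quat_j = 0" "qi quat_j = 0" "qj quat_j = 1" "qk quat_j = 0"
  "q1 quat_k = 0" "qi quat_k = 0" "qj quat_k = 0" "qk quat_k = 1"
  by (simp_all add: quat_i_def quat_j_def quat_k_def)

lemma hamilton_relations:
  "quat_i * quat_i = -1" "quat_j * quat_j = -1" "quat_k * quat_k = -1"
  "quat_i * quat_j * quat_k = -1"
  by (simp_all add: quat_eq_iff)

lemma quat_decompose:
  "x = q1 x *\<^sub>R 1 + qi x *\<^sub>R quat_i + qj x *\<^sub>R quat_j + qk x *\<^sub>R quat_k"
  by (simp add: quat_eq_iff)

primcorec qcnj :: "quat \<Rightarrow> quat" where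
  "q1 (qcnj x) = q1 x" | "qi (qcnj x) = - qi x" | "qj (qcnj x) = - qj x" | "qk (qcnj x) = - qk x"

instantiation quat :: real_inner
begin

definition inner_quat :: "quat \<Rightarrow> quat \<Rightarrow> real" where
  "inner_quat x y = q1 x * q1 y + qi x * qi y + qj x * qj y + qk x * qk y"

definition norm_quat :: "quat \<Rightarrow> real" where
  "norm_quat x = sqrt ((q1 x)\<^sup>2 + (qi x)\<^sup>2 + (qj x)\<^sup>2 + (qk x)\<^sup>2)"

definition sgn_quat :: "quat \<Rightarrow> quat" where
  "sgn_quat x = x /\<^sub>R norm x"

definition dist_quat :: "quat \<Rightarrow> quat \<Rightarrow> real" where
  "dist_quat x y = norm (x - y)"

definition uniformity_quat :: "(quat \<times> quat) filter" where
  "uniformity_quat = (INF e\<in>{0<..}. principal {(x, y). dist x y < e})"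

definition open_quat :: "quat set \<Rightarrow> bool" where
  "open_quat U \<longleftrightarrow> (\<forall>x\<in>U. eventually (\<lambda>(x', y). x' = x \<longrightarrow> y \<in> U) uniformity)"

instance
proof
  fix x y z :: quat and r :: real and U :: "quat set"
  show "sgn x = x /\<^sub>R norm x" by (rule sgn_quat_def)
  show "dist x y = norm (x - y)" by (rule dist_quat_def)
  show "(uniformity :: (quat \<times> quat) filter) = (INF e\<in>{0<..}. principal {(x, y). dist x y < e})"
    by (rule uniformity_quat_def)
  show "open U \<longleftrightarrow> (\<forall>x\<in>U. eventually (\<lambda>(x', y). x' = x \<longrightarrow> y \<in> U) uniformity)"
    by (rule open_quat_def)
  show "inner x y = inner y x" by (simp add: inner_quat_def mult.commute)
  show "inner (x + y) z = inner x z + inner y z" by (simp add: inner_quat_def algebra_simps)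
  show "inner (scaleR r x) y = r * inner x y" by (simp add: inner_quat_def algebra_simps)
  show "0 \<le> inner x x" by (simp add: inner_quat_def)
  show "inner x x = 0 \<longleftrightarrow> x = 0"
    by (auto simp add: inner_quat_def quat_eq_iff add_nonneg_eq_0_iff)
  show "norm x = sqrt (inner x x)" by (simp add: inner_quat_def norm_quat_def power2_eq_square)
qed

end

lemma norm_quat_mult: "norm (x * y) = norm x * norm y" for x y :: quat
  by (simp add: norm_quat_def power2_eq_square algebra_simps flip: real_sqrt_mult)

lemma mult_qcnj_eq_norm: "x * qcnj x = of_real ((norm x)\<^sup>2)"
  unfolding of_real_def norm_quat_def by (simp add: quat_eq_iff power2_eq_square algebra_simps)

instantiation quat :: real_normed_div_algebra
begin

definition inverse_quat :: "quat \<Rightarrow> quat" where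
  "inverse_quat x = qcnj x /\<^sub>R (norm x)\<^sup>2"

definition divide_quat :: "quat \<Rightarrow> quat \<Rightarrow> quat" where
  "x div y = x * inverse y" for x y :: quat

instance
proof
  fix x y :: quat
  show "norm (x * y) = norm x * norm y" by (rule norm_quat_mult)
  show "x div y = x * inverse y" by (rule divide_quat_def)
  show "inverse (0::quat) = 0" by (simp add: inverse_quat_def quat_eq_iff)
  assume "x \<noteq> 0"
  then have nz: "(norm x)\<^sup>2 \<noteq> 0" by simp
  have comm: "qcnj x * x = x * qcnj x" by (simp add: quat_eq_iff)
  have "(1 / (norm x)\<^sup>2) *\<^sub>R of_real ((norm x)\<^sup>2) = (1::quat)"
    unfolding of_real_def scaleR_scaleR using nz by simp
  then show "x * inverse x = 1" "inverse x * x = 1"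
    by (simp_all only: inverse_quat_def mult_scaleR_right mult_scaleR_left comm
        mult_qcnj_eq_norm inverse_eq_divide)
qed

end

instantiation quat :: euclidean_space
begin

definition Basis_quat :: "quat set" where
  "Basis_quat = {1, quat_i, quat_j, quat_k}"

instance
proof
  show "(Basis :: quat set) \<noteq> {}" "finite (Basis :: quat set)"
    by (simp_all add: Basis_quat_def)
  show "inner u v = (if u = v then 1 else 0)" if "u \<in> Basis" "v \<in> Basis" for u v :: quat
    using that unfolding Basis_quat_def
    by (elim insertE emptyE; simp add: inner_quat_def quat_eq_iff)
  show "(\<forall>u\<in>Basis. inner x u = 0) \<longleftrightarrow> x = 0" for x :: quat
    by (simp add: Basis_quat_def inner_quat_def quat_eq_iff [of x 0])
qed

end

lemma norm_quat_unit [simp]: "norm quat_i = 1" "norm quat_j = 1" "norm quat_k = 1"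
  by (simp_all add: norm_quat_def)

lemma norm_qcnj [simp]: "norm (qcnj x) = norm x"
  by (simp add: norm_quat_def)

lemma inner_quat_eq: "inner x y = q1 (x * qcnj y)"
  by (simp add: inner_quat_def)

lemma bounded_linear_qcnj: "bounded_linear qcnj"
  by (rule bounded_linear_intro [where K = 1]) (simp_all add: quat_eq_iff)

lemma borel_measurable_qcnj [measurable]: "qcnj \<in> borel_measurable borel"
  by (intro borel_measurable_continuous_onI linear_continuous_on bounded_linear_qcnj)

lemma borel_measurable_quat_mult [measurable (raw)]:
  fixes f g :: "'a \<Rightarrow> quat"
  assumes "f \<in> borel_measurable M" "g \<in> borel_measurable M"
  shows "(\<lambda>x. f x * g x) \<in> borel_measurable M"
  using assms by (rule borel_measurable_continuous_Pair) (intro continuous_intros)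


section \<open>The spaces $L^r$ and $L^2$\<close>

definition Lp_fun :: "real \<Rightarrow> ('a::euclidean_space \<Rightarrow> quat) \<Rightarrow> bool" where
  "Lp_fun r f \<longleftrightarrow> f \<in> borel_measurable lebesgue \<and> integrable lebesgue (\<lambda>x. norm (f x) powr r)"

lemma Lp_fun_2:
  "Lp_fun 2 f \<longleftrightarrow> f \<in> borel_measurable lebesgue \<and> integrable lebesgue (\<lambda>x. (norm (f x))\<^sup>2)"
  by (simp add: Lp_fun_def)

lemma Lp_fun_2_zero: "Lp_fun 2 (\<lambda>_. 0)"
  by (simp add: Lp_fun_2)

lemma Lp_fun_2_scaleR: "Lp_fun 2 f \<Longrightarrow> Lp_fun 2 (\<lambda>x. c *\<^sub>R f x)"
  by (simp add: Lp_fun_2 power_mult_distrib borel_measurable_scaleR)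

lemma Lp_fun_2_add:
  assumes "Lp_fun 2 f" "Lp_fun 2 g"
  shows "Lp_fun 2 (\<lambda>x. f x + g x)"
proof -
  have [measurable]: "f \<in> borel_measurable lebesgue" "g \<in> borel_measurable lebesgue"
    and int: "integrable lebesgue (\<lambda>x. (norm (f x))\<^sup>2)" "integrable lebesgue (\<lambda>x. (norm (g x))\<^sup>2)"
    using assms by (simp_all add: Lp_fun_2)
  have "(norm (f x + g x))\<^sup>2 \<le> 2 * (norm (f x))\<^sup>2 + 2 * (norm (g x))\<^sup>2" for x
  proof -
    have "(norm (f x + g x))\<^sup>2 \<le> (norm (f x) + norm (g x))\<^sup>2"
      by (simp add: norm_triangle_ineq power_mono)
    also have "\<dots> \<le> 2 * (norm (f x))\<^sup>2 + 2 * (norm (g x))\<^sup>2"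
      using sum_squares_bound [of "norm (f x)" "norm (g x)"] by (simp add: power2_sum)
    finally show ?thesis .
  qed
  then have le: "AE x in lebesgue. norm ((norm (f x + g x))\<^sup>2)
      \<le> norm (2 * (norm (f x))\<^sup>2 + 2 * (norm (g x))\<^sup>2)"
    by (intro AE_I2) simp
  have "integrable lebesgue (\<lambda>x. 2 * (norm (f x))\<^sup>2 + 2 * (norm (g x))\<^sup>2)"
    using int by simp
  then have "integrable lebesgue (\<lambda>x. (norm (f x + g x))\<^sup>2)"
    by (rule Bochner_Integration.integrable_bound [OF _ _ le]) measurable
  then show ?thesis
    by (simp add: Lp_fun_2)
qed

lemma Lp_fun_2_uminus: "Lp_fun 2 f \<Longrightarrow> Lp_fun 2 (\<lambda>x. - f x)"
  using Lp_fun_2_scaleR [of f "-1"] by simp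

lemma Lp_fun_2_diff: "Lp_fun 2 f \<Longrightarrow> Lp_fun 2 g \<Longrightarrow> Lp_fun 2 (\<lambda>x. f x - g x)"
  using Lp_fun_2_add [of f "\<lambda>x. - g x"] by (simp add: Lp_fun_2_uminus)

lemma integrable_Lp_fun_2_bound:
  fixes h :: "'a::euclidean_space \<Rightarrow> 'b::{banach, second_countable_topology}"
  assumes "Lp_fun 2 f" "Lp_fun 2 g" "h \<in> borel_measurable lebesgue"
    and le: "\<And>x. norm (h x) \<le> norm (f x) * norm (g x)"
  shows "integrable lebesgue h"
proof (rule Bochner_Integration.integrable_bound)
  show "integrable lebesgue (\<lambda>x. (norm (f x))\<^sup>2 + (norm (g x))\<^sup>2)"
    using assms by (simp add: Lp_fun_2)
  have "norm (h x) \<le> (norm (f x))\<^sup>2 + (norm (g x))\<^sup>2" for x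
  proof -
    have "0 \<le> norm (f x) * norm (g x)" by simp
    then show ?thesis
      using le [of x] sum_squares_bound [of "norm (f x)" "norm (g x)"] by linarith
  qed
  then show "AE x in lebesgue. norm (h x) \<le> norm ((norm (f x))\<^sup>2 + (norm (g x))\<^sup>2)"
    by (intro AE_I2) simp
qed fact

lemma integrable_inner_Lp_fun_2:
  assumes "Lp_fun 2 f" "Lp_fun 2 g"
  shows "integrable lebesgue (\<lambda>x. inner (f x) (g x))"
proof -
  have [measurable]: "f \<in> borel_measurable lebesgue" "g \<in> borel_measurable lebesgue"
    using assms by (simp_all add: Lp_fun_2)
  show ?thesis
    by (rule integrable_Lp_fun_2_bound [OF assms]) (simp_all add: Cauchy_Schwarz_ineq2)
qed

lemma integrable_pairing_Lp_fun_2: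
  assumes "Lp_fun 2 f" "Lp_fun 2 g"
  shows "integrable lebesgue (\<lambda>x. f x * qcnj (g x))"
proof -
  have [measurable]: "f \<in> borel_measurable lebesgue" "g \<in> borel_measurable lebesgue"
    using assms by (simp_all add: Lp_fun_2)
  show ?thesis
    by (rule integrable_Lp_fun_2_bound [OF assms]) (simp_all add: norm_mult)
qed

definition L2_rel :: "('a::euclidean_space \<Rightarrow> quat) \<Rightarrow> ('a \<Rightarrow> quat) \<Rightarrow> bool" where
  "L2_rel f g \<longleftrightarrow> Lp_fun 2 f \<and> Lp_fun 2 g \<and> (AE x in lebesgue. f x = g x)"

quotient_type (overloaded) 'a L2 = "'a::euclidean_space \<Rightarrow> quat" / partial: L2_rel
proof (rule part_equivpI)
  show "\<exists>f. L2_rel f f"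
    using Lp_fun_2_zero by (auto simp: L2_rel_def)
  show "symp L2_rel"
    by (rule sympI) (auto simp: L2_rel_def)
  show "transp L2_rel"
    by (rule transpI) (auto simp: L2_rel_def elim: AE_mp)
qed

instantiation L2 :: (euclidean_space) real_vector
begin

lift_definition zero_L2 :: "'a L2" is "\<lambda>_. 0"
  by (simp add: L2_rel_def Lp_fun_2_zero)

lift_definition plus_L2 :: "'a L2 \<Rightarrow> 'a L2 \<Rightarrow> 'a L2" is "\<lambda>f g x. f x + g x"
  by (auto simp: L2_rel_def Lp_fun_2_add)

lift_definition minus_L2 :: "'a L2 \<Rightarrow> 'a L2 \<Rightarrow> 'a L2" is "\<lambda>f g x. f x - g x"
  by (auto simp: L2_rel_def Lp_fun_2_diff)

lift_definition uminus_L2 :: "'a L2 \<Rightarrow> 'a L2" is "\<lambda>f x. - f x"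
  by (auto simp: L2_rel_def Lp_fun_2_uminus)

lift_definition scaleR_L2 :: "real \<Rightarrow> 'a L2 \<Rightarrow> 'a L2" is "\<lambda>c f x. c *\<^sub>R f x"
  by (auto simp: L2_rel_def Lp_fun_2_scaleR)

instance
proof
  fix f g h :: "'a L2" and a b :: real
  show "f + g + h = f + (g + h)"
    by transfer (auto simp: L2_rel_def Lp_fun_2_add add.assoc)
  show "f + g = g + f"
    by transfer (auto simp: L2_rel_def Lp_fun_2_add add.commute)
  show "0 + f = f"
    by transfer (auto simp: L2_rel_def)
  show "- f + f = 0"
    by transfer (auto simp: L2_rel_def Lp_fun_2_zero)
  show "f - g = f + - g"
    by transfer (auto simp: L2_rel_def Lp_fun_2_diff)
  show "a *\<^sub>R (f + g) = a *\<^sub>R f + a *\<^sub>R g"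
    by transfer (auto simp: L2_rel_def Lp_fun_2_add Lp_fun_2_scaleR scaleR_add_right)
  show "(a + b) *\<^sub>R f = a *\<^sub>R f + b *\<^sub>R f"
    by transfer (auto simp: L2_rel_def Lp_fun_2_add Lp_fun_2_scaleR scaleR_add_left)
  show "a *\<^sub>R b *\<^sub>R f = (a * b) *\<^sub>R f"
    by transfer (auto simp: L2_rel_def Lp_fun_2_scaleR)
  show "1 *\<^sub>R f = f"
    by transfer (auto simp: L2_rel_def)
qed

end

instantiation L2 :: (euclidean_space) real_inner
begin

lift_definition inner_L2 :: "'a L2 \<Rightarrow> 'a L2 \<Rightarrow> real"
  is "\<lambda>f g. \<integral>x. inner (f x) (g x) \<partial>lebesgue"
  by (rule integral_cong_AE) (auto simp: L2_rel_def Lp_fun_2)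

lift_definition norm_L2 :: "'a L2 \<Rightarrow> real" is "\<lambda>f. sqrt (\<integral>x. (norm (f x))\<^sup>2 \<partial>lebesgue)"
  by (rule arg_cong [where f = sqrt], rule integral_cong_AE) (auto simp: L2_rel_def Lp_fun_2)

definition sgn_L2 :: "'a L2 \<Rightarrow> 'a L2" where
  "sgn_L2 f = f /\<^sub>R norm f"

definition dist_L2 :: "'a L2 \<Rightarrow> 'a L2 \<Rightarrow> real" where
  "dist_L2 f g = norm (f - g)"

definition uniformity_L2 :: "('a L2 \<times> 'a L2) filter" where
  "uniformity_L2 = (INF e\<in>{0<..}. principal {(f, g). dist f g < e})"

definition open_L2 :: "'a L2 set \<Rightarrow> bool" where
  "open_L2 U \<longleftrightarrow> (\<forall>f\<in>U. eventually (\<lambda>(f', g). f' = f \<longrightarrow> g \<in> U) uniformity)"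

instance
proof
  fix f g h :: "'a L2" and a :: real and U :: "'a L2 set"
  show "sgn f = f /\<^sub>R norm f" by (rule sgn_L2_def)
  show "dist f g = norm (f - g)" by (rule dist_L2_def)
  show "(uniformity :: ('a L2 \<times> 'a L2) filter) = (INF e\<in>{0<..}. principal {(f, g). dist f g < e})"
    by (rule uniformity_L2_def)
  show "open U \<longleftrightarrow> (\<forall>f\<in>U. eventually (\<lambda>(f', g). f' = f \<longrightarrow> g \<in> U) uniformity)"
    by (rule open_L2_def)
  show "inner f g = inner g f"
    by transfer (simp add: inner_commute)
  show "inner (f + g) h = inner f h + inner g h"
    by transfer (simp add: L2_rel_def inner_add_left integrable_inner_Lp_fun_2)
  show "inner (a *\<^sub>R f) g = a * inner f g"
    by transfer simp
  show "0 \<le> inner f f"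
    by transfer simp
  show "inner f f = 0 \<longleftrightarrow> f = 0"
  proof transfer
    fix f :: "'a \<Rightarrow> quat"
    assume "L2_rel f f"
    then have f: "Lp_fun 2 f" by (simp add: L2_rel_def)
    have "(\<integral>x. inner (f x) (f x) \<partial>lebesgue) = 0 \<longleftrightarrow> (AE x in lebesgue. inner (f x) (f x) = 0)"
      using f by (intro integral_nonneg_eq_0_iff_AE integrable_inner_Lp_fun_2) simp_all
    then show "(\<integral>x. inner (f x) (f x) \<partial>lebesgue) = 0 \<longleftrightarrow> L2_rel f (\<lambda>_. 0)"
      using f by (simp add: L2_rel_def Lp_fun_2_zero)
  qed
  show "norm f = sqrt (inner f f)"
    by transfer (simp add: power2_norm_eq_inner)
qed

end

lift_definition pairing :: "'a::euclidean_space L2 \<Rightarrow> 'a L2 \<Rightarrow> quat"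
  is "\<lambda>f g. \<integral>x. f x * qcnj (g x) \<partial>lebesgue"
proof -
  fix f f' g g' :: "'a \<Rightarrow> quat"
  assume f: "L2_rel f f'" and g: "L2_rel g g'"
  then have [measurable]: "f \<in> borel_measurable lebesgue" "f' \<in> borel_measurable lebesgue"
    "g \<in> borel_measurable lebesgue" "g' \<in> borel_measurable lebesgue"
    by (simp_all add: L2_rel_def Lp_fun_2)
  show "(\<integral>x. f x * qcnj (g x) \<partial>lebesgue) = (\<integral>x. f' x * qcnj (g' x) \<partial>lebesgue)"
    by (rule integral_cong_AE, simp, simp) (use f g in \<open>auto simp: L2_rel_def\<close>)
qed

lemma bounded_linear_q1: "bounded_linear q1"
  by (rule bounded_linear_intro [where K = 1])
    (simp_all add: norm_quat_def real_le_rsqrt)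

lemma inner_L2_eq_pairing: "inner f g = q1 (pairing f g)"
proof transfer
  fix f g :: "'a \<Rightarrow> quat"
  assume "L2_rel f f" "L2_rel g g"
  then have "integrable lebesgue (\<lambda>x. f x * qcnj (g x))"
    by (simp add: L2_rel_def integrable_pairing_Lp_fun_2)
  from integral_bounded_linear [OF bounded_linear_q1 this]
  show "(\<integral>x. inner (f x) (g x) \<partial>lebesgue) = q1 (\<integral>x. f x * qcnj (g x) \<partial>lebesgue)"
    by (simp only: inner_quat_eq)
qed

section \<open>The Wigner transform\<close>

lemma lebesgue_affine_scaleR:
  fixes x :: "'a::euclidean_space"
  assumes "c \<noteq> 0"
  shows measurable_affine_scaleR: "(\<lambda>p. x + c *\<^sub>R p) \<in> lebesgue \<rightarrow>\<^sub>M lebesgue"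
    and lebesgue_eq_affine_scaleR:
      "density (distr lebesgue lebesgue (\<lambda>p. x + c *\<^sub>R p)) (\<lambda>_. ennreal (\<bar>c\<bar> ^ DIM('a))) = lebesgue"
proof -
  have T: "(\<lambda>p. x + (\<Sum>j\<in>Basis. (c * (p \<bullet> j)) *\<^sub>R j)) = (\<lambda>p. x + c *\<^sub>R p)"
    by (simp add: euclidean_representation flip: scaleR_scaleR scaleR_sum_right)
  show "(\<lambda>p. x + c *\<^sub>R p) \<in> lebesgue \<rightarrow>\<^sub>M lebesgue"
    using lebesgue_affine_measurable [of "\<lambda>_. c" x] assms by (simp only: T simp_thms)
  show "density (distr lebesgue lebesgue (\<lambda>p. x + c *\<^sub>R p)) (\<lambda>_. ennreal (\<bar>c\<bar> ^ DIM('a))) = lebesgue"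
    using lebesgue_affine_euclidean [of "\<lambda>_. c" x, symmetric] assms
    by (simp only: T simp_thms prod_constant)
qed

lemma AE_affine_scaleR:
  fixes x :: "'a::euclidean_space"
  assumes "c \<noteq> 0" "AE y in lebesgue. P y"
  shows "AE p in lebesgue. P (x + c *\<^sub>R p)"
proof -
  have "AE y in density (distr lebesgue lebesgue (\<lambda>p. x + c *\<^sub>R p)) (\<lambda>_. ennreal (\<bar>c\<bar> ^ DIM('a))). P y"
    unfolding lebesgue_eq_affine_scaleR [OF assms(1)] by (rule assms(2))
  then have "AE y in distr lebesgue lebesgue (\<lambda>p. x + c *\<^sub>R p). P y"
    using assms(1) by (subst (asm) AE_density) simp_all
  then show ?thesis
    by (rule AE_distrD [OF measurable_affine_scaleR [OF assms(1)]])
qed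

lemma Lp_fun_2_affine_scaleR:
  fixes x :: "'a::euclidean_space"
  assumes c: "c \<noteq> 0" and f: "Lp_fun 2 f"
  shows "Lp_fun 2 (\<lambda>p. f (x + c *\<^sub>R p))"
    and "\<bar>c\<bar> ^ DIM('a) * (\<integral>p. (norm (f (x + c *\<^sub>R p)))\<^sup>2 \<partial>lebesgue) = (\<integral>y. (norm (f y))\<^sup>2 \<partial>lebesgue)"
proof -
  define T where "T = (\<lambda>p. x + c *\<^sub>R p)"
  define k where "k = \<bar>c\<bar> ^ DIM('a)"
  define h where "h = (\<lambda>y. (norm (f y))\<^sup>2)"
  have k: "0 < k" using c by (simp add: k_def)
  have T [measurable]: "T \<in> lebesgue \<rightarrow>\<^sub>M lebesgue"
    unfolding T_def by (rule measurable_affine_scaleR [OF c])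
  have leb: "density (distr lebesgue lebesgue T) (\<lambda>_. ennreal k) = lebesgue"
    unfolding T_def k_def by (rule lebesgue_eq_affine_scaleR [OF c])
  have fm [measurable]: "f \<in> borel_measurable lebesgue"
    and hi: "integrable lebesgue h"
    using f by (simp_all add: Lp_fun_2 h_def)
  have hm [measurable]: "h \<in> borel_measurable lebesgue"
    unfolding h_def by measurable
  have hd: "h \<in> borel_measurable (distr lebesgue lebesgue T)"
    using hm by simp
  have "integrable (density (distr lebesgue lebesgue T) (\<lambda>_. ennreal k)) h"
    unfolding leb by (rule hi)
  then have "integrable (distr lebesgue lebesgue T) (\<lambda>y. k *\<^sub>R h y)"
    using k hd by (subst (asm) integrable_density) simp_all
  then have "integrable lebesgue (\<lambda>p. k *\<^sub>R h (T p))"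
    by (subst (asm) integrable_distr_eq) (simp_all add: borel_measurable_scaleR)
  then have "integrable lebesgue (\<lambda>p. h (T p))"
    using k by simp
  moreover have "(\<lambda>p. f (T p)) \<in> borel_measurable lebesgue"
    by measurable
  ultimately show "Lp_fun 2 (\<lambda>p. f (x + c *\<^sub>R p))"
    by (simp add: Lp_fun_2 h_def T_def)
  have "(\<integral>y. h y \<partial>density (distr lebesgue lebesgue T) (\<lambda>_. ennreal k))
      = (\<integral>y. k *\<^sub>R h y \<partial>distr lebesgue lebesgue T)"
    using k hd by (intro integral_density) simp_all
  also have "\<dots> = (\<integral>p. k *\<^sub>R h (T p) \<partial>lebesgue)"
    by (rule integral_distr) (simp_all add: borel_measurable_scaleR)
  finally show "\<bar>c\<bar> ^ DIM('a) * (\<integral>p. (norm (f (x + c *\<^sub>R p)))\<^sup>2 \<partial>lebesgue) = (\<integral>y. (norm (f y))\<^sup>2 \<partial>lebesgue)"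
    unfolding leb by (simp add: h_def T_def k_def)
qed

lemma exp_quat_unit:
  assumes "u * u = (-1 :: quat)"
  shows "exp (t *\<^sub>R u) = cos t *\<^sub>R 1 + sin t *\<^sub>R u"
proof -
  have even: "u ^ (2 * n) = (-1) ^ n" for n
    by (simp add: power_mult power2_eq_square assms)
  have "(\<lambda>n. (t *\<^sub>R u) ^ n /\<^sub>R fact n) = (\<lambda>n. (cos_coeff n * t ^ n) *\<^sub>R 1 + (sin_coeff n * t ^ n) *\<^sub>R u)"
  proof
    fix n
    show "(t *\<^sub>R u) ^ n /\<^sub>R fact n = (cos_coeff n * t ^ n) *\<^sub>R 1 + (sin_coeff n * t ^ n) *\<^sub>R u"
    proof (cases "even n")
      case True
      then obtain m where "n = 2 * m" by blast
      then show ?thesis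
        by (cases "even m") (simp_all add: cos_coeff_def sin_coeff_def scaleR_power even divide_inverse_commute)
    next
      case False
      then obtain m where "n = 2 * m + 1" by (elim oddE)
      then show ?thesis
        by (cases "even m") (simp_all add: cos_coeff_def sin_coeff_def scaleR_power even divide_inverse_commute)
    qed
  qed
  moreover have "(\<lambda>n. (t *\<^sub>R u) ^ n /\<^sub>R fact n) sums exp (t *\<^sub>R u)"
    by (rule exp_converges)
  moreover have "(\<lambda>n. (cos_coeff n * t ^ n) *\<^sub>R 1 + (sin_coeff n * t ^ n) *\<^sub>R u) sums (cos t *\<^sub>R 1 + sin t *\<^sub>R u)"
    using cos_converges [of t] sin_converges [of t] by (intro sums_add sums_scaleR_left) simp_all
  ultimately show ?thesis
    using sums_unique2 by metis
qed

lemma norm_exp_quat_unit [simp]: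
  "norm (exp (t *\<^sub>R quat_i)) = 1" "norm (exp (t *\<^sub>R quat_j)) = 1"
  by (simp_all add: exp_quat_unit hamilton_relations norm_quat_def)

definition wigner_integrand ::
    "(real^2 \<Rightarrow> quat) \<Rightarrow> (real^2 \<Rightarrow> quat) \<Rightarrow> real^2 \<Rightarrow> real^2 \<Rightarrow> real^2 \<Rightarrow> quat" where
  "wigner_integrand f g x \<xi> p =
     exp ((- 2 * pi * (\<xi> $ 1) * (p $ 1)) *\<^sub>R quat_i) * f (x + (1/2) *\<^sub>R p) *
     qcnj (g (x - (1/2) *\<^sub>R p)) * exp ((- 2 * pi * (\<xi> $ 2) * (p $ 2)) *\<^sub>R quat_j)"

definition wigner_fun ::
    "(real^2 \<Rightarrow> quat) \<Rightarrow> (real^2 \<Rightarrow> quat) \<Rightarrow> (real^2) \<times> (real^2) \<Rightarrow> quat" where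
  "wigner_fun f g = (\<lambda>(x, \<xi>). \<integral>p. wigner_integrand f g x \<xi> p \<partial>lebesgue)"

lemma norm_wigner_integrand:
  "norm (wigner_integrand f g x \<xi> p) = norm (f (x + (1/2) *\<^sub>R p)) * norm (g (x - (1/2) *\<^sub>R p))"
  by (simp add: wigner_integrand_def norm_mult del: scaleR_minus_left mult_minus_left)

lemma Lp_fun_2_half_shift:
  fixes x :: "real^2"
  assumes "Lp_fun 2 f"
  shows "Lp_fun 2 (\<lambda>p. f (x + (1/2) *\<^sub>R p))" "Lp_fun 2 (\<lambda>p. f (x - (1/2) *\<^sub>R p))"
  using Lp_fun_2_affine_scaleR(1) [OF _ assms, of "1/2" x]
    Lp_fun_2_affine_scaleR(1) [OF _ assms, of "-1/2" x] by simp_all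

lemma borel_measurable_wigner_integrand:
  assumes "Lp_fun 2 f" "Lp_fun 2 g"
  shows "wigner_integrand f g x \<xi> \<in> borel_measurable lebesgue"
proof -
  have [measurable]: "(\<lambda>p. f (x + (1/2) *\<^sub>R p)) \<in> borel_measurable lebesgue"
    "(\<lambda>p. g (x - (1/2) *\<^sub>R p)) \<in> borel_measurable lebesgue"
    using assms [THEN Lp_fun_2_half_shift(1), of x] assms [THEN Lp_fun_2_half_shift(2), of x]
    by (simp_all only: Lp_fun_2)
  have "(\<lambda>p::real^2. exp ((- 2 * pi * (\<xi> $ 1) * (p $ 1)) *\<^sub>R quat_i)) \<in> borel_measurable borel"
    "(\<lambda>p::real^2. exp ((- 2 * pi * (\<xi> $ 2) * (p $ 2)) *\<^sub>R quat_j)) \<in> borel_measurable borel"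
    by (simp_all only: exp_quat_unit hamilton_relations,
        intro borel_measurable_continuous_onI continuous_intros)
      (intro borel_measurable_continuous_onI continuous_intros)
  then have [measurable]:
    "(\<lambda>p::real^2. exp ((- 2 * pi * (\<xi> $ 1) * (p $ 1)) *\<^sub>R quat_i)) \<in> borel_measurable lebesgue"
    "(\<lambda>p::real^2. exp ((- 2 * pi * (\<xi> $ 2) * (p $ 2)) *\<^sub>R quat_j)) \<in> borel_measurable lebesgue"
    by (auto intro!: measurable_completion simp only: measurable_lborel1 measurable_lborel2)
  show ?thesis
    unfolding wigner_integrand_def [abs_def] by measurable
qed

lemma integrable_wigner_integrand:
  assumes "Lp_fun 2 f" "Lp_fun 2 g"
  shows "integrable lebesgue (wigner_integrand f g x \<xi>)"
  by (rule integrable_Lp_fun_2_bound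
      [OF Lp_fun_2_half_shift(1) [OF assms(1), of x] Lp_fun_2_half_shift(2) [OF assms(2), of x]
        borel_measurable_wigner_integrand [OF assms]])
    (simp only: norm_wigner_integrand order_refl)

lemma Cauchy_Schwarz_Lp_fun_2:
  fixes f g :: "'a::euclidean_space \<Rightarrow> quat"
  assumes "Lp_fun 2 f" "Lp_fun 2 g"
  shows "(\<integral>x. norm (f x) * norm (g x) \<partial>lebesgue)
    \<le> sqrt (\<integral>x. (norm (f x))\<^sup>2 \<partial>lebesgue) * sqrt (\<integral>x. (norm (g x))\<^sup>2 \<partial>lebesgue)"
proof -
  let ?n = "\<lambda>f x. of_real (norm (f x)) :: quat"
  have rel: "L2_rel (?n h) (?n h)" if "Lp_fun 2 h" for h :: "'a \<Rightarrow> quat"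
  proof -
    have [measurable]: "h \<in> borel_measurable lebesgue"
      using that by (simp add: Lp_fun_2)
    have "?n h \<in> borel_measurable lebesgue"
      by measurable
    then show ?thesis
      using that by (simp add: L2_rel_def Lp_fun_2)
  qed
  have "inner (abs_L2 (?n f)) (abs_L2 (?n g)) \<le> norm (abs_L2 (?n f)) * norm (abs_L2 (?n g))"
    by (rule norm_cauchy_schwarz)
  then show ?thesis
    using rel [OF assms(1)] rel [OF assms(2)]
    by (simp add: inner_L2.abs_eq norm_L2.abs_eq) (simp add: inner_quat_def of_real_def)
qed

text \<open>
  For \<^term>\<open>f\<close> and \<^term>\<open>g\<close> in $L^2$ the defining integral converges absolutely at every point.  The
  resulting map is real bilinear (\<open>wigner_bilinear\<close>) and bounded from $L^2 \times L^2$ to $L^\infty$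
  (\<open>wigner_bound\<close>), hence it is the continuous extension of the Wigner transform of Schwartz functions.
\<close>

lift_definition wigner :: "(real^2) L2 \<Rightarrow> (real^2) L2 \<Rightarrow> (real^2) \<times> (real^2) \<Rightarrow> quat" is wigner_fun
proof -
  fix f f' g g' :: "real^2 \<Rightarrow> quat"
  assume f: "L2_rel f f'" and g: "L2_rel g g'"
  have "(\<integral>p. wigner_integrand f g x \<xi> p \<partial>lebesgue) = (\<integral>p. wigner_integrand f' g' x \<xi> p \<partial>lebesgue)" for x \<xi>
  proof (rule integral_cong_AE)
    show "wigner_integrand f g x \<xi> \<in> borel_measurable lebesgue"
      "wigner_integrand f' g' x \<xi> \<in> borel_measurable lebesgue"
      using f g by (simp_all add: L2_rel_def borel_measurable_wigner_integrand)
    have "AE p in lebesgue. f (x + (1/2) *\<^sub>R p) = f' (x + (1/2) *\<^sub>R p)"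
      using f by (intro AE_affine_scaleR) (simp_all add: L2_rel_def)
    moreover have "AE p in lebesgue. g (x + (-1/2) *\<^sub>R p) = g' (x + (-1/2) *\<^sub>R p)"
      using g by (intro AE_affine_scaleR) (simp_all add: L2_rel_def)
    ultimately show "AE p in lebesgue. wigner_integrand f g x \<xi> p = wigner_integrand f' g' x \<xi> p"
      by eventually_elim (simp add: wigner_integrand_def)
  qed
  then show "wigner_fun f g = wigner_fun f' g'"
    by (simp add: wigner_fun_def)
qed

lemma wigner_bound: "norm (wigner f g z) \<le> 4 * norm f * norm g"
proof transfer
  fix f g :: "real^2 \<Rightarrow> quat" and z :: "(real^2) \<times> (real^2)"
  assume "L2_rel f f" "L2_rel g g"
  then have f: "Lp_fun 2 f" and g: "Lp_fun 2 g" by (simp_all add: L2_rel_def)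
  obtain x \<xi> where z: "z = (x, \<xi>)" by (cases z)
  have f2: "(\<integral>p. (norm (f (x + (1/2) *\<^sub>R p)))\<^sup>2 \<partial>lebesgue) = 4 * (\<integral>y. (norm (f y))\<^sup>2 \<partial>lebesgue)"
    using Lp_fun_2_affine_scaleR(2) [OF _ f, of "1/2" x] by (simp add: power2_eq_square)
  have g2: "(\<integral>p. (norm (g (x - (1/2) *\<^sub>R p)))\<^sup>2 \<partial>lebesgue) = 4 * (\<integral>y. (norm (g y))\<^sup>2 \<partial>lebesgue)"
    using Lp_fun_2_affine_scaleR(2) [OF _ g, of "-1/2" x] by (simp add: power2_eq_square)
  have "norm (wigner_fun f g z) \<le> (\<integral>p. norm (wigner_integrand f g x \<xi> p) \<partial>lebesgue)"
    unfolding wigner_fun_def z by (simp add: integral_norm_bound)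
  also have "\<dots> \<le> sqrt (\<integral>p. (norm (f (x + (1/2) *\<^sub>R p)))\<^sup>2 \<partial>lebesgue)
      * sqrt (\<integral>p. (norm (g (x - (1/2) *\<^sub>R p)))\<^sup>2 \<partial>lebesgue)"
    unfolding norm_wigner_integrand
    by (rule Cauchy_Schwarz_Lp_fun_2 [OF Lp_fun_2_half_shift(1) [OF f] Lp_fun_2_half_shift(2) [OF g]])
  also have "\<dots> = 4 * sqrt (\<integral>y. (norm (f y))\<^sup>2 \<partial>lebesgue) * sqrt (\<integral>y. (norm (g y))\<^sup>2 \<partial>lebesgue)"
    unfolding f2 g2 by (simp add: real_sqrt_mult)
  finally show "norm (wigner_fun f g z)
      \<le> 4 * sqrt (\<integral>y. (norm (f y))\<^sup>2 \<partial>lebesgue) * sqrt (\<integral>y. (norm (g y))\<^sup>2 \<partial>lebesgue)" .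
qed

lemma qcnj_add: "qcnj (x + y) = qcnj x + qcnj y" and qcnj_scaleR: "qcnj (c *\<^sub>R x) = c *\<^sub>R qcnj x"
  by (simp_all add: quat_eq_iff)

lemma wigner_bilinear:
  "wigner (f + f') g z = wigner f g z + wigner f' g z"
  "wigner f (g + g') z = wigner f g z + wigner f g' z"
  "wigner (c *\<^sub>R f) g z = c *\<^sub>R wigner f g z"
  "wigner f (c *\<^sub>R g) z = c *\<^sub>R wigner f g z"
proof -
  show "wigner (f + f') g z = wigner f g z + wigner f' g z"
  proof transfer
    fix f f' g :: "real^2 \<Rightarrow> quat" and z :: "(real^2) \<times> (real^2)"
    assume "L2_rel f f" "L2_rel f' f'" "L2_rel g g"
    moreover have "wigner_integrand (\<lambda>x. f x + f' x) g x \<xi> p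
        = wigner_integrand f g x \<xi> p + wigner_integrand f' g x \<xi> p" for x \<xi> p
      by (simp only: wigner_integrand_def distrib_left distrib_right)
    ultimately show "wigner_fun (\<lambda>x. f x + f' x) g z = wigner_fun f g z + wigner_fun f' g z"
      by (cases z) (simp add: wigner_fun_def L2_rel_def integrable_wigner_integrand)
  qed
  show "wigner f (g + g') z = wigner f g z + wigner f g' z"
  proof transfer
    fix f g g' :: "real^2 \<Rightarrow> quat" and z :: "(real^2) \<times> (real^2)"
    assume "L2_rel f f" "L2_rel g g" "L2_rel g' g'"
    moreover have "wigner_integrand f (\<lambda>x. g x + g' x) x \<xi> p
        = wigner_integrand f g x \<xi> p + wigner_integrand f g' x \<xi> p" for x \<xi> p
      by (simp only: wigner_integrand_def qcnj_add distrib_left distrib_right)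
    ultimately show "wigner_fun f (\<lambda>x. g x + g' x) z = wigner_fun f g z + wigner_fun f g' z"
      by (cases z) (simp add: wigner_fun_def L2_rel_def integrable_wigner_integrand)
  qed
  show "wigner (c *\<^sub>R f) g z = c *\<^sub>R wigner f g z"
    by transfer (simp add: wigner_fun_def wigner_integrand_def split_beta)
  show "wigner f (c *\<^sub>R g) z = c *\<^sub>R wigner f g z"
    by transfer (simp add: wigner_fun_def wigner_integrand_def qcnj_scaleR split_beta)
qed


section \<open>The Weyl transform\<close>

definition weyl_form :: "((real^2) \<times> (real^2) \<Rightarrow> quat) \<Rightarrow> (real^2) L2 \<Rightarrow> (real^2) L2 \<Rightarrow> quat" where
  "weyl_form \<sigma> f g = (\<integral>z. \<sigma> z * wigner f g z \<partial>lebesgue)"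

text \<open>
  The defining identity determines the operator (\<open>is_weyl_transform_unique\<close>), but for a general symbol there
  need not be an operator that satisfies it: \<^term>\<open>\<lambda>g. pairing h g\<close> turns left multiplication of \<^term>\<open>g\<close> by a
  quaternion \<open>q\<close> into right multiplication by \<^term>\<open>qcnj q\<close>, while the factor with \<^const>\<open>quat_j\<close> to the right of
  \<open>qcnj (g _)\<close> in \<^term>\<open>wigner f g\<close> need not commute with \<^term>\<open>qcnj q\<close>.  For
  $\sigma(x,\xi) = \varphi(x)\psi(\xi_1)\psi(\xi_2)$ with real $\varphi$ and odd real $\psi$, which satisfies
  $\sigma(x,\xi) = \sigma(x,-\xi)$, the form is $\int\int a(x,p)\, i f(x + p/2) \overline{g(x - p/2)} j\,dx\,dp$
  with real $a$, and this is not of the form $\langle h, g\rangle$ unless it vanishes.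
  The scalar part of the identity alone also determines the operator, because the scalar part of
  \<^const>\<open>pairing\<close> is the real inner product of $L^2$ (\<open>inner_L2_eq_pairing\<close>).
\<close>

definition is_weyl_transform ::
    "((real^2) \<times> (real^2) \<Rightarrow> quat) \<Rightarrow> ((real^2) L2 \<Rightarrow> (real^2) L2) \<Rightarrow> bool" where
  "is_weyl_transform \<sigma> W \<longleftrightarrow> (\<forall>f g. pairing (W f) g = weyl_form \<sigma> f g)"

definition is_scalar_weyl_transform ::
    "((real^2) \<times> (real^2) \<Rightarrow> quat) \<Rightarrow> ((real^2) L2 \<Rightarrow> (real^2) L2) \<Rightarrow> bool" where
  "is_scalar_weyl_transform \<sigma> W \<longleftrightarrow> (\<forall>f g. q1 (pairing (W f) g) = q1 (weyl_form \<sigma> f g))"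

lemma is_weyl_transform_imp_scalar: "is_weyl_transform \<sigma> W \<Longrightarrow> is_scalar_weyl_transform \<sigma> W"
  by (simp add: is_weyl_transform_def is_scalar_weyl_transform_def)

lemma is_scalar_weyl_transform_unique:
  assumes "is_scalar_weyl_transform \<sigma> V" "is_scalar_weyl_transform \<sigma> W"
  shows "V = W"
proof
  fix f
  have "inner (V f) g = inner (W f) g" for g
    using assms by (simp add: is_scalar_weyl_transform_def inner_L2_eq_pairing)
  then have "inner (V f - W f) (V f - W f) = 0"
    by (simp only: inner_diff_left cancel_comm_monoid_add_class.diff_cancel)
  then show "V f = W f"
    by simp
qed

lemma is_weyl_transform_unique:
  "is_weyl_transform \<sigma> V \<Longrightarrow> is_weyl_transform \<sigma> W \<Longrightarrow> V = W"
  using is_scalar_weyl_transform_unique is_weyl_transform_imp_scalar by blast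

definition compact_operator :: "('a::real_normed_vector \<Rightarrow> 'b::real_normed_vector) \<Rightarrow> bool" where
  "compact_operator T \<longleftrightarrow> bounded_linear T \<and> (\<forall>B. bounded B \<longrightarrow> compact (closure (T ` B)))"

end

theory Submission
  imports Defs "HOL-Probability.Characteristic_Functions"
begin

text \<open>
  The scalar part of the Weyl form is a real bilinear form on the real Hilbert space $L^2$, so it suffices to write it
  as \<open>inner (T f) g\<close> with a compact \<open>T\<close>.  The forms with such a \<open>T\<close> are closed under limits that are uniform on
  bounded sets, and they include all Hilbert-Schmidt forms, since these are limits of forms of finite rank.
  The scalar part of a product of quaternions is cyclic.  Hence the square of the two-sided Fourier transform can be
  integrated against a Gaussian as in the complex case, which gives a Plancherel inequality.  For a symbol in
  $L^1 \cap L^2$ the exponentials can be moved from the Wigner transform to the symbol, and by the Plancherel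
  inequality the form then has a square integrable kernel.  A symbol in $L^r$ is the sum of one in $L^1$ (where it exceeds $1$ in
  modulus) and one in $L^2$; both parts are approximated by truncations in $L^1 \cap L^2$.  The errors are
  controlled by the bounds of the Wigner transform in $L^\infty$ and, by the Plancherel inequality again, in $L^2$.
\<close>

section \<open>Borel representatives and completeness of $L^2$\<close>

text \<open>Fubini dictates the lower layer. \<open>Lp_fun\<close> refers to the completed measure
  \<open>lebesgue\<close>, and a product of completed measures is not complete; with Borel
  representatives all double integrals are taken over \<open>lborel\<close>, where
  \<open>lborel_prod\<close> applies. Non-commutativity shapes the rest. The two exponentials stand
  on different sides of the integrand and cannot be merged, and the transform is not quaternion
  linear on either side. What survives is that left and right multiplication have adjoints for the
  real inner product, namely multiplication by the conjugate; every exponential is moved by this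
  rule alone. Completeness of L^2 is needed because operators do not come from a representation
  theorem: they are explicit for forms of rank one, and for other forms they arise as sums and
  pointwise limits. Only upper bounds enter, so Plancherel is needed as an inequality; neither an
  inversion formula nor a dense class of functions appears.\<close>

definition borel_L2 :: "('a::euclidean_space \<Rightarrow> quat) \<Rightarrow> bool" where
  "borel_L2 h \<longleftrightarrow> h \<in> borel_measurable borel \<and> integrable lborel (\<lambda>x. (norm (h x))\<^sup>2)"

lemma borel_L2_measurable [measurable_dest]: "borel_L2 h \<Longrightarrow> h \<in> borel_measurable borel"
  by (simp add: borel_L2_def)

lemma borel_L2_integrable: "borel_L2 h \<Longrightarrow> integrable lborel (\<lambda>x. (norm (h x))\<^sup>2)"
  by (simp add: borel_L2_def)

lemma borel_L2_iff_nn_integral: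
  "borel_L2 h \<longleftrightarrow> h \<in> borel_measurable borel \<and> (\<integral>\<^sup>+x. ennreal ((norm (h x))\<^sup>2) \<partial>lborel) < \<infinity>"
  by (auto simp: borel_L2_def integrable_iff_bounded)

lemma borel_imp_lebesgue_measurable: "h \<in> borel_measurable borel \<Longrightarrow> h \<in> borel_measurable lebesgue"
  by (auto intro!: measurable_completion)

lemma borel_L2_imp_Lp_fun: "borel_L2 h \<Longrightarrow> Lp_fun 2 h"
  by (auto simp: borel_L2_def Lp_fun_2 integrable_completion borel_imp_lebesgue_measurable)

lemma borel_L2_rel: "borel_L2 h \<Longrightarrow> L2_rel h h"
  by (simp add: L2_rel_def borel_L2_imp_Lp_fun)

lemma norm_abs_L2: "borel_L2 h \<Longrightarrow> (norm (abs_L2 h))\<^sup>2 = (\<integral>x. (norm (h x))\<^sup>2 \<partial>lborel)"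
  by (simp add: norm_L2.abs_eq borel_L2_rel borel_L2_measurable integral_completion)

lemma ennreal_norm_abs_L2:
  "borel_L2 h \<Longrightarrow> ennreal ((norm (abs_L2 h))\<^sup>2) = (\<integral>\<^sup>+x. ennreal ((norm (h x))\<^sup>2) \<partial>lborel)"
  by (simp add: norm_abs_L2 nn_integral_eq_integral borel_L2_integrable)

lemma borel_L2_diff: "borel_L2 f \<Longrightarrow> borel_L2 g \<Longrightarrow> borel_L2 (\<lambda>x. f x - g x)"
  using Lp_fun_2_diff[of f g] borel_L2_imp_Lp_fun[of f] borel_L2_imp_Lp_fun[of g]
  by (auto simp: borel_L2_def Lp_fun_2 integrable_completion)

lemma borel_L2_add: "borel_L2 f \<Longrightarrow> borel_L2 g \<Longrightarrow> borel_L2 (\<lambda>x. f x + g x)"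
  using Lp_fun_2_add[of f g] borel_L2_imp_Lp_fun[of f] borel_L2_imp_Lp_fun[of g]
  by (auto simp: borel_L2_def Lp_fun_2 integrable_completion)

lemma borel_L2_bound:
  assumes "borel_L2 h" "f \<in> borel_measurable borel" "\<And>x. norm (f x) \<le> c * norm (h x)"
  shows "borel_L2 f"
proof -
  have "(norm (f x))\<^sup>2 \<le> c\<^sup>2 * (norm (h x))\<^sup>2" for x
    using assms(3)[of x] by (metis norm_ge_zero power_mono power_mult_distrib)
  moreover have "integrable lborel (\<lambda>x. c\<^sup>2 * (norm (h x))\<^sup>2)"
    using assms(1) by (simp add: borel_L2_integrable)
  ultimately have "integrable lborel (\<lambda>x. (norm (f x))\<^sup>2)"
    using assms(2) by - (rule Bochner_Integration.integrable_bound, assumption, measurable, auto)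
  then show ?thesis using assms(2) by (simp add: borel_L2_def)
qed

lemma abs_L2_diff:
  "borel_L2 f \<Longrightarrow> borel_L2 g \<Longrightarrow> abs_L2 (\<lambda>x. f x - g x) = abs_L2 f - abs_L2 g"
  by (simp add: minus_L2.abs_eq borel_L2_rel)

lemma abs_L2_add:
  "borel_L2 f \<Longrightarrow> borel_L2 g \<Longrightarrow> abs_L2 (\<lambda>x. f x + g x) = abs_L2 f + abs_L2 g"
  by (simp add: plus_L2.abs_eq borel_L2_rel)

lemma inner_abs_L2:
  assumes "borel_L2 f" "borel_L2 g"
  shows "inner (abs_L2 f) (abs_L2 g) = (\<integral>x. inner (f x) (g x) \<partial>lborel)"
  using assms by (simp add: inner_L2.abs_eq borel_L2_rel borel_L2_measurable integral_completion)

lemma integrable_inner_borel_L2: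
  assumes "borel_L2 f" "borel_L2 g"
  shows "integrable lborel (\<lambda>x. inner (f x) (g x))"
  using integrable_inner_Lp_fun_2[OF assms[THEN borel_L2_imp_Lp_fun]] assms
  by (simp add: integrable_completion borel_L2_measurable)

text \<open>Each of the four real coordinates has a Borel version. As \<open>Basis\<close> is
  finite, the exceptional null sets combine and the coordinates can be reassembled.\<close>

lemma ex_borel_AE_eq:
  fixes h :: "'a::euclidean_space \<Rightarrow> quat"
  assumes "h \<in> borel_measurable lebesgue"
  shows "\<exists>h'\<in>borel_measurable borel. AE x in lebesgue. h x = h' x"
proof -
  have "\<forall>b\<in>Basis. \<exists>g'\<in>borel_measurable lborel. AE x in lborel. inner (h x) b = g' x"
    using assms by (intro ballI completion_ex_borel_measurable_real borel_measurable_inner) auto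
  then obtain g where g: "\<And>b. b \<in> Basis \<Longrightarrow> g b \<in> borel_measurable lborel"
      "\<And>b. b \<in> Basis \<Longrightarrow> AE x in lborel. inner (h x) b = g b x"
    by metis
  define h' where "h' x = (\<Sum>b\<in>Basis. g b x *\<^sub>R b)" for x
  have "AE x in lborel. \<forall>b\<in>Basis. inner (h x) b = g b x"
    using g(2) by (intro AE_finite_allI) auto
  then have "AE x in lborel. h x = h' x"
  proof eventually_elim
    case (elim x)
    have "h' x = (\<Sum>b\<in>Basis. inner (h x) b *\<^sub>R b)"
      unfolding h'_def using elim by (intro sum.cong) auto
    then show ?case by (simp add: euclidean_representation)
  qed
  moreover have "h' \<in> borel_measurable borel"
    using g(1) unfolding h'_def by (intro borel_measurable_sum borel_measurable_scaleR) auto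
  ultimately show ?thesis
    by (auto intro: AE_completion)
qed

lemma ex_borel_L2_rep: "\<exists>h. borel_L2 h \<and> abs_L2 h = f"
proof -
  obtain f0 where f0: "L2_rel f0 f0" "f = abs_L2 f0"
    using Quotient_L2 by (metis Quotient_alt_def2 Quotient_def)
  then have m: "Lp_fun 2 f0" by (simp add: L2_rel_def)
  then obtain h where h: "h \<in> borel_measurable borel" "AE x in lebesgue. f0 x = h x"
    using ex_borel_AE_eq by (auto simp: Lp_fun_2)
  have "integrable lebesgue (\<lambda>x. (norm (h x))\<^sup>2)"
  proof (rule Bochner_Integration.integrable_cong_AE_imp[where g="\<lambda>x. (norm (f0 x))\<^sup>2"])
    show "integrable lebesgue (\<lambda>x. (norm (f0 x))\<^sup>2)" using m by (simp add: Lp_fun_2)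
    show "(\<lambda>x. (norm (h x))\<^sup>2) \<in> borel_measurable lebesgue"
      using borel_imp_lebesgue_measurable[OF h(1)] by measurable
    show "AE x in lebesgue. (norm (f0 x))\<^sup>2 = (norm (h x))\<^sup>2"
      using h(2) by eventually_elim simp
  qed
  then have "borel_L2 h"
    using h(1) by (simp add: borel_L2_def integrable_completion)
  moreover have "abs_L2 h = f"
  proof -
    have "L2_rel f0 h" using m h \<open>borel_L2 h\<close> by (simp add: L2_rel_def borel_L2_imp_Lp_fun)
    then show ?thesis using f0(2) Quotient_L2 by (metis Quotient_rel_abs)
  qed
  ultimately show ?thesis by blast
qed

text \<open>A fixed Borel representative of each class allows pointwise products such as
  \<open>tensor\<close> and \<open>correlation\<close> to be formed from elements of L^2.\<close>

definition rep :: "'a::euclidean_space L2 \<Rightarrow> 'a \<Rightarrow> quat" where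
  "rep f = (SOME h. borel_L2 h \<and> abs_L2 h = f)"

lemma borel_L2_rep [simp]: "borel_L2 (rep f)" and abs_L2_rep [simp]: "abs_L2 (rep f) = f"
  using someI_ex[OF ex_borel_L2_rep[of f]] by (simp_all add: rep_def)

lemma rep_measurable [measurable]: "rep f \<in> borel_measurable borel"
  by (rule borel_L2_measurable) simp

lemma nn_integral_rep: "(\<integral>\<^sup>+x. ennreal ((norm (rep f x))\<^sup>2) \<partial>lborel) = ennreal ((norm f)\<^sup>2)"
  using ennreal_norm_abs_L2[of "rep f"] by simp

text \<open>Dominated convergence for the squared differences: \<open>s n\<close> and its limit obey
  the same bound, so the difference is at most \<open>2 * c * norm (h x)\<close>.\<close>

lemma L2_tendsto_dominated:
  fixes h :: "'a::euclidean_space \<Rightarrow> quat"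
  assumes h: "borel_L2 h" and s: "\<And>n. s n \<in> borel_measurable borel" and f: "f \<in> borel_measurable borel"
    and le: "\<And>n x. norm (s n x) \<le> c * norm (h x)" and lim: "\<And>x. (\<lambda>n. s n x) \<longlonglongrightarrow> f x"
  shows "(\<lambda>n. abs_L2 (s n)) \<longlonglongrightarrow> abs_L2 f" "borel_L2 f"
proof -
  note [measurable] = s f borel_L2_measurable[OF h]
  have lef: "norm (f x) \<le> c * norm (h x)" for x
    using lim[of x, THEN tendsto_norm] by (rule LIMSEQ_le_const2) (auto intro: le)
  have S: "borel_L2 (s n)" for n by (rule borel_L2_bound[OF h s le])
  show F: "borel_L2 f" by (rule borel_L2_bound[OF h f lef])
  have "(\<lambda>n. \<integral>x. (norm (s n x - f x))\<^sup>2 \<partial>lborel) \<longlonglongrightarrow> (\<integral>x. 0 \<partial>(lborel :: 'a measure))"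
  proof (rule integral_dominated_convergence[where s="\<lambda>n x. (norm (s n x - f x))\<^sup>2"
        and f="\<lambda>x. 0::real" and w="\<lambda>x. (2*c)\<^sup>2 * (norm (h x))\<^sup>2"])
    show "integrable lborel (\<lambda>x. (2 * c)\<^sup>2 * (norm (h x))\<^sup>2)"
      using h by (simp add: borel_L2_integrable)
    show "AE x in lborel. (\<lambda>i. (norm (s i x - f x))\<^sup>2) \<longlonglongrightarrow> 0"
      using lim by (auto intro!: AE_I2 tendsto_eq_intros LIM_zero)
    have "norm (s i x - f x) \<le> 2 * c * norm (h x)" for i x
      using norm_triangle_ineq4[of "s i x" "f x"] le[of i x] lef[of x] by linarith
    then have "(norm (s i x - f x))\<^sup>2 \<le> (2*c)\<^sup>2 * (norm (h x))\<^sup>2" for i x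
      by (metis norm_ge_zero power_mono power_mult_distrib)
    then show "AE x in lborel. norm ((norm (s i x - f x))\<^sup>2) \<le> (2 * c)\<^sup>2 * (norm (h x))\<^sup>2" for i
      by auto
  qed measurable
  then have "(\<lambda>n. (norm (abs_L2 (s n) - abs_L2 f))\<^sup>2) \<longlonglongrightarrow> 0"
    by (simp add: abs_L2_diff[symmetric] S F borel_L2_diff norm_abs_L2)
  then have "(\<lambda>n. sqrt ((norm (abs_L2 (s n) - abs_L2 f))\<^sup>2)) \<longlonglongrightarrow> sqrt 0"
    by (rule tendsto_real_sqrt)
  then show "(\<lambda>n. abs_L2 (s n)) \<longlonglongrightarrow> abs_L2 f"
    by (simp add: LIM_zero_cancel tendsto_norm_zero_iff)
qed

text \<open>
  The squared increments of a rapidly Cauchy sequence, weighted by \<open>2 ^ n\<close>, have a finite integral,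
  so the increments are almost everywhere dominated by a geometric series.
\<close>

lemma AE_convergent_if_rapidly_Cauchy:
  fixes y :: "nat \<Rightarrow> 'a::euclidean_space \<Rightarrow> quat"
  assumes y: "\<And>n. borel_L2 (y n)"
    and le: "\<And>n. norm (abs_L2 (y (Suc n)) - abs_L2 (y n)) \<le> (1/2) ^ n"
  shows "AE x in lborel. convergent (\<lambda>n. y n x)"
proof -
  note [measurable] = borel_L2_measurable[OF y]
  define d where "d n x = (norm (y (Suc n) x - y n x))\<^sup>2" for n x
  have d_meas [measurable]: "d n \<in> borel_measurable borel" for n unfolding d_def by measurable
  have "(\<integral>\<^sup>+x. (\<Sum>n. ennreal (2 ^ n * d n x)) \<partial>lborel) = (\<Sum>n. \<integral>\<^sup>+x. ennreal (2 ^ n * d n x) \<partial>lborel)"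
    by (rule nn_integral_suminf) measurable
  also have "\<dots> \<le> (\<Sum>n. ennreal ((1/2) ^ n))"
  proof (rule suminf_le)
    fix n
    have "(\<integral>\<^sup>+x. ennreal (2 ^ n * d n x) \<partial>lborel) = ennreal (2 ^ n) * (\<integral>\<^sup>+x. ennreal (d n x) \<partial>lborel)"
      by (subst nn_integral_cmult[symmetric]) (auto simp: ennreal_mult d_def)
    also have "(\<integral>\<^sup>+x. ennreal (d n x) \<partial>lborel) = ennreal ((norm (abs_L2 (y (Suc n)) - abs_L2 (y n)))\<^sup>2)"
      unfolding d_def by (simp add: y abs_L2_diff[symmetric] ennreal_norm_abs_L2 borel_L2_diff)
    also have "ennreal (2 ^ n) * \<dots> \<le> ennreal (2 ^ n) * ennreal (((1/2) ^ n)\<^sup>2)"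
      using le[of n] by (intro mult_left_mono ennreal_leI power_mono) auto
    also have "\<dots> = ennreal ((1/2) ^ n)"
      by (simp add: ennreal_mult[symmetric] power2_eq_square power_one_over divide_simps)
    finally show "(\<integral>\<^sup>+x. ennreal (2 ^ n * d n x) \<partial>lborel) \<le> ennreal ((1/2) ^ n)" .
  qed auto
  also have "\<dots> < \<infinity>"
    by (subst suminf_ennreal_eq[where x="1 / (1 - 1/2)"]) (use geometric_sums[of "1/2::real"] in auto)
  finally have "(\<integral>\<^sup>+x. (\<Sum>n. ennreal (2 ^ n * d n x)) \<partial>lborel) \<noteq> \<infinity>" by simp
  then have "AE x in lborel. (\<Sum>n. ennreal (2 ^ n * d n x)) \<noteq> \<infinity>"
    by (intro nn_integral_noteq_infinite) measurable
  then show ?thesis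
  proof eventually_elim
    case (elim x)
    then have "summable (\<lambda>n. 2 ^ n * d n x)"
      by (intro summable_suminf_not_top) (auto simp: d_def)
    then have "Bseq (\<lambda>n. 2 ^ n * d n x)"
      by (intro convergent_imp_Bseq convergentI) (rule summable_LIMSEQ_zero)
    then obtain C where C: "0 < C" "\<And>n. 2 ^ n * d n x \<le> C"
      by (auto simp: Bseq_def d_def)
    have geom: "norm (y (Suc n) x - y n x) \<le> sqrt C * (1 / sqrt 2) ^ n" for n
    proof (rule power2_le_imp_le)
      have "d n x \<le> C * (1/2)^n" using C(2)[of n] by (simp add: power_one_over divide_simps mult.commute)
      also have "\<dots> = (sqrt C * (1 / sqrt 2) ^ n)\<^sup>2"
      proof -
        have "((1 / sqrt 2) ^ n)\<^sup>2 = ((1 / sqrt 2)\<^sup>2) ^ n"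
          by (simp only: power_mult[symmetric] mult.commute[of n 2])
        also have "(1 / sqrt 2)\<^sup>2 = 1 / (2::real)" by (simp add: power_divide)
        finally show ?thesis using C(1) by (simp only: power_mult_distrib real_sqrt_pow2 less_imp_le)
      qed
      finally show "(norm (y (Suc n) x - y n x))\<^sup>2 \<le> (sqrt C * (1 / sqrt 2) ^ n)\<^sup>2"
        by (simp add: d_def)
    qed (use C(1) in simp)
    have "summable (\<lambda>n. sqrt C * (1 / sqrt 2) ^ n)"
      by (intro summable_mult summable_geometric) simp
    then have "summable (\<lambda>n. y (Suc n) x - y n x)"
      by (rule summable_comparison_test'[where N=0]) (rule geom)
    then have "convergent (\<lambda>n. (y n x - y 0 x) + y 0 x)"
      unfolding summable_iff_convergent sum_lessThan_telescope[of "\<lambda>n. y n x"]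
      by (rule convergent_add[OF _ convergent_const])
    then show ?case by simp
  qed
qed

text \<open>Riesz-Fischer: the increments give a limit almost everywhere, and Fatou in the second
  index turns the Cauchy estimate into one for the distance to that limit.\<close>

lemma rapidly_Cauchy_L2_convergent:
  fixes X :: "nat \<Rightarrow> 'a::euclidean_space L2"
  assumes C: "Cauchy X" and le: "\<And>n. norm (X (Suc n) - X n) \<le> (1/2) ^ n"
  shows "convergent X"
proof -
  define y where "y n = rep (X n)" for n
  have y: "borel_L2 (y n)" "abs_L2 (y n) = X n" for n by (simp_all add: y_def)
  note [measurable] = borel_L2_measurable[OF y(1)]
  \<comment> \<open>\<open>lim\<close> is total, so \<open>l\<close> is a Borel function on the
    whole space; what it returns at points of divergence matters only on a null set.\<close>
  define l where "l x = lim (\<lambda>n. y n x)" for x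
  have [measurable]: "l \<in> borel_measurable borel" unfolding l_def by measurable
  have "AE x in lborel. convergent (\<lambda>n. y n x)"
    using AE_convergent_if_rapidly_Cauchy[of y] le by (simp add: y)
  then have lim: "AE x in lborel. (\<lambda>n. y n x) \<longlonglongrightarrow> l x"
    by eventually_elim (simp only: l_def convergent_LIMSEQ_iff)
  have fatou: "(\<integral>\<^sup>+x. ennreal ((norm (y n x - l x))\<^sup>2) \<partial>lborel) \<le> ennreal (e\<^sup>2)"
    if N: "\<And>m. m \<ge> N \<Longrightarrow> norm (X n - X m) \<le> e" for n N e
  proof -
    have "(\<integral>\<^sup>+x. ennreal ((norm (y n x - l x))\<^sup>2) \<partial>lborel)
        \<le> (\<integral>\<^sup>+x. liminf (\<lambda>m. ennreal ((norm (y n x - y m x))\<^sup>2)) \<partial>lborel)"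
    proof (rule nn_integral_mono_AE)
      show "AE x in lborel. ennreal ((norm (y n x - l x))\<^sup>2)
          \<le> liminf (\<lambda>m. ennreal ((norm (y n x - y m x))\<^sup>2))"
        using lim
      proof eventually_elim
        case (elim x)
        then have "(\<lambda>m. ennreal ((norm (y n x - y m x))\<^sup>2)) \<longlonglongrightarrow> ennreal ((norm (y n x - l x))\<^sup>2)"
          by (intro tendsto_intros)
        from lim_imp_Liminf[OF _ this] show ?case by simp
      qed
    qed
    also have "\<dots> \<le> liminf (\<lambda>m. \<integral>\<^sup>+x. ennreal ((norm (y n x - y m x))\<^sup>2) \<partial>lborel)"
      by (rule nn_integral_liminf) measurable
    also have "\<dots> = liminf (\<lambda>m. ennreal ((norm (X n - X m))\<^sup>2))"
      by (simp add: y ennreal_norm_abs_L2[symmetric] borel_L2_diff abs_L2_diff)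
    also have "\<dots> \<le> limsup (\<lambda>m. ennreal ((norm (X n - X m))\<^sup>2))"
      by (rule Liminf_le_Limsup) simp
    also have "\<dots> \<le> ennreal (e\<^sup>2)"
      using N by (intro Limsup_bounded eventually_sequentiallyI[of N] ennreal_leI power_mono) auto
    finally show ?thesis .
  qed
  have small: "\<exists>N. \<forall>n\<ge>N. \<forall>m\<ge>N. norm (X n - X m) \<le> e" if "0 < e" for e
    using CauchyD[OF C that] by (meson less_imp_le)
  \<comment> \<open>A single tolerance puts \<open>l\<close> into L^2, as the difference of
    \<open>y N\<close> and \<open>y N - l\<close>; only then does \<open>abs_L2 l\<close> have a
    meaningful norm distance to \<open>X n\<close>.\<close>
  obtain N where N: "\<And>m. m \<ge> N \<Longrightarrow> norm (X N - X m) \<le> 1"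
    using small[of 1] by auto
  have "(\<integral>\<^sup>+x. ennreal ((norm (y N x - l x))\<^sup>2) \<partial>lborel) \<le> ennreal (1\<^sup>2)"
    by (rule fatou[where N=N]) (rule N)
  also have "\<dots> < \<infinity>" by simp
  finally have "borel_L2 (\<lambda>x. y N x - l x)"
    unfolding borel_L2_iff_nn_integral by simp
  from borel_L2_diff[OF y(1)[of N] this] have l: "borel_L2 l" by simp
  have "\<exists>N. \<forall>n\<ge>N. norm (X n - abs_L2 l) < e" if "0 < e" for e
  proof -
    obtain N where N: "\<And>n m. n \<ge> N \<Longrightarrow> m \<ge> N \<Longrightarrow> norm (X n - X m) \<le> e/2"
      using small[of "e/2"] \<open>0 < e\<close> by (meson half_gt_zero)
    have "norm (X n - abs_L2 l) < e" if "n \<ge> N" for n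
    proof -
      have "ennreal ((norm (X n - abs_L2 l))\<^sup>2) = (\<integral>\<^sup>+x. ennreal ((norm (y n x - l x))\<^sup>2) \<partial>lborel)"
        using l by (simp add: y ennreal_norm_abs_L2[symmetric] borel_L2_diff abs_L2_diff)
      also have "\<dots> \<le> ennreal ((e/2)\<^sup>2)" using N that by (intro fatou) auto
      finally have "norm (X n - abs_L2 l) \<le> e/2"
        using \<open>0 < e\<close> by (auto simp: ennreal_le_iff intro: power2_le_imp_le)
      then show ?thesis using \<open>0 < e\<close> by simp
    qed
    then show ?thesis by blast
  qed
  then have "X \<longlonglongrightarrow> abs_L2 l" by (intro LIMSEQ_I) blast
  then show ?thesis by (rule convergentI)
qed

text \<open>A Cauchy sequence converges as soon as one subsequence does, so it is enough to extract
  a rapidly Cauchy one.\<close>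

instance L2 :: (euclidean_space) banach
proof
  fix X :: "nat \<Rightarrow> 'a L2"
  assume C: "Cauchy X"
  have "\<exists>r. strict_mono r \<and> (\<forall>n. norm (X (r (Suc n)) - X (r n)) \<le> (1/2) ^ n)"
  proof -
    have "\<exists>N. \<forall>m\<ge>N. \<forall>n\<ge>N. norm (X m - X n) \<le> (1/2) ^ k" for k :: nat
      using CauchyD[OF C, of "(1/2)^k"] by (meson less_imp_le zero_less_divide_1_iff zero_less_numeral zero_less_power)
    then obtain N where N: "\<And>k m n. m \<ge> N k \<Longrightarrow> n \<ge> N k \<Longrightarrow> norm (X m - X n) \<le> (1/2) ^ k"
      by metis
    \<comment> \<open>The sum puts \<open>r n\<close> above \<open>N n\<close>, and the extra
      summand \<open>n\<close> makes the growth strict.\<close>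
    define r where "r n = (\<Sum>k\<le>n. N k) + n" for n
    have "strict_mono r" by (rule strict_monoI_Suc) (simp add: r_def)
    moreover have "N n \<le> r n" for n
      using member_le_sum[of n "{..n}" N] by (simp add: r_def)
    then have "N n \<le> r n" "N n \<le> r (Suc n)" for n
      using \<open>strict_mono r\<close> by (meson le_trans lessI less_imp_le strict_mono_less)+
    then have "norm (X (r (Suc n)) - X (r n)) \<le> (1/2) ^ n" for n
      by (intro N)
    ultimately show ?thesis by blast
  qed
  then obtain r where r: "strict_mono r" "\<And>n. norm (X (r (Suc n)) - X (r n)) \<le> (1/2) ^ n"
    by blast
  have "convergent (X \<circ> r)"
    using r by (intro rapidly_Cauchy_L2_convergent Cauchy_subseq_Cauchy C) auto
  then show "convergent X"
    using Cauchy_converges_subseq[OF C r(1)] by (auto simp: convergent_def)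
qed

section \<open>Forms represented by compact operators\<close>

lemma compact_closure_subset:
  fixes K :: "'a::metric_space set"
  assumes "compact K" "S \<subseteq> K"
  shows "compact (closure S)"
proof -
  have "closure S \<subseteq> K" using assms by (simp add: closure_minimal compact_imp_closed)
  then have "closure S = K \<inter> closure S" by blast
  then show ?thesis using compact_Int_closed[OF assms(1) closed_closure] by metis
qed

lemma compact_operator_add:
  assumes "compact_operator S" "compact_operator T"
  shows "compact_operator (\<lambda>x. S x + T x)"
  unfolding compact_operator_def
proof (intro conjI allI impI)
  show "bounded_linear (\<lambda>x. S x + T x)"
    using assms by (auto simp: compact_operator_def intro: bounded_linear_add)
  fix B :: "'a set" assume "bounded B"
  then have "compact {x + y |x y. x \<in> closure (S ` B) \<and> y \<in> closure (T ` B)}"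
    using assms by (intro compact_sums) (auto simp: compact_operator_def)
  then show "compact (closure ((\<lambda>x. S x + T x) ` B))"
    by (rule compact_closure_subset) (use closure_subset[of "S ` B"] closure_subset[of "T ` B"] in blast)
qed

lemma compact_operator_scaleR:
  assumes "compact_operator T"
  shows "compact_operator (\<lambda>x. c *\<^sub>R T x)"
  unfolding compact_operator_def
proof (intro conjI allI impI)
  show "bounded_linear (\<lambda>x. c *\<^sub>R T x)"
    using assms by (auto simp: compact_operator_def intro: bounded_linear_compose[OF bounded_linear_scaleR_right])
  fix B :: "'a set" assume "bounded B"
  then have "compact ((\<lambda>x. c *\<^sub>R x) ` closure (T ` B))"
    using assms by (intro compact_scaling) (auto simp: compact_operator_def)
  then show "compact (closure ((\<lambda>x. c *\<^sub>R T x) ` B))"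
    by (rule compact_closure_subset) (use closure_subset[of "T ` B"] in blast)
qed

lemma compact_operator_rank_one:
  fixes a :: "'a::real_inner" and b :: "'b::real_normed_vector"
  shows "compact_operator (\<lambda>x. inner x a *\<^sub>R b)"
  unfolding compact_operator_def
proof (intro conjI allI impI)
  show "bounded_linear (\<lambda>x. inner x a *\<^sub>R b)"
    by (intro bounded_linear_scaleR_const bounded_linear_inner_left)
  fix B :: "'a set" assume "bounded B"
  then obtain M where M: "\<And>x. x \<in> B \<Longrightarrow> norm x \<le> M" by (auto simp: bounded_iff)
  have "compact ((\<lambda>t. t *\<^sub>R b) ` {- (M * norm a)..M * norm a})"
    by (intro compact_continuous_image continuous_intros) auto
  moreover have "\<bar>inner x a\<bar> \<le> M * norm a" if "x \<in> B" for x
    using Cauchy_Schwarz_ineq2[of x a] M[OF that] by (meson mult_right_mono norm_ge_zero order_trans)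
  ultimately show "compact (closure ((\<lambda>x. inner x a *\<^sub>R b) ` B))"
    by (elim compact_closure_subset) (force simp: abs_le_iff)
qed

text \<open>The Weyl transform is given by a form, and forms are what gets approximated below; the
  representing operator is carried along existentially, so it has to be written down only for rank
  one.\<close>

definition compact_form :: "('a::real_normed_vector \<Rightarrow> 'b::real_inner \<Rightarrow> real) \<Rightarrow> bool" where
  "compact_form B \<longleftrightarrow> (\<exists>T. compact_operator T \<and> (\<forall>f g. B f g = inner (T f) g))"

lemma compact_form_add:
  assumes "compact_form A" "compact_form B"
  shows "compact_form (\<lambda>f g. A f g + B f g)"
proof -
  obtain S T where "compact_operator S" "\<And>f g. A f g = inner (S f) g"
    "compact_operator T" "\<And>f g. B f g = inner (T f) g"
    using assms by (auto simp: compact_form_def)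
  then show ?thesis
    unfolding compact_form_def
    by (intro exI[of _ "\<lambda>x. S x + T x"]) (simp add: compact_operator_add inner_add_left)
qed

lemma compact_form_scale:
  assumes "compact_form B"
  shows "compact_form (\<lambda>f g. c * B f g)"
proof -
  obtain T where "compact_operator T" "\<And>f g. B f g = inner (T f) g"
    using assms by (auto simp: compact_form_def)
  then show ?thesis
    unfolding compact_form_def
    by (intro exI[of _ "\<lambda>x. c *\<^sub>R T x"]) (simp add: compact_operator_scaleR)
qed

lemma compact_form_rank_one: "compact_form (\<lambda>f g. inner f a * inner g b)"
  unfolding compact_form_def
  by (intro exI[of _ "\<lambda>x. inner x a *\<^sub>R b"])
    (simp add: compact_operator_rank_one inner_commute)

lemma compact_form_zero: "compact_form (\<lambda>(f::'a::real_inner) (g::'b::real_inner). 0)"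
  using compact_form_rank_one[of "0::'a" "0::'b"] by simp

lemma compact_form_sum:
  fixes B :: "'i \<Rightarrow> 'a::real_inner \<Rightarrow> 'b::real_inner \<Rightarrow> real"
  assumes "\<And>i. i \<in> I \<Longrightarrow> compact_form (B i)"
  shows "compact_form (\<lambda>f g. \<Sum>i\<in>I. B i f g)"
proof (cases "finite I")
  case True
  then show ?thesis using assms
    by (induction I) (simp_all add: compact_form_zero compact_form_add)
qed (simp add: compact_form_zero)

text \<open>Testing with \<open>g = v\<close> suffices. This converts estimates between forms into
  estimates between the representing operators.\<close>

lemma norm_le_if_inner_le:
  fixes v :: "'a::real_inner"
  assumes "0 \<le> c" "\<And>g. \<bar>inner v g\<bar> \<le> c * norm g"
  shows "norm v \<le> c"
proof (cases "v = 0")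
  case True
  then show ?thesis using assms(1) by simp
next
  case False
  have "norm v * norm v \<le> c * norm v"
    using assms(2)[of v] by (simp add: power2_norm_eq_inner[symmetric] power2_eq_square)
  then show ?thesis using False by simp
qed

text \<open>The approximating operators are Cauchy uniformly on bounded sets, because inner products
  recover the norm. Completeness of the target gives a pointwise limit, and its closeness to a
  single compact approximant makes images of bounded sets totally bounded.\<close>

lemma compact_form_limit:
  fixes B :: "'a::real_normed_vector \<Rightarrow> 'b::{real_inner, banach} \<Rightarrow> real"
  assumes approx: "\<And>e. 0 < e \<Longrightarrow>
    \<exists>A. compact_form A \<and> (\<forall>f g. \<bar>B f g - A f g\<bar> \<le> e * norm f * norm g)"
  shows "compact_form B"
proof -
  define e where "e n = 1 / real (Suc n)" for n
  have e: "0 < e n" for n by (simp add: e_def)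
  have e_lim: "e \<longlonglongrightarrow> 0" unfolding e_def by (rule LIMSEQ_Suc[OF lim_const_over_n])
  have "\<exists>T. compact_operator T \<and> (\<forall>f g. \<bar>B f g - inner (T f) g\<bar> \<le> e n * norm f * norm g)" for n
    using approx[OF e[of n]] by (force simp: compact_form_def)
  then obtain T where T: "\<And>n. compact_operator (T n)"
      and BT: "\<And>n f g. \<bar>B f g - inner (T n f) g\<bar> \<le> e n * norm f * norm g"
    by metis
  have lin: "bounded_linear (T n)" for n using T by (simp add: compact_operator_def)
  have dist_T: "norm (T n f - T m f) \<le> (e n + e m) * norm f" for n m f
  proof (rule norm_le_if_inner_le)
    show "0 \<le> (e n + e m) * norm f" using e[of n] e[of m] by simp
    fix g
    show "\<bar>inner (T n f - T m f) g\<bar> \<le> (e n + e m) * norm f * norm g"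
      using BT[of f g n] BT[of f g m] by (simp add: inner_diff_left algebra_simps abs_if split: if_splits)
  qed
  have conv: "convergent (\<lambda>n. T n f)" for f
  proof (rule Cauchy_convergent, rule metric_CauchyI)
    fix d :: real assume d: "0 < d"
    have "(\<lambda>n. e n * norm f) \<longlonglongrightarrow> 0" using tendsto_mult_right[OF e_lim, of "norm f"] by simp
    then have "\<forall>\<^sub>F n in sequentially. e n * norm f < d / 2"
      using d by (intro order_tendstoD(2)) auto
    then obtain N where N: "\<And>n. n \<ge> N \<Longrightarrow> e n * norm f < d / 2"
      by (auto simp: eventually_sequentially)
    have "dist (T m f) (T n f) < d" if "m \<ge> N" "n \<ge> N" for m n
      using dist_T[of m f n] N[OF that(1)] N[OF that(2)] by (simp add: dist_norm algebra_simps)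
    then show "\<exists>N. \<forall>m\<ge>N. \<forall>n\<ge>N. dist (T m f) (T n f) < d" by blast
  qed
  define L where "L f = lim (\<lambda>n. T n f)" for f
  have lim: "(\<lambda>n. T n f) \<longlonglongrightarrow> L f" for f
    using conv[of f] by (simp only: L_def convergent_LIMSEQ_iff)
  have BL: "B f g = inner (L f) g" for f g
  proof -
    have "(\<lambda>n. inner (T n f) g) \<longlonglongrightarrow> inner (L f) g" by (intro tendsto_intros lim)
    moreover have "(\<lambda>n. inner (T n f) g) \<longlonglongrightarrow> B f g"
    proof (rule LIM_zero_cancel, rule tendsto_rabs_zero_cancel, rule tendsto_sandwich[where f="\<lambda>_. 0"])
      show "(\<lambda>n. e n * norm f * norm g) \<longlonglongrightarrow> 0"
        using tendsto_mult_right[OF e_lim, of "norm f * norm g"] by (simp add: mult.assoc)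
      show "\<forall>\<^sub>F n in sequentially. \<bar>inner (T n f) g - B f g\<bar> \<le> e n * norm f * norm g"
        using BT[of f g] by (simp add: abs_minus_commute)
    qed auto
    ultimately show ?thesis using LIMSEQ_unique by blast
  qed
  have LT: "norm (L f - T n f) \<le> e n * norm f" for f n
    using BT[of f _ n] e[of n] by (intro norm_le_if_inner_le) (simp_all add: BL inner_diff_left)
  have L_lin: "bounded_linear L"
  proof -
    \<comment> \<open>\<open>L f\<close> is within \<open>e 0 * norm f\<close> of
      \<open>T 0 f\<close>, so the bound of one approximant already bounds \<open>L\<close>.\<close>
    obtain K where K: "\<And>f. norm (T 0 f) \<le> norm f * K"
      using bounded_linear.bounded[OF lin[of 0]] by auto
    show ?thesis
    proof (rule bounded_linear_intro[where K="e 0 + K"])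
      fix x y and r :: real
      show "L (x + y) = L x + L y"
        using tendsto_add[OF lim[of x] lim[of y]] lim[of "x + y"]
        by (simp add: linear_add[OF bounded_linear.linear[OF lin]] LIMSEQ_unique)
      show "L (r *\<^sub>R x) = r *\<^sub>R L x"
        using tendsto_scaleR[OF tendsto_const lim[of x], of r] lim[of "r *\<^sub>R x"]
        by (simp add: linear_scale[OF bounded_linear.linear[OF lin]] LIMSEQ_unique)
      have "norm (L x) \<le> norm (L x - T 0 x) + norm (T 0 x)"
        using norm_triangle_ineq[of "L x - T 0 x" "T 0 x"] by simp
      then show "norm (L x) \<le> norm x * (e 0 + K)"
        using LT[of x 0] K[of x] by (simp add: algebra_simps)
    qed
  qed
  have "compact (closure (L ` S))" if "bounded S" for S
  proof -
    obtain M where M: "0 < M" "\<And>x. x \<in> S \<Longrightarrow> norm x \<le> M" using \<open>bounded S\<close> by (auto simp: bounded_pos)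
    \<comment> \<open>The three thirds of \<open>d\<close> pay for the net of the image under
      \<open>T n\<close>, for passing from \<open>T n\<close> to \<open>L\<close>, and for passing
      from the image to its closure.\<close>
    have "\<exists>k. finite k \<and> closure (L ` S) \<subseteq> (\<Union>x\<in>k. ball x d)" if d: "0 < d" for d
    proof -
      have "(\<lambda>n. e n * M) \<longlonglongrightarrow> 0" using tendsto_mult_right[OF e_lim, of M] by simp
      then have "\<forall>\<^sub>F n in sequentially. e n * M < d / 3"
        using d by (intro order_tendstoD(2)) auto
      then obtain n where n: "e n * M < d / 3" by (auto simp: eventually_sequentially)
      have "compact (closure (T n ` S))" using T \<open>bounded S\<close> by (auto simp: compact_operator_def)
      then obtain k where k: "finite k" "closure (T n ` S) \<subseteq> (\<Union>x\<in>k. ball x (d / 3))"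
        using d unfolding compact_eq_totally_bounded by (meson zero_less_divide_iff zero_less_numeral)
      have "closure (L ` S) \<subseteq> (\<Union>x\<in>k. ball x d)"
      proof
        fix y assume "y \<in> closure (L ` S)"
        then obtain x where x: "x \<in> S" "dist (L x) y < d / 3"
          using d by (force simp: closure_approachable dest: spec[of _ "d / 3"])
        have "T n x \<in> closure (T n ` S)" using x(1) closure_subset[of "T n ` S"] by blast
        then obtain z where z: "z \<in> k" "dist z (T n x) < d / 3" using k(2) by auto
        have "e n * norm x \<le> e n * M" using M(2)[OF x(1)] e[of n] by simp
        then have "dist (T n x) (L x) < d / 3"
          using LT[of x n] n by (simp add: dist_norm norm_minus_commute)
        then have "dist z y < d"
          using z(2) x(2) dist_triangle[of z y "T n x"] dist_triangle[of "T n x" y "L x"] by linarith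
        then show "y \<in> (\<Union>x\<in>k. ball x d)" using z(1) by auto
      qed
      then show ?thesis using k(1) by blast
    qed
    then show ?thesis
      unfolding compact_eq_totally_bounded by (simp add: complete_eq_closed)
  qed
  then have "compact_operator L" using L_lin by (simp add: compact_operator_def)
  then show ?thesis using BL by (auto simp: compact_form_def)
qed

section \<open>Hilbert-Schmidt kernels\<close>

lemma borel_L2_indicator:
  fixes A :: "'a::euclidean_space set"
  assumes "A \<in> sets borel" "emeasure lborel A < \<infinity>"
  shows "borel_L2 (\<lambda>x. indicator A x *\<^sub>R c)"
  unfolding borel_L2_def
proof
  show "(\<lambda>x. indicator A x *\<^sub>R c) \<in> borel_measurable borel"
    using assms by (intro borel_measurable_scaleR) auto
  have "integrable lborel (\<lambda>x. indicator A x * (norm c)\<^sup>2)" using assms by simp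
  moreover have "(norm (indicator A x *\<^sub>R c))\<^sup>2 = indicator A x * (norm c)\<^sup>2" for x
    by (simp add: indicator_def)
  ultimately show "integrable lborel (\<lambda>x. (norm (indicator A x *\<^sub>R c))\<^sup>2)" by simp
qed

text \<open>Rectangles form an intersection-stable generator of the Borel sets of the product. A
  Dynkin induction therefore reaches Borel sets inside a rectangle of finite measure; exhaustion,
  simple functions and density then reach all of L^2.\<close>

lemma L2_product_induct [consumes 0, case_names rectangle add scale limit]:
  fixes P :: "('a::euclidean_space \<times> 'b::euclidean_space) L2 \<Rightarrow> bool"
  assumes rectangle: "\<And>A B c. A \<in> sets borel \<Longrightarrow> B \<in> sets borel \<Longrightarrow> emeasure lborel A < \<infinity> \<Longrightarrow>
      emeasure lborel B < \<infinity> \<Longrightarrow> P (abs_L2 (\<lambda>z. indicator (A \<times> B) z *\<^sub>R c))"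
    and add: "\<And>k l. P k \<Longrightarrow> P l \<Longrightarrow> P (k + l)"
    and scale: "\<And>r k. P k \<Longrightarrow> P (r *\<^sub>R k)"
    and limit: "\<And>s k. (\<And>n. P (s n)) \<Longrightarrow> s \<longlonglongrightarrow> k \<Longrightarrow> P k"
  shows "P k"
proof -
  have diff: "P (k - l)" if "P k" "P l" for k l
    using add[OF that(1) scale[OF that(2), of "-1"]] by simp
  have zero: "P 0" using scale[OF rectangle[of "{}" "{}"], of 0] by simp
  \<comment> \<open>Here \<open>A \<inter> U \<times> V\<close> is the intersection of
    \<open>A\<close> with the rectangle. The cut keeps measures finite, so that the complement step
    is a difference of two elements of L^2.\<close>
  have bounded: "P (abs_L2 (\<lambda>z. indicator (A \<inter> U \<times> V) z *\<^sub>R c))"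
    if A: "A \<in> sets borel" and UV: "U \<in> sets borel" "V \<in> sets borel"
      "emeasure lborel U < \<infinity>" "emeasure lborel V < \<infinity>"
    for A :: "('a \<times> 'b) set" and U V c
  proof -
    let ?G = "{a \<times> b | a b. a \<in> sets (borel :: 'a measure) \<and> b \<in> sets (borel :: 'b measure)}"
    have sig: "sets (borel :: ('a \<times> 'b) measure) = sigma_sets UNIV ?G"
      by (simp add: borel_prod[symmetric] sets_pair_measure)
    have UVb: "U \<times> V \<in> sets borel" using UV by (simp add: borel_prod[symmetric])
    have "emeasure lborel (U \<times> V) = emeasure lborel U * emeasure lborel V"
      using UV by (simp add: lborel_prod[symmetric] lborel.emeasure_pair_measure_Times)
    then have UVf: "emeasure lborel (U \<times> V) < \<infinity>" using UV by (simp add: ennreal_mult_less_top)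
    have fin: "emeasure lborel (A \<inter> U \<times> V) < \<infinity>" if "A \<in> sets borel" for A
      using UVf UVb by (intro le_less_trans[OF emeasure_mono[OF Int_lower2]]) auto
    have L2: "borel_L2 (\<lambda>z. indicator (A \<inter> U \<times> V) z *\<^sub>R c)" if "A \<in> sets borel" for A
      using that UVb fin by (intro borel_L2_indicator) auto
    have "Int_stable ?G" by (rule Int_stable_pair_measure_generator)
    moreover have "?G \<subseteq> Pow UNIV" by simp
    moreover have "A \<in> sigma_sets UNIV ?G" using A sig by simp
    ultimately show ?thesis
    proof (induction rule: sigma_sets_induct_disjoint)
      case (basic A)
      then obtain a b where ab: "A = a \<times> b" "a \<in> sets borel" "b \<in> sets borel" by blast
      have "emeasure lborel (a \<inter> U) < \<infinity>" "emeasure lborel (b \<inter> V) < \<infinity>"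
        using UV by (auto intro!: le_less_trans[OF emeasure_mono[OF Int_lower2]])
      then show ?case
        using ab UV rectangle[of "a \<inter> U" "b \<inter> V" c] by (simp add: Times_Int_Times)
    next
      case empty
      then show ?case using zero by (simp add: zero_L2_def[symmetric] zero_L2.abs_eq[symmetric])
    next
      case (compl A)
      have A: "A \<in> sets borel" using compl sig by simp
      have "indicator ((UNIV - A) \<inter> U \<times> V) z *\<^sub>R c
          = indicator (U \<times> V) z *\<^sub>R c - indicator (A \<inter> U \<times> V) z *\<^sub>R c" for z
        by (auto simp: indicator_def)
      moreover have "P (abs_L2 (\<lambda>z. indicator (U \<times> V) z *\<^sub>R c))"
        using rectangle[of U V c] UV by simp
      ultimately show ?case
        using compl A L2[of UNIV] by (simp add: abs_L2_diff L2 diff)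
    next
      case (union A)
      have A: "A i \<in> sets borel" for i using union(2) sig by auto
      \<comment> \<open>Disjointness makes finite unions sums of indicators; the countable union is
        their limit, dominated by the indicator of \<open>U \<times> V\<close>.\<close>
      have fin_union: "P (abs_L2 (\<lambda>z. indicator ((\<Union>i<n. A i) \<inter> U \<times> V) z *\<^sub>R c))" for n
      proof (induction n)
        case 0
        then show ?case using zero by (simp add: zero_L2_def[symmetric] zero_L2.abs_eq[symmetric])
      next
        case (Suc n)
        have "A n \<inter> A i = {}" if "i < n" for i
          using union(1) that by (auto simp: disjoint_family_on_def)
        then have "A n \<inter> (\<Union>i<n. A i) = {}" by blast
        then have "indicator ((\<Union>i<Suc n. A i) \<inter> U \<times> V) z *\<^sub>R c
            = indicator (A n \<inter> U \<times> V) z *\<^sub>R c + indicator ((\<Union>i<n. A i) \<inter> U \<times> V) z *\<^sub>R c" for z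
          by (auto simp: indicator_def lessThan_Suc)
        moreover have "(\<Union>i<n. A i) \<in> sets borel" using A by auto
        ultimately show ?case
          using Suc union(3) A by (simp add: abs_L2_add L2 add)
      qed
      show ?case
      proof (rule limit[OF fin_union], rule L2_tendsto_dominated(1)[where c=1])
        show "borel_L2 (\<lambda>z. indicator (U \<times> V) z *\<^sub>R c)" using L2[of UNIV] by simp
        show "(\<lambda>z. indicator ((\<Union>i<n. A i) \<inter> U \<times> V) z *\<^sub>R c) \<in> borel_measurable borel" for n
          using A by (intro borel_L2_measurable L2) auto
        show "(\<lambda>z. indicator ((\<Union>i. A i) \<inter> U \<times> V) z *\<^sub>R c) \<in> borel_measurable borel"
          using A by (intro borel_L2_measurable L2) auto
        show "norm (indicator ((\<Union>i<n. A i) \<inter> U \<times> V) z *\<^sub>R c)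
            \<le> 1 * norm (indicator (U \<times> V) z *\<^sub>R c)" for n z
          by (auto simp: indicator_def)
        show "(\<lambda>n. indicator ((\<Union>i<n. A i) \<inter> U \<times> V) z *\<^sub>R c)
            \<longlonglongrightarrow> indicator ((\<Union>i. A i) \<inter> U \<times> V) z *\<^sub>R c" for z
          unfolding indicator_inter_arith by (intro tendsto_intros LIMSEQ_indicator_UN)
      qed
    qed
  qed
  have ind: "P (abs_L2 (\<lambda>z. indicator A z *\<^sub>R c))"
    if A: "A \<in> sets borel" "emeasure lborel A < \<infinity>" for A c
  proof -
    \<comment> \<open>Products of growing balls exhaust the space, so the indicator of a set of
      finite measure is a dominated limit of the sets treated above.\<close>
    have "P (abs_L2 (\<lambda>z. indicator (A \<inter> ball 0 (real n) \<times> ball 0 (real n)) z *\<^sub>R c))" for n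
      using A by (intro bounded emeasure_bounded_finite bounded_ball) auto
    then show ?thesis
    proof (rule limit, intro L2_tendsto_dominated(1)[where c=1 and h="\<lambda>z. indicator A z *\<^sub>R c"])
      show "borel_L2 (\<lambda>z. indicator A z *\<^sub>R c)" using A by (rule borel_L2_indicator)
      then show "(\<lambda>z. indicator A z *\<^sub>R c) \<in> borel_measurable borel" by (rule borel_L2_measurable)
      have "open (ball (0::'a) (real n) \<times> ball (0::'b) (real n))" for n by (intro open_Times) auto
      then show "(\<lambda>z. indicator (A \<inter> ball 0 (real n) \<times> ball 0 (real n)) z *\<^sub>R c) \<in> borel_measurable borel" for n
        using A by (intro borel_measurable_scaleR borel_measurable_indicator sets.Int) auto
      show "norm (indicator (A \<inter> ball 0 (real n) \<times> ball 0 (real n)) z *\<^sub>R c)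
          \<le> 1 * norm (indicator A z *\<^sub>R c)" for n z
        by (auto simp: indicator_def)
      show "(\<lambda>n. indicator (A \<inter> ball 0 (real n) \<times> ball 0 (real n)) z *\<^sub>R c) \<longlonglongrightarrow> indicator A z *\<^sub>R c" for z
      proof (rule tendsto_eventually)
        obtain N where "max (norm (fst z)) (norm (snd z)) < real N" using reals_Archimedean2 by blast
        then have "indicator (A \<inter> ball 0 (real n) \<times> ball 0 (real n)) z *\<^sub>R c = indicator A z *\<^sub>R c" if "n \<ge> N" for n
          using that by (cases z) (auto simp: indicator_def)
        then show "\<forall>\<^sub>F n in sequentially. indicator (A \<inter> ball 0 (real n) \<times> ball 0 (real n)) z *\<^sub>R c = indicator A z *\<^sub>R c"
          by (rule eventually_sequentiallyI)
      qed
    qed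
  qed
  have simple: "P (abs_L2 s)" if s: "borel_L2 s" "simple_function lborel s" for s
  proof -
    \<comment> \<open>Chebyshev: on this level set the quotient of squares equals 1. The value 0 is
      left out because its level set may have infinite measure.\<close>
    have fin: "emeasure lborel (s -` {y}) < \<infinity>" if "y \<noteq> 0" for y
    proof -
      have "s -` {y} \<in> sets borel" using measurable_sets[OF borel_L2_measurable[OF s(1)], of "{y}"] by simp
      then have "emeasure lborel (s -` {y}) = (\<integral>\<^sup>+x. indicator (s -` {y}) x \<partial>lborel)" by simp
      also have "\<dots> \<le> (\<integral>\<^sup>+x. ennreal ((norm (s x))\<^sup>2 / (norm y)\<^sup>2) \<partial>lborel)"
        using that by (intro nn_integral_mono) (auto simp: indicator_def)
      also have "\<dots> < \<infinity>"
        using borel_L2_integrable[OF s(1), THEN integrable_divide_zero, of "(norm y)\<^sup>2"]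
        by (simp add: nn_integral_eq_integral)
      finally show ?thesis .
    qed
    have sb: "s -` {y} \<in> sets borel" for y
      using measurable_sets[OF borel_L2_measurable[OF s(1)], of "{y}"] by simp
    have "finite Y \<Longrightarrow> 0 \<notin> Y \<Longrightarrow> borel_L2 (\<lambda>x. \<Sum>y\<in>Y. indicator (s -` {y}) x *\<^sub>R y)
        \<and> P (abs_L2 (\<lambda>x. \<Sum>y\<in>Y. indicator (s -` {y}) x *\<^sub>R y))" for Y
    proof (induction Y rule: finite_induct)
      case empty
      then show ?case using zero
        by (simp add: zero_L2_def[symmetric] zero_L2.abs_eq[symmetric] borel_L2_def)
    next
      case (insert y Y)
      then have "borel_L2 (\<lambda>x. indicator (s -` {y}) x *\<^sub>R y)" "P (abs_L2 (\<lambda>x. indicator (s -` {y}) x *\<^sub>R y))"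
        using sb fin by (auto intro!: borel_L2_indicator ind)
      moreover from insert have "borel_L2 (\<lambda>x. \<Sum>y\<in>Y. indicator (s -` {y}) x *\<^sub>R y)"
        "P (abs_L2 (\<lambda>x. \<Sum>y\<in>Y. indicator (s -` {y}) x *\<^sub>R y))" by simp_all
      ultimately show ?case
        by (simp only: sum.insert[OF insert(1,2)] abs_L2_add borel_L2_add add simp_thms)
    qed
    moreover have "finite (range s - {0})" using s(2) by (simp add: simple_function_def)
    ultimately have "P (abs_L2 (\<lambda>x. \<Sum>y\<in>range s - {0}. indicator (s -` {y}) x *\<^sub>R y))" by blast
    moreover have "(\<Sum>y\<in>range s - {0}. indicator (s -` {y}) x *\<^sub>R y) = s x" for x
    proof -
      have "(\<Sum>y\<in>range s - {0}. indicator (s -` {y}) x *\<^sub>R y) = (\<Sum>y\<in>range s - {0}. if y = s x then y else 0)"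
        by (intro sum.cong) (auto simp: indicator_def)
      also have "\<dots> = s x" using \<open>finite (range s - {0})\<close> by simp
      finally show ?thesis .
    qed
    ultimately show ?thesis by simp
  qed
  obtain s where s: "\<And>i. simple_function lborel (s i)" "\<And>x. (\<lambda>i. s i x) \<longlonglongrightarrow> rep k x"
    "\<And>i x. norm (s i x) \<le> 2 * norm (rep k x)"
    using borel_measurable_implies_sequence_metric[of "rep k" lborel 0] by (auto simp: dist_norm)
  have sm: "s i \<in> borel_measurable borel" for i
    using borel_measurable_simple_function[OF s(1)[of i]] by simp
  have "P (abs_L2 (s i))" for i
    using s(1) by (intro simple borel_L2_bound[OF borel_L2_rep[of k] sm s(3)])
  moreover have "(\<lambda>i. abs_L2 (s i)) \<longlonglongrightarrow> abs_L2 (rep k)"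
    by (rule L2_tendsto_dominated(1)[OF borel_L2_rep sm rep_measurable s(3) s(2)])
  ultimately show ?thesis using limit[of "\<lambda>i. abs_L2 (s i)" "abs_L2 (rep k)"] by simp
qed

section \<open>Integrals of products and elementary tensors\<close>

lemma nn_integral_product_fst_snd:
  fixes p :: "'a::euclidean_space \<Rightarrow> ennreal" and q :: "'b::euclidean_space \<Rightarrow> ennreal"
  assumes [measurable]: "p \<in> borel_measurable borel" "q \<in> borel_measurable borel"
  shows "(\<integral>\<^sup>+z. p (fst z) * q (snd z) \<partial>lborel) = (\<integral>\<^sup>+x. p x \<partial>lborel) * (\<integral>\<^sup>+y. q y \<partial>lborel)"
proof -
  have "(\<integral>\<^sup>+z. p (fst z) * q (snd z) \<partial>lborel) = (\<integral>\<^sup>+x. \<integral>\<^sup>+y. p x * q y \<partial>lborel \<partial>lborel)"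
    unfolding lborel_prod[symmetric] by (subst lborel.nn_integral_fst[symmetric]) simp_all
  also have "\<dots> = (\<integral>\<^sup>+x. p x * (\<integral>\<^sup>+y. q y \<partial>lborel) \<partial>lborel)"
    by (simp add: nn_integral_cmult)
  also have "\<dots> = (\<integral>\<^sup>+x. p x \<partial>lborel) * (\<integral>\<^sup>+y. q y \<partial>lborel)"
    by (simp add: nn_integral_multc)
  finally show ?thesis .
qed

lemma integral_product_fst_snd:
  fixes p :: "'a::euclidean_space \<Rightarrow> real" and q :: "'b::euclidean_space \<Rightarrow> real"
  assumes p: "integrable lborel p" and q: "integrable lborel q"
  shows "integrable lborel (\<lambda>z. p (fst z) * q (snd z))"
    and "(\<integral>z. p (fst z) * q (snd z) \<partial>lborel) = (\<integral>x. p x \<partial>lborel) * (\<integral>y. q y \<partial>lborel)"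
proof -
  have [measurable]: "p \<in> borel_measurable borel" "q \<in> borel_measurable borel"
    using p q by auto
  have "(\<integral>\<^sup>+z. ennreal (norm (p (fst z) * q (snd z))) \<partial>lborel)
      = (\<integral>\<^sup>+z. ennreal (norm (p (fst z))) * ennreal (norm (q (snd z))) \<partial>lborel)"
    by (simp add: abs_mult ennreal_mult)
  also have "\<dots> = (\<integral>\<^sup>+x. ennreal (norm (p x)) \<partial>lborel) * (\<integral>\<^sup>+y. ennreal (norm (q y)) \<partial>lborel)"
    by (rule nn_integral_product_fst_snd) measurable
  also have "\<dots> < \<infinity>"
    using p q by (simp add: integrable_iff_bounded ennreal_mult_less_top)
  finally show int: "integrable lborel (\<lambda>z. p (fst z) * q (snd z))"
    unfolding integrable_iff_bounded by (auto simp: borel_prod[symmetric])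
  then have "integrable (lborel \<Otimes>\<^sub>M lborel) (\<lambda>z. p (fst z) * q (snd z))"
    by (simp add: lborel_prod)
  from lborel_pair.integral_fst'[OF this]
  show "(\<integral>z. p (fst z) * q (snd z) \<partial>lborel) = (\<integral>x. p x \<partial>lborel) * (\<integral>y. q y \<partial>lborel)"
    by (simp add: lborel_prod)
qed

text \<open>
  With this order of the factors, \<open>inner (k z) (tensor f g z)\<close> is the scalar part of $k(u,v) f(u) \overline{g(v)}$.
\<close>

definition tensor :: "('a::euclidean_space \<Rightarrow> quat) \<Rightarrow> ('b::euclidean_space \<Rightarrow> quat) \<Rightarrow> 'a \<times> 'b \<Rightarrow> quat" where
  "tensor f g = (\<lambda>z. g (snd z) * qcnj (f (fst z)))"

lemma tensor_measurable [measurable]: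
  assumes "f \<in> borel_measurable borel" "g \<in> borel_measurable borel"
  shows "tensor f g \<in> borel_measurable borel"
proof -
  note [measurable] = assms
  show ?thesis unfolding tensor_def borel_prod[symmetric] by measurable
qed

lemma tensor_nn_integral:
  assumes [measurable]: "f \<in> borel_measurable borel" "g \<in> borel_measurable borel"
  shows "(\<integral>\<^sup>+z. ennreal ((norm (tensor f g z))\<^sup>2) \<partial>lborel)
    = (\<integral>\<^sup>+x. ennreal ((norm (f x))\<^sup>2) \<partial>lborel) * (\<integral>\<^sup>+x. ennreal ((norm (g x))\<^sup>2) \<partial>lborel)"
proof -
  have "(norm (tensor f g z))\<^sup>2 = (norm (f (fst z)))\<^sup>2 * (norm (g (snd z)))\<^sup>2" for z
    by (simp add: tensor_def norm_mult power_mult_distrib)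
  then show ?thesis
    by (simp add: ennreal_mult)
      (rule nn_integral_product_fst_snd[of "\<lambda>x. ennreal ((norm (f x))\<^sup>2)" "\<lambda>x. ennreal ((norm (g x))\<^sup>2)"]; measurable)
qed

lemma borel_L2_tensor: "borel_L2 f \<Longrightarrow> borel_L2 g \<Longrightarrow> borel_L2 (tensor f g)"
  by (auto simp: borel_L2_iff_nn_integral tensor_nn_integral ennreal_mult_less_top)

definition tensor_L2 :: "'a::euclidean_space L2 \<Rightarrow> 'b::euclidean_space L2 \<Rightarrow> ('a \<times> 'b) L2" where
  "tensor_L2 f g = abs_L2 (tensor (rep f) (rep g))"

lemma norm_tensor_L2: "norm (tensor_L2 f g) = norm f * norm g"
proof -
  have "ennreal ((norm (tensor_L2 f g))\<^sup>2) = ennreal ((norm f * norm g)\<^sup>2)"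
    by (simp add: tensor_L2_def ennreal_norm_abs_L2 borel_L2_tensor tensor_nn_integral nn_integral_rep
        ennreal_mult power_mult_distrib)
  then show ?thesis by (simp add: power2_eq_iff_nonneg)
qed

text \<open>By adjoints the left side equals \<open>inner (c * x) y\<close>; expanding in the basis
  and moving \<open>c\<close> back separates \<open>x\<close> from \<open>y\<close> in four real
  products.\<close>

lemma inner_quat_mult_qcnj:
  "inner (c::quat) (y * qcnj x) = (\<Sum>b\<in>Basis. inner x (qcnj c * b) * inner y b)"
  by (simp add: Basis_quat_def inner_quat_def quat_eq_iff algebra_simps)

text \<open>A constant kernel on a rectangle has real rank at most four, one for each summand of
  \<open>inner_quat_mult_qcnj\<close>.\<close>

lemma compact_form_rectangle:
  fixes A :: "'a::euclidean_space set" and B :: "'b::euclidean_space set"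
  assumes A: "A \<in> sets borel" "emeasure lborel A < \<infinity>" and B: "B \<in> sets borel" "emeasure lborel B < \<infinity>"
  shows "compact_form (\<lambda>f g. inner (abs_L2 (\<lambda>z. indicator (A \<times> B) z *\<^sub>R c)) (tensor_L2 f g))"
proof -
  have AB: "A \<times> B \<in> sets borel" using A B by (simp add: borel_prod[symmetric])
  have "emeasure lborel (A \<times> B) < \<infinity>"
    using A B by (simp add: lborel_prod[symmetric] lborel.emeasure_pair_measure_Times ennreal_mult_less_top)
  then have L2: "borel_L2 (\<lambda>z. indicator (A \<times> B) z *\<^sub>R c)" using AB by (intro borel_L2_indicator)
  have "inner (abs_L2 (\<lambda>z. indicator (A \<times> B) z *\<^sub>R c)) (tensor_L2 f g)
      = (\<Sum>b\<in>Basis. inner f (abs_L2 (\<lambda>x. indicator A x *\<^sub>R (qcnj c * b))) * inner g (abs_L2 (\<lambda>x. indicator B x *\<^sub>R b)))"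
    for f :: "'a L2" and g :: "'b L2"
  proof -
    define F where "F b x = inner (rep f x) (indicator A x *\<^sub>R (qcnj c * b))" for b x
    define G where "G b x = inner (rep g x) (indicator B x *\<^sub>R b)" for b x
    have F: "integrable lborel (F b)" "(\<integral>x. F b x \<partial>lborel) = inner f (abs_L2 (\<lambda>x. indicator A x *\<^sub>R (qcnj c * b)))" for b
      using inner_abs_L2[OF borel_L2_rep[of f] borel_L2_indicator[OF A, of "qcnj c * b"]]
        integrable_inner_borel_L2[OF borel_L2_rep[of f] borel_L2_indicator[OF A, of "qcnj c * b"]]
      by (simp_all add: F_def[abs_def])
    have G: "integrable lborel (G b)" "(\<integral>x. G b x \<partial>lborel) = inner g (abs_L2 (\<lambda>x. indicator B x *\<^sub>R b))" for b
      using inner_abs_L2[OF borel_L2_rep[of g] borel_L2_indicator[OF B, of b]]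
        integrable_inner_borel_L2[OF borel_L2_rep[of g] borel_L2_indicator[OF B, of b]]
      by (simp_all add: G_def[abs_def])
    have "inner (abs_L2 (\<lambda>z. indicator (A \<times> B) z *\<^sub>R c)) (tensor_L2 f g)
        = (\<integral>z. inner (indicator (A \<times> B) z *\<^sub>R c) (tensor (rep f) (rep g) z) \<partial>lborel)"
      unfolding tensor_L2_def by (intro inner_abs_L2 L2 borel_L2_tensor borel_L2_rep)
    also have "\<dots> = (\<integral>z. (\<Sum>b\<in>Basis. F b (fst z) * G b (snd z)) \<partial>lborel)"
    proof (intro Bochner_Integration.integral_cong refl)
      fix z
      show "inner (indicator (A \<times> B) z *\<^sub>R c) (tensor (rep f) (rep g) z) = (\<Sum>b\<in>Basis. F b (fst z) * G b (snd z))"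
        by (cases "fst z \<in> A"; cases "snd z \<in> B")
          (simp_all add: tensor_def F_def G_def inner_quat_mult_qcnj indicator_times
            linear_0[OF bounded_linear.linear[OF bounded_linear_qcnj]])
    qed
    also have "\<dots> = (\<Sum>b\<in>Basis. (\<integral>z. F b (fst z) * G b (snd z) \<partial>lborel))"
      by (intro Bochner_Integration.integral_sum integral_product_fst_snd F G)
    also have "\<dots> = (\<Sum>b\<in>Basis. inner f (abs_L2 (\<lambda>x. indicator A x *\<^sub>R (qcnj c * b))) * inner g (abs_L2 (\<lambda>x. indicator B x *\<^sub>R b)))"
      by (simp add: integral_product_fst_snd F G)
    finally show ?thesis .
  qed
  then show ?thesis by (simp add: compact_form_sum compact_form_rank_one)
qed

text \<open>Since \<open>norm_tensor_L2\<close> is multiplicative, L^2 convergence of kernels is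
  uniform convergence of the forms on bounded sets, which is the limit step of the
  induction.\<close>

lemma compact_form_kernel:
  fixes k :: "('a::euclidean_space \<times> 'b::euclidean_space) L2"
  shows "compact_form (\<lambda>f g. inner k (tensor_L2 f g))"
proof (induction k rule: L2_product_induct)
  case (rectangle A B c)
  then show ?case by (intro compact_form_rectangle)
next
  case (add k l)
  then show ?case by (simp add: inner_add_left compact_form_add)
next
  case (scale r k)
  then show ?case by (simp add: compact_form_scale)
next
  case (limit s k)
  show ?case
  proof (rule compact_form_limit)
    fix e :: real assume "0 < e"
    then obtain n where n: "norm (k - s n) < e"
      using LIMSEQ_D[OF limit(2)] by (metis norm_minus_commute order_refl)
    have "\<bar>inner k (tensor_L2 f g) - inner (s n) (tensor_L2 f g)\<bar> \<le> e * norm f * norm g"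
      for f :: "'a L2" and g :: "'b L2"
    proof -
      have "\<bar>inner (k - s n) (tensor_L2 f g)\<bar> \<le> norm (k - s n) * (norm f * norm g)"
        using Cauchy_Schwarz_ineq2 norm_tensor_L2 by metis
      also have "\<dots> \<le> e * (norm f * norm g)" using n by (intro mult_right_mono) auto
      finally show ?thesis by (simp add: inner_diff_left mult.assoc)
    qed
    then show "\<exists>A. compact_form A \<and> (\<forall>f g. \<bar>inner k (tensor_L2 f g) - A f g\<bar> \<le> e * norm f * norm g)"
      using limit(1) by blast
  qed
qed

section \<open>A Plancherel inequality for the two-sided quaternion Fourier transform\<close>

text \<open>Normalised by the value 1 at the origin and not by its integral: it tends to the
  constant 1 as \<open>s\<close> grows, while its Fourier transform is a probability
  density.\<close>

definition gauss :: "real \<Rightarrow> real \<Rightarrow> real" where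
  "gauss s x = exp (- (x / s)\<^sup>2 / 2)"

lemma gauss_std: "gauss s x = sqrt (2 * pi) * std_normal_density (x / s)"
  by (simp add: gauss_def normal_density_def power_divide)

text \<open>These are the real and imaginary parts of the characteristic function of the standard
  normal distribution.\<close>

lemma std_normal_cos_sin:
  "(\<integral>x. std_normal_density x * cos (t * x) \<partial>lborel) = exp (- t\<^sup>2 / 2)"
  "(\<integral>x. std_normal_density x * sin (t * x) \<partial>lborel) = 0"
proof -
  have int: "integrable lborel (\<lambda>x. std_normal_density x *\<^sub>R iexp (t * x))"
    by (rule Bochner_Integration.integrable_bound[OF integrable_normal_moment[of 1 0 0]]) auto
  have "complex_of_real (exp (- t\<^sup>2 / 2)) = (\<integral>x. std_normal_density x *\<^sub>R iexp (t * x) \<partial>lborel)"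
    unfolding char_std_normal_distribution[THEN fun_cong, symmetric] char_def
    by (subst integral_density) auto
  then have eq: "(\<integral>x. std_normal_density x *\<^sub>R iexp (t * x) \<partial>lborel) = complex_of_real (exp (- t\<^sup>2 / 2))" ..
  show "(\<integral>x. std_normal_density x * cos (t * x) \<partial>lborel) = exp (- t\<^sup>2 / 2)"
    using integral_Re[OF int] unfolding eq by (simp add: Re_exp)
  show "(\<integral>x. std_normal_density x * sin (t * x) \<partial>lborel) = 0"
    using integral_Im[OF int] unfolding eq by (simp add: Im_exp)
qed

lemma gauss_integrable: "0 < s \<Longrightarrow> integrable lborel (gauss s)"
  unfolding gauss_std[abs_def]
  using lborel_integrable_real_affine[of std_normal_density "1 / s" 0] integrable_normal_moment[of 1 0 0]
  by simp

text \<open>Substituting \<open>s * x\<close> reduces to the standard normal case. With the factor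
  \<open>2 * pi\<close> in the frequency, width \<open>s\<close> turns into standard deviation
  \<open>1 / (2 * pi * s)\<close>.\<close>

lemma gauss_cos_sin:
  assumes "0 < s"
  shows "(\<integral>x. gauss s x * cos (2 * pi * t * x) \<partial>lborel) = normal_density 0 (1 / (2 * pi * s)) t"
    and "(\<integral>x. gauss s x * sin (2 * pi * t * x) \<partial>lborel) = 0"
proof -
  have "(\<integral>x. gauss s x * cos (2 * pi * t * x) \<partial>lborel)
      = s * (\<integral>x. sqrt (2 * pi) * (std_normal_density x * cos ((2 * pi * t * s) * x)) \<partial>lborel)"
    using assms lborel_integral_real_affine[of s "\<lambda>x. gauss s x * cos (2 * pi * t * x)" 0]
    by (simp add: gauss_std mult_ac)
  also have "\<dots> = s * sqrt (2 * pi) * exp (- (2 * pi * t * s)\<^sup>2 / 2)"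
    using std_normal_cos_sin(1)[of "2 * pi * t * s"] by simp
  also have "\<dots> = normal_density 0 (1 / (2 * pi * s)) t"
  proof -
    have "sqrt (2 * pi * (1 / (2 * pi * s))\<^sup>2) = 1 / (s * sqrt (2 * pi))"
      using assms by (simp add: real_sqrt_mult real_sqrt_divide power2_eq_square field_simps real_sqrt_mult_self)
    then show ?thesis
      using assms by (simp add: normal_density_def power_mult_distrib field_simps)
  qed
  finally show "(\<integral>x. gauss s x * cos (2 * pi * t * x) \<partial>lborel) = normal_density 0 (1 / (2 * pi * s)) t" .
  have "(\<integral>x. gauss s x * sin (2 * pi * t * x) \<partial>lborel)
      = s * (\<integral>x. sqrt (2 * pi) * (std_normal_density x * sin ((2 * pi * t * s) * x)) \<partial>lborel)"
    using assms lborel_integral_real_affine[of s "\<lambda>x. gauss s x * sin (2 * pi * t * x)" 0]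
    by (simp add: gauss_std mult_ac)
  also have "\<dots> = 0" using std_normal_cos_sin(2)[of "2 * pi * t * s"] by simp
  finally show "(\<integral>x. gauss s x * sin (2 * pi * t * x) \<partial>lborel) = 0" .
qed

section \<open>Lebesgue measure on the plane as a product\<close>

lemma vector_2_measurable [measurable]:
  "(\<lambda>z::real \<times> real. vector [fst z, snd z] :: real^2) \<in> borel_measurable borel"
proof -
  have "(\<lambda>z::real \<times> real. vector [fst z, snd z] :: real^2) = (\<lambda>z. fst z *\<^sub>R axis 1 1 + snd z *\<^sub>R axis 2 1)"
    by (auto simp: vec_eq_iff forall_2 axis_def)
  then show ?thesis
    by (simp only:) (intro borel_measurable_continuous_onI continuous_intros)
qed

text \<open>Volumes of boxes determine Lebesgue measure, and in both types they are products of two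
  side lengths. This gives Fubini in the coordinates of \<open>real^2\<close>.\<close>

lemma lborel_real2_eq_distr:
  "(lborel :: (real^2) measure) = distr lborel borel (\<lambda>z. vector [fst z, snd z])"
proof (rule lborel_eqI)
  fix l u :: "real^2" assume le: "\<And>b. b \<in> Basis \<Longrightarrow> l \<bullet> b \<le> u \<bullet> b"
  have B: "(Basis :: (real^2) set) = {axis 1 1, axis 2 1}"
    by (auto simp: Basis_vec_def UNIV_2)
  have ne: "axis 1 1 \<noteq> (axis 2 1 :: real^2)" by (simp add: axis_eq_axis)
  have "emeasure (distr lborel borel (\<lambda>z. vector [fst z, snd z])) (box l u)
      = emeasure lborel ((\<lambda>z::real \<times> real. vector [fst z, snd z] :: real^2) -` box l u)"
    by (subst emeasure_distr) auto
  also have "(\<lambda>z::real \<times> real. vector [fst z, snd z] :: real^2) -` box l u = box (l$1, l$2) (u$1, u$2)"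
    by (auto simp: mem_box B inner_axis Basis_prod_def)
  also have "emeasure lborel \<dots> = ennreal (\<Prod>b\<in>Basis. (u - l) \<bullet> b)"
    using le[of "axis 1 1"] le[of "axis 2 1"] by (auto simp: emeasure_lborel_box_eq B ne inner_axis Basis_prod_def)
  finally show "emeasure (distr lborel borel (\<lambda>z. vector [fst z, snd z])) (box l u)
      = ennreal (\<Prod>b\<in>Basis. (u - l) \<bullet> b)" .
qed simp

lemma nn_integral_product_real2:
  fixes p q :: "real \<Rightarrow> ennreal"
  assumes [measurable]: "p \<in> borel_measurable borel" "q \<in> borel_measurable borel"
  shows "(\<integral>\<^sup>+\<xi>. p (\<xi>$1) * q (\<xi>$2) \<partial>(lborel :: (real^2) measure)) = (\<integral>\<^sup>+x. p x \<partial>lborel) * (\<integral>\<^sup>+x. q x \<partial>lborel)"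
  by (subst lborel_real2_eq_distr, subst nn_integral_distr)
    (simp_all add: nn_integral_product_fst_snd)

lemma integral_product_real2:
  fixes p q :: "real \<Rightarrow> real"
  assumes p: "integrable lborel p" and q: "integrable lborel q"
  shows "integrable (lborel :: (real^2) measure) (\<lambda>\<xi>. p (\<xi>$1) * q (\<xi>$2))"
    and "(\<integral>\<xi>. p (\<xi>$1) * q (\<xi>$2) \<partial>(lborel :: (real^2) measure)) = (\<integral>x. p x \<partial>lborel) * (\<integral>x. q x \<partial>lborel)"
proof -
  have [measurable]: "p \<in> borel_measurable borel" "q \<in> borel_measurable borel"
    using p q by auto
  show "integrable (lborel :: (real^2) measure) (\<lambda>\<xi>. p (\<xi>$1) * q (\<xi>$2))"
    by (subst lborel_real2_eq_distr, subst integrable_distr_eq)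
      (simp_all add: integral_product_fst_snd p q)
  show "(\<integral>\<xi>. p (\<xi>$1) * q (\<xi>$2) \<partial>(lborel :: (real^2) measure)) = (\<integral>x. p x \<partial>lborel) * (\<integral>x. q x \<partial>lborel)"
    by (subst lborel_real2_eq_distr, subst integral_distr)
      (simp_all add: integral_product_fst_snd p q)
qed

text \<open>The quaternion is an argument because it stands between two exponentials in different
  units, neither of which commutes with it in general.\<close>

definition modulate :: "real^2 \<Rightarrow> real^2 \<Rightarrow> quat \<Rightarrow> quat" where
  "modulate \<xi> p a = exp ((- 2 * pi * (\<xi> $ 1) * (p $ 1)) *\<^sub>R quat_i) * a *
     exp ((- 2 * pi * (\<xi> $ 2) * (p $ 2)) *\<^sub>R quat_j)"

lemma norm_modulate [simp]: "norm (modulate \<xi> p a) = norm a"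
  by (simp add: modulate_def norm_mult del: scaleR_minus_left mult_minus_left)

lemma modulate_measurable [measurable (raw)]:
  assumes [measurable]: "u \<in> borel_measurable M" "v \<in> borel_measurable M" "a \<in> borel_measurable M"
  shows "(\<lambda>x. modulate (u x) (v x) (a x)) \<in> borel_measurable M"
proof -
  have nth: "(\<lambda>x. w x $ i) \<in> borel_measurable M" if "w \<in> borel_measurable M" for w :: "_ \<Rightarrow> real^2" and i
    by (rule measurable_compose[OF that borel_measurable_nth])
  note [measurable] = nth[OF assms(1)] nth[OF assms(2)]
  show ?thesis
    unfolding modulate_def
    by (simp only: exp_quat_unit hamilton_relations) measurable
qed

text \<open>Cyclicity of the scalar part, in the form that conjugates are adjoints of left and right
  multiplications.\<close>

lemma inner_quat_mult:
  "inner z (u * y * v) = inner (qcnj u * z * qcnj v) y"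
  by (simp add: inner_quat_def algebra_simps)

lemma qcnj_exp_mult_exp:
  "qcnj (exp (t *\<^sub>R quat_i)) * exp (s *\<^sub>R quat_i) = cos (s - t) *\<^sub>R 1 + sin (s - t) *\<^sub>R quat_i"
  "exp (s *\<^sub>R quat_j) * qcnj (exp (t *\<^sub>R quat_j)) = cos (s - t) *\<^sub>R 1 + sin (s - t) *\<^sub>R quat_j"
  by (simp_all add: exp_quat_unit hamilton_relations quat_eq_iff cos_diff sin_diff)

text \<open>Taking adjoints brings the two exponentials in \<open>quat_i\<close> together on the
  left and the two in \<open>quat_j\<close> on the right; each pair commutes, so the angles subtract
  to \<open>- A\<close> and \<open>- B\<close>.\<close>

lemma inner_modulate:
  fixes \<xi> p p' :: "real^2"
  defines "A \<equiv> 2 * pi * (p $ 1 - p' $ 1) * \<xi> $ 1" and "B \<equiv> 2 * pi * (p $ 2 - p' $ 2) * \<xi> $ 2"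
  shows "inner (modulate \<xi> p a) (modulate \<xi> p' b) =
    cos A * cos B * inner a b - sin A * cos B * inner (quat_i * a) b
    - cos A * sin B * inner (a * quat_j) b + sin A * sin B * inner (quat_i * a * quat_j) b"
proof -
  define E where "E t u = exp (t *\<^sub>R u)" for t :: real and u :: quat
  have "inner (modulate \<xi> p a) (modulate \<xi> p' b)
      = inner ((qcnj (E (- 2 * pi * \<xi> $ 1 * p' $ 1) quat_i) * E (- 2 * pi * \<xi> $ 1 * p $ 1) quat_i) * a
        * (E (- 2 * pi * \<xi> $ 2 * p $ 2) quat_j * qcnj (E (- 2 * pi * \<xi> $ 2 * p' $ 2) quat_j))) b"
    unfolding modulate_def E_def[symmetric] inner_quat_mult by (simp only: mult.assoc)
  also have "\<dots> = inner ((cos (- A) *\<^sub>R 1 + sin (- A) *\<^sub>R quat_i) * a * (cos (- B) *\<^sub>R 1 + sin (- B) *\<^sub>R quat_j)) b"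
    unfolding E_def qcnj_exp_mult_exp by (simp only: A_def B_def) (simp add: algebra_simps)
  also have "\<dots> = cos A * cos B * inner a b - sin A * cos B * inner (quat_i * a) b
    - cos A * sin B * inner (a * quat_j) b + sin A * sin B * inner (quat_i * a * quat_j) b"
    by (simp add: algebra_simps inner_add_left inner_diff_left)
  finally show ?thesis .
qed

definition gauss2 :: "real \<Rightarrow> real^2 \<Rightarrow> real" where
  "gauss2 s \<xi> = gauss s (\<xi> $ 1) * gauss s (\<xi> $ 2)"

definition normal2 :: "real \<Rightarrow> real^2 \<Rightarrow> real" where
  "normal2 s p = normal_density 0 (1 / (2 * pi * s)) (p $ 1) * normal_density 0 (1 / (2 * pi * s)) (p $ 2)"

text \<open>All four terms factor over the coordinates. The sine integrals vanish, which removes the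
  terms twisted by a unit and leaves what commuting scalars would give.\<close>

lemma integral_gauss2_inner_modulate:
  assumes s: "0 < s"
  shows "(\<integral>\<xi>. gauss2 s \<xi> * inner (modulate \<xi> p a) (modulate \<xi> p' b) \<partial>lborel) = normal2 s (p - p') * inner a b"
proof -
  define C where "C t x = gauss s x * cos (2 * pi * t * x)" for t x
  define S where "S t x = gauss s x * sin (2 * pi * t * x)" for t x
  define d1 d2 where "d1 = p $ 1 - p' $ 1" and "d2 = p $ 2 - p' $ 2"
  have C: "integrable lborel (C t)" and S: "integrable lborel (S t)" for t
    unfolding C_def S_def
    by (rule Bochner_Integration.integrable_bound[OF gauss_integrable[OF s]];
        auto simp: abs_mult gauss_def[abs_def] mult_left_le)+
  have "gauss2 s \<xi> * inner (modulate \<xi> p a) (modulate \<xi> p' b) =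
      inner a b * (C d1 (\<xi>$1) * C d2 (\<xi>$2)) - inner (quat_i * a) b * (S d1 (\<xi>$1) * C d2 (\<xi>$2))
      - inner (a * quat_j) b * (C d1 (\<xi>$1) * S d2 (\<xi>$2))
      + inner (quat_i * a * quat_j) b * (S d1 (\<xi>$1) * S d2 (\<xi>$2))" for \<xi>
    unfolding inner_modulate C_def S_def d1_def d2_def gauss2_def by (simp add: algebra_simps)
  then have "(\<integral>\<xi>. gauss2 s \<xi> * inner (modulate \<xi> p a) (modulate \<xi> p' b) \<partial>lborel)
      = inner a b * ((\<integral>x. C d1 x \<partial>lborel) * (\<integral>x. C d2 x \<partial>lborel))
      - inner (quat_i * a) b * ((\<integral>x. S d1 x \<partial>lborel) * (\<integral>x. C d2 x \<partial>lborel))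
      - inner (a * quat_j) b * ((\<integral>x. C d1 x \<partial>lborel) * (\<integral>x. S d2 x \<partial>lborel))
      + inner (quat_i * a * quat_j) b * ((\<integral>x. S d1 x \<partial>lborel) * (\<integral>x. S d2 x \<partial>lborel))"
    using C S by (simp add: integral_product_real2)
  also have "\<dots> = normal2 s (p - p') * inner a b"
    unfolding C_def S_def gauss_cos_sin[OF s] by (simp add: normal2_def d1_def d2_def)
  finally show ?thesis .
qed

text \<open>The two-sided quaternion Fourier transform. As a Bochner integral it takes the value 0
  when \<open>h\<close> is not integrable.\<close>

definition qft :: "(real^2 \<Rightarrow> quat) \<Rightarrow> real^2 \<Rightarrow> quat" where
  "qft h \<xi> = (\<integral>p. modulate \<xi> p (h p) \<partial>lborel)"

lemma nn_integral_normal2: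
  assumes "0 < s"
  shows "(\<integral>\<^sup>+p. ennreal (normal2 s (p - a)) \<partial>lborel) = 1" "(\<integral>\<^sup>+p. ennreal (normal2 s (a - p)) \<partial>lborel) = 1"
proof -
  define n where "n = normal_density 0 (1 / (2 * pi * s))"
  have [measurable]: "n \<in> borel_measurable borel" unfolding n_def by simp
  have n: "0 \<le> n x" "normal2 s p = n (p $ 1) * n (p $ 2)" for x p
    by (simp_all add: n_def normal2_def)
  have "(\<integral>\<^sup>+x. ennreal (n x) \<partial>lborel) = 1"
    unfolding n_def using assms by (subst nn_integral_eq_integral) auto
  then have one: "(\<integral>\<^sup>+p. ennreal (normal2 s p) \<partial>lborel) = 1"
    by (simp add: n ennreal_mult nn_integral_product_real2[of "\<lambda>x. ennreal (n x)" "\<lambda>x. ennreal (n x)"])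
  have [measurable]: "normal2 s \<in> borel_measurable borel" unfolding n by measurable
  have "(\<integral>\<^sup>+p. ennreal (normal2 s (p - a)) \<partial>lborel)
      = (\<integral>\<^sup>+p. ennreal (normal2 s (p - a)) \<partial>(distr lborel borel ((+) a)))"
    by (simp add: lborel_distr_plus)
  also have "\<dots> = 1" by (subst nn_integral_distr) (simp_all add: one)
  finally show eq: "(\<integral>\<^sup>+p. ennreal (normal2 s (p - a)) \<partial>lborel) = 1" .
  have "normal2 s (a - p) = normal2 s (p - a)" for p
    by (simp add: normal2_def normal_density_def power2_commute)
  then show "(\<integral>\<^sup>+p. ennreal (normal2 s (a - p)) \<partial>lborel) = 1" using eq by simp
qed

lemma
  assumes "0 < s"
  shows gauss2_nonneg: "0 \<le> gauss2 s \<xi>"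
    and gauss2_integrable: "integrable lborel (gauss2 s)"
    and gauss2_measurable: "gauss2 s \<in> borel_measurable borel"
proof -
  show "0 \<le> gauss2 s \<xi>" by (simp add: gauss2_def gauss_def)
  show "integrable lborel (gauss2 s)"
    unfolding gauss2_def[abs_def] by (intro integral_product_real2 gauss_integrable assms)
  then show "gauss2 s \<in> borel_measurable borel" by auto
qed

lemma normal2_measurable [measurable]: "normal2 s \<in> borel_measurable borel"
  unfolding normal2_def[abs_def] by measurable

lemma normal2_nonneg [simp]: "0 \<le> normal2 s p"
  by (simp add: normal2_def)

lemma integrable_modulate:
  assumes "integrable lborel h"
  shows "integrable lborel (\<lambda>p. modulate \<xi> p (h p))"
proof (rule Bochner_Integration.integrable_bound[OF assms])
  have [measurable]: "h \<in> borel_measurable borel" using assms by auto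
  show "(\<lambda>p. modulate \<xi> p (h p)) \<in> borel_measurable lborel" by measurable
qed simp

lemma qft_measurable:
  assumes [measurable]: "h \<in> borel_measurable borel"
  shows "qft h \<in> borel_measurable borel"
proof -
  have "(\<lambda>z. modulate (fst z) (snd z) (h (snd z))) \<in> borel_measurable (borel \<Otimes>\<^sub>M lborel)"
    by measurable
  then show ?thesis
    unfolding qft_def[abs_def] by (intro lborel.borel_measurable_lebesgue_integral) (simp add: split_beta')
qed

text \<open>
  Expanding the square gives a Gaussian integral in \<open>\<xi>\<close>: the scalar part is cyclic, so the two exponentials on
  either side of \<open>h p\<close> combine with those around \<open>h p'\<close>, and only the even part survives.
\<close>

lemma integral_gauss2_qft:
  assumes s: "0 < s" and h: "integrable lborel h"
  shows "integrable lborel (\<lambda>\<xi>. gauss2 s \<xi> * (norm (qft h \<xi>))\<^sup>2)"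
    and "integrable lborel (\<lambda>w. normal2 s (fst w - snd w) * inner (h (fst w)) (h (snd w)))"
    and "(\<integral>\<xi>. gauss2 s \<xi> * (norm (qft h \<xi>))\<^sup>2 \<partial>lborel)
      = (\<integral>w. normal2 s (fst w - snd w) * inner (h (fst w)) (h (snd w)) \<partial>lborel)"
proof -
  have hm [measurable]: "h \<in> borel_measurable borel" using h by auto
  note gm [measurable] = gauss2_measurable[OF s]
  have hn: "integrable lborel (\<lambda>p. norm (h p))" using h by simp
  define I where "I = (\<lambda>(\<xi>, w). gauss2 s \<xi> * inner (modulate \<xi> (fst w) (h (fst w))) (modulate \<xi> (snd w) (h (snd w))))"
  have hh: "integrable lborel (\<lambda>w::(real^2)\<times>(real^2). norm (h (fst w)) * norm (h (snd w)))"
    by (rule integral_product_fst_snd[OF hn hn])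
  have meas: "(\<lambda>w::(real^2)\<times>(real^2). inner (modulate \<xi> (fst w) (h (fst w))) (modulate \<xi> (snd w) (h (snd w)))) \<in> borel_measurable borel" for \<xi>
    unfolding borel_prod[symmetric] by measurable
  have w_int: "integrable lborel (\<lambda>w::(real^2)\<times>(real^2). inner (modulate \<xi> (fst w) (h (fst w))) (modulate \<xi> (snd w) (h (snd w))))" for \<xi>
    by (rule Bochner_Integration.integrable_bound[OF hh])
      (use meas in \<open>auto intro!: order_trans[OF Cauchy_Schwarz_ineq2]\<close>)
  \<comment> \<open>The Gaussian supplies integrability in \<xi> and \<open>h\<close> supplies it in
    the other two variables, so the triple integral converges absolutely.\<close>
  have "integrable lborel (\<lambda>z::(real^2) \<times> ((real^2)\<times>(real^2)). gauss2 s (fst z) * (norm (h (fst (snd z))) * norm (h (snd (snd z)))))"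
    by (rule integral_product_fst_snd[OF gauss2_integrable[OF s] hh])
  then have I: "integrable (lborel \<Otimes>\<^sub>M lborel) I"
    unfolding lborel_prod
  proof (rule Bochner_Integration.integrable_bound)
    show "I \<in> borel_measurable lborel"
      unfolding I_def measurable_lborel2 borel_prod[symmetric] by (simp add: split_beta')
    show "AE z in lborel. norm (I z) \<le> norm (gauss2 s (fst z) * (norm (h (fst (snd z))) * norm (h (snd (snd z)))))"
      using gauss2_nonneg[OF s]
      by (auto simp: I_def split_beta abs_mult intro!: mult_left_mono order_trans[OF Cauchy_Schwarz_ineq2])
  qed
  have sq: "(\<integral>w. I (\<xi>, w) \<partial>lborel) = gauss2 s \<xi> * (norm (qft h \<xi>))\<^sup>2" for \<xi>
  proof -
    have int: "integrable lborel (\<lambda>p. modulate \<xi> p (h p))" by (rule integrable_modulate[OF h])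
    have "(\<integral>w. inner (modulate \<xi> (fst w) (h (fst w))) (modulate \<xi> (snd w) (h (snd w))) \<partial>lborel)
        = (\<integral>p. \<integral>p'. inner (modulate \<xi> p (h p)) (modulate \<xi> p' (h p')) \<partial>lborel \<partial>lborel)"
      using lborel_pair.integral_fst'[of "\<lambda>w. inner (modulate \<xi> (fst w) (h (fst w))) (modulate \<xi> (snd w) (h (snd w)))"] w_int[of \<xi>]
      by (simp add: lborel_prod)
    also have "\<dots> = (\<integral>p. inner (modulate \<xi> p (h p)) (qft h \<xi>) \<partial>lborel)"
      unfolding qft_def using int by simp
    also have "\<dots> = inner (qft h \<xi>) (qft h \<xi>)"
      unfolding qft_def using int by simp
    finally show ?thesis by (simp add: I_def power2_norm_eq_inner)
  qed
  have swap: "(\<integral>\<xi>. I (\<xi>, w) \<partial>lborel) = normal2 s (fst w - snd w) * inner (h (fst w)) (h (snd w))" for w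
    by (simp add: I_def integral_gauss2_inner_modulate[OF s])
  show "integrable lborel (\<lambda>\<xi>. gauss2 s \<xi> * (norm (qft h \<xi>))\<^sup>2)"
    using lborel_pair.integrable_fst'[OF I] by (simp add: sq)
  have I': "integrable (lborel \<Otimes>\<^sub>M lborel) (\<lambda>(w, \<xi>). I (\<xi>, w))"
    using lborel_pair.integrable_product_swap[OF I] .
  show "integrable lborel (\<lambda>w. normal2 s (fst w - snd w) * inner (h (fst w)) (h (snd w)))"
    using lborel_pair.integrable_fst'[OF I'] by (simp add: swap)
  have "(\<integral>\<xi>. (\<integral>w. I (\<xi>, w) \<partial>lborel) \<partial>lborel) = (\<integral>w. (\<integral>\<xi>. I (\<xi>, w) \<partial>lborel) \<partial>lborel)"
    using lborel_pair.integral_fst'[OF I] lborel_pair.integral_fst'[OF I'] lborel_pair.integral_product_swap[of I] I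
    by (simp add: borel_measurable_integrable)
  then show "(\<integral>\<xi>. gauss2 s \<xi> * (norm (qft h \<xi>))\<^sup>2 \<partial>lborel)
      = (\<integral>w. normal2 s (fst w - snd w) * inner (h (fst w)) (h (snd w)) \<partial>lborel)"
    by (simp add: sq swap)
qed

text \<open>A Schur test: the product of two values of \<open>h\<close> is at most half the sum of
  their squares, and \<open>normal2\<close> has mass 1 in each variable separately. The bound does
  not depend on \<open>s\<close>.\<close>

lemma qft_gauss2_bound:
  assumes s: "0 < s" and h: "integrable lborel h"
  shows "(\<integral>\<^sup>+\<xi>. ennreal (gauss2 s \<xi> * (norm (qft h \<xi>))\<^sup>2) \<partial>lborel) \<le> (\<integral>\<^sup>+p. ennreal ((norm (h p))\<^sup>2) \<partial>lborel)"
proof -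
  have hm [measurable]: "h \<in> borel_measurable borel" using h by auto
  let ?N = "\<lambda>w::(real^2)\<times>(real^2). normal2 s (fst w - snd w)"
  let ?h = "\<integral>\<^sup>+p. ennreal ((norm (h p))\<^sup>2) \<partial>lborel"
  have "(\<integral>\<^sup>+\<xi>. ennreal (gauss2 s \<xi> * (norm (qft h \<xi>))\<^sup>2) \<partial>lborel)
      = ennreal (\<integral>w. ?N w * inner (h (fst w)) (h (snd w)) \<partial>lborel)"
    using integral_gauss2_qft[OF s h] gauss2_nonneg[OF s]
    by (subst nn_integral_eq_integral) auto
  also have "\<dots> \<le> (\<integral>\<^sup>+w. ennreal (norm (?N w * inner (h (fst w)) (h (snd w)))) \<partial>lborel)"
    by (rule order_trans[OF ennreal_leI integral_norm_bound_ennreal[OF integral_gauss2_qft(2)[OF s h]]]) simp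
  also have "\<dots> \<le> (\<integral>\<^sup>+w. ennreal (1/2) * (ennreal (?N w) * ennreal ((norm (h (fst w)))\<^sup>2))
      + ennreal (1/2) * (ennreal (?N w) * ennreal ((norm (h (snd w)))\<^sup>2)) \<partial>lborel)"
  proof (rule nn_integral_mono)
    fix w :: "(real^2)\<times>(real^2)"
    have "\<bar>inner (h (fst w)) (h (snd w))\<bar> \<le> 1/2 * (norm (h (fst w)))\<^sup>2 + 1/2 * (norm (h (snd w)))\<^sup>2"
      using Cauchy_Schwarz_ineq2[of "h (fst w)" "h (snd w)"] sum_squares_bound[of "norm (h (fst w))" "norm (h (snd w))"]
      by linarith
    then have "norm (?N w * inner (h (fst w)) (h (snd w)))
        \<le> ?N w * (1/2 * (norm (h (fst w)))\<^sup>2 + 1/2 * (norm (h (snd w)))\<^sup>2)"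
      unfolding real_norm_def abs_mult abs_of_nonneg[OF normal2_nonneg] by (rule mult_left_mono) simp
    then have "ennreal (norm (?N w * inner (h (fst w)) (h (snd w))))
        \<le> ennreal (1/2 * (?N w * (norm (h (fst w)))\<^sup>2) + 1/2 * (?N w * (norm (h (snd w)))\<^sup>2))"
      by (intro ennreal_leI) (simp add: algebra_simps)
    also have "\<dots> = ennreal (1/2) * (ennreal (?N w) * ennreal ((norm (h (fst w)))\<^sup>2))
      + ennreal (1/2) * (ennreal (?N w) * ennreal ((norm (h (snd w)))\<^sup>2))"
      by (simp only: ennreal_plus ennreal_mult normal2_nonneg zero_le_power2 mult_nonneg_nonneg
          zero_le_divide_1_iff zero_le_numeral)
    finally show "ennreal (norm (?N w * inner (h (fst w)) (h (snd w)))) \<le> \<dots>" .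
  qed
  also have "\<dots> = ennreal (1/2) * (\<integral>\<^sup>+w. ennreal (?N w) * ennreal ((norm (h (fst w)))\<^sup>2) \<partial>lborel)
      + ennreal (1/2) * (\<integral>\<^sup>+w. ennreal (?N w) * ennreal ((norm (h (snd w)))\<^sup>2) \<partial>lborel)"
    unfolding lborel_prod[symmetric] by (subst nn_integral_add; (subst nn_integral_cmult)?; (subst nn_integral_cmult)?; measurable)
  also have "(\<integral>\<^sup>+w. ennreal (?N w) * ennreal ((norm (h (fst w)))\<^sup>2) \<partial>lborel) = ?h"
    unfolding lborel_prod[symmetric]
    by (subst lborel.nn_integral_fst[symmetric]) (simp_all add: nn_integral_multc nn_integral_normal2[OF s])
  also have "(\<integral>\<^sup>+w. ennreal (?N w) * ennreal ((norm (h (snd w)))\<^sup>2) \<partial>lborel) = ?h"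
    unfolding lborel_prod[symmetric]
    by (subst lborel_pair.nn_integral_snd[symmetric]) (simp_all add: nn_integral_multc nn_integral_normal2[OF s])
  also have "ennreal (1/2) * ?h + ennreal (1/2) * ?h = ?h"
  proof -
    have "ennreal (1/2) + ennreal (1/2) = ennreal (1/2 + 1/2)"
      by (rule ennreal_plus[symmetric]) auto
    then show ?thesis by (simp only: distrib_right[symmetric]) simp
  qed
  finally show ?thesis .
qed

text \<open>Fatou along \<open>s = Suc n\<close>: the Gaussian weight tends to 1 at every point,
  under a bound independent of \<open>s\<close>.\<close>

lemma qft_Plancherel_integrable:
  assumes h: "integrable lborel h"
  shows "(\<integral>\<^sup>+\<xi>. ennreal ((norm (qft h \<xi>))\<^sup>2) \<partial>lborel) \<le> (\<integral>\<^sup>+p. ennreal ((norm (h p))\<^sup>2) \<partial>lborel)"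
proof -
  have [measurable]: "qft h \<in> borel_measurable borel" using h by (intro qft_measurable) auto
  note [measurable] = gauss2_measurable
  have "(\<lambda>n. gauss2 (real (Suc n)) \<xi>) \<longlonglongrightarrow> 1" for \<xi>
  proof -
    have "(\<lambda>n. gauss2 (real (Suc n)) \<xi>) \<longlonglongrightarrow> exp (- 0\<^sup>2 / 2) * exp (- 0\<^sup>2 / 2)"
      unfolding gauss2_def gauss_def
      by (intro tendsto_intros LIMSEQ_Suc[OF lim_const_over_n]) auto
    then show ?thesis by simp
  qed
  then have "(\<lambda>n. ennreal (gauss2 (real (Suc n)) \<xi> * (norm (qft h \<xi>))\<^sup>2)) \<longlonglongrightarrow> ennreal (1 * (norm (qft h \<xi>))\<^sup>2)" for \<xi>
    by (intro tendsto_ennrealI tendsto_mult tendsto_const)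
  from lim_imp_Liminf[OF _ this]
  have "(\<integral>\<^sup>+\<xi>. ennreal ((norm (qft h \<xi>))\<^sup>2) \<partial>lborel)
      = (\<integral>\<^sup>+\<xi>. liminf (\<lambda>n. ennreal (gauss2 (real (Suc n)) \<xi> * (norm (qft h \<xi>))\<^sup>2)) \<partial>lborel)"
    by simp
  also have "\<dots> \<le> liminf (\<lambda>n. \<integral>\<^sup>+\<xi>. ennreal (gauss2 (real (Suc n)) \<xi> * (norm (qft h \<xi>))\<^sup>2) \<partial>lborel)"
    by (rule nn_integral_liminf) (simp add: gauss2_measurable)
  also have "\<dots> \<le> limsup (\<lambda>n. \<integral>\<^sup>+\<xi>. ennreal (gauss2 (real (Suc n)) \<xi> * (norm (qft h \<xi>))\<^sup>2) \<partial>lborel)"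
    by (rule Liminf_le_Limsup) simp
  also have "\<dots> \<le> (\<integral>\<^sup>+p. ennreal ((norm (h p))\<^sup>2) \<partial>lborel)"
    using qft_gauss2_bound[OF _ h] by (intro Limsup_bounded always_eventually) auto
  finally show ?thesis .
qed

section \<open>The Wigner transform is bounded into $L^2$\<close>

lemma nn_integral_affine:
  fixes h :: "'a::euclidean_space \<Rightarrow> ennreal"
  assumes c: "c \<noteq> 0" and [measurable]: "h \<in> borel_measurable borel"
  shows "(\<integral>\<^sup>+x. h x \<partial>lborel) = ennreal (\<bar>c\<bar> ^ DIM('a)) * (\<integral>\<^sup>+x. h (t + c *\<^sub>R x) \<partial>lborel)"
  by (subst lborel_affine[OF c, of t], subst nn_integral_density, simp, simp)
    (simp add: nn_integral_distr nn_integral_cmult)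

definition half_shift :: "'a::real_vector \<times> 'a \<Rightarrow> 'a \<times> 'a" where
  "half_shift z = (fst z + (1/2) *\<^sub>R snd z, fst z - (1/2) *\<^sub>R snd z)"

lemma half_shift_measurable [measurable]:
  "(half_shift :: 'a::euclidean_space \<times> 'a \<Rightarrow> 'a \<times> 'a) \<in> borel_measurable borel"
  unfolding half_shift_def[abs_def] by (intro borel_measurable_continuous_onI continuous_intros)

text \<open>Two substitutions in one variable each, separated by Tonelli, replace a determinant:
  \<open>p = 2 *\<^sub>R u - 2 *\<^sub>R x\<close> contributes the factor
  \<open>2 ^ DIM('a)\<close>, and \<open>v = 2 *\<^sub>R x - u\<close> absorbs it.\<close>

lemma distr_half_shift:
  "distr lborel borel half_shift = (lborel :: ('a::euclidean_space \<times> 'a) measure)"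
proof (rule measure_eqI)
  fix A :: "('a \<times> 'a) set" assume "A \<in> sets (distr lborel borel half_shift)"
  then have A: "A \<in> sets borel" by simp
  define h :: "'a \<times> 'a \<Rightarrow> ennreal" where "h = indicator A"
  have hm [measurable]: "h \<in> borel_measurable (borel \<Otimes>\<^sub>M borel)"
    using A by (simp add: h_def borel_prod)
  have cont: "(\<lambda>z::'a \<times> 'a. (fst z, 2 *\<^sub>R snd z - fst z)) \<in> borel \<rightarrow>\<^sub>M borel \<Otimes>\<^sub>M borel"
    unfolding borel_prod by (intro borel_measurable_continuous_onI continuous_intros)
  have "emeasure (distr lborel borel half_shift) A = (\<integral>\<^sup>+z. h (half_shift z) \<partial>lborel)"
    using A by (simp add: nn_integral_distr h_def flip: nn_integral_indicator)
  also have "\<dots> = (\<integral>\<^sup>+x. \<integral>\<^sup>+p. h (x + (1/2) *\<^sub>R p, x - (1/2) *\<^sub>R p) \<partial>lborel \<partial>lborel)"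
    unfolding lborel_prod[symmetric]
    by (subst lborel.nn_integral_fst[symmetric]) (simp_all add: half_shift_def borel_prod[symmetric])
  also have "\<dots> = (\<integral>\<^sup>+x. ennreal (2 ^ DIM('a)) * (\<integral>\<^sup>+u. h (u, 2 *\<^sub>R x - u) \<partial>lborel) \<partial>lborel)"
  proof (rule nn_integral_cong)
    fix x :: 'a
    show "(\<integral>\<^sup>+p. h (x + (1/2) *\<^sub>R p, x - (1/2) *\<^sub>R p) \<partial>lborel)
        = ennreal (2 ^ DIM('a)) * (\<integral>\<^sup>+u. h (u, 2 *\<^sub>R x - u) \<partial>lborel)"
      by (subst nn_integral_affine[of 2 _ "(-2) *\<^sub>R x"]) (simp_all add: algebra_simps, simp add: scaleR_2)
  qed
  also have "\<dots> = ennreal (2 ^ DIM('a)) * (\<integral>\<^sup>+x. \<integral>\<^sup>+u. h (u, 2 *\<^sub>R x - u) \<partial>lborel \<partial>lborel)"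
    by (rule nn_integral_cmult) measurable
  also have "\<dots> = ennreal (2 ^ DIM('a)) * (\<integral>\<^sup>+u. \<integral>\<^sup>+x. h (u, 2 *\<^sub>R x - u) \<partial>lborel \<partial>lborel)"
    by (subst lborel_pair.Fubini') (simp_all add: split_beta')
  also have "\<dots> = (\<integral>\<^sup>+u. ennreal (2 ^ DIM('a)) * (\<integral>\<^sup>+x. h (u, 2 *\<^sub>R x - u) \<partial>lborel) \<partial>lborel)"
    by (rule nn_integral_cmult[symmetric]) measurable
  also have "\<dots> = (\<integral>\<^sup>+u. \<integral>\<^sup>+v. h (u, v) \<partial>lborel \<partial>lborel)"
  proof (rule nn_integral_cong)
    fix u :: 'a
    show "ennreal (2 ^ DIM('a)) * (\<integral>\<^sup>+x. h (u, 2 *\<^sub>R x - u) \<partial>lborel) = (\<integral>\<^sup>+v. h (u, v) \<partial>lborel)"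
      by (subst (2) nn_integral_affine[of 2 _ "- u"]) (simp_all add: algebra_simps)
  qed
  also have "\<dots> = (\<integral>\<^sup>+z. h z \<partial>lborel)"
    unfolding lborel_prod[symmetric] by (subst lborel.nn_integral_fst) simp_all
  also have "\<dots> = emeasure lborel A" using A by (simp add: h_def)
  finally show "emeasure (distr lborel borel half_shift) A = emeasure lborel A" .
qed simp

lemma nn_integral_half_shift:
  fixes h :: "'a::euclidean_space \<times> 'a \<Rightarrow> ennreal"
  assumes [measurable]: "h \<in> borel_measurable borel"
  shows "(\<integral>\<^sup>+z. h (half_shift z) \<partial>lborel) = (\<integral>\<^sup>+z. h z \<partial>lborel)"
  by (subst (2) distr_half_shift[symmetric]) (simp add: nn_integral_distr)

lemma integral_half_shift:
  fixes h :: "'a::euclidean_space \<times> 'a \<Rightarrow> real"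
  assumes [measurable]: "h \<in> borel_measurable borel"
  shows "(\<integral>z. h (half_shift z) \<partial>lborel) = (\<integral>z. h z \<partial>lborel)"
  by (subst (2) distr_half_shift[symmetric]) (simp add: integral_distr)

text \<open>Modulation preserves the norm, so for non-integrable \<open>h\<close> every integrand is
  non-integrable and \<open>qft h\<close> is 0 by default. Sections of a function can thus be
  treated without exceptional sets.\<close>

lemma qft_Plancherel:
  assumes "h \<in> borel_measurable borel"
  shows "(\<integral>\<^sup>+\<xi>. ennreal ((norm (qft h \<xi>))\<^sup>2) \<partial>lborel) \<le> (\<integral>\<^sup>+p. ennreal ((norm (h p))\<^sup>2) \<partial>lborel)"
proof (cases "integrable lborel h")
  case False
  have "\<not> integrable lborel (\<lambda>p. modulate \<xi> p (h p))" for \<xi>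
  proof
    assume "integrable lborel (\<lambda>p. modulate \<xi> p (h p))"
    then have "integrable lborel h"
      by (rule Bochner_Integration.integrable_bound) (use assms in auto)
    then show False using False by simp
  qed
  then show ?thesis by (simp add: qft_def not_integrable_integral_eq)
qed (rule qft_Plancherel_integrable)

text \<open>The Wigner integrand without its exponentials, in the variables \<open>(x, p)\<close>.
  The conjugate undoes the reversed order of the factors in \<open>tensor\<close>.\<close>

definition correlation :: "(real^2 \<Rightarrow> quat) \<Rightarrow> (real^2 \<Rightarrow> quat) \<Rightarrow> (real^2) \<times> (real^2) \<Rightarrow> quat" where
  "correlation f g z = qcnj (tensor f g (half_shift z))"

lemma qcnj_mult: "qcnj (x * y) = qcnj y * qcnj x" and qcnj_qcnj [simp]: "qcnj (qcnj x) = x"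
  by (simp_all add: quat_eq_iff)

lemma correlation_measurable [measurable]:
  assumes "f \<in> borel_measurable borel" "g \<in> borel_measurable borel"
  shows "correlation f g \<in> borel_measurable borel"
proof -
  note [measurable] = tensor_measurable[OF assms]
  show ?thesis unfolding correlation_def[abs_def] by measurable
qed

lemma correlation_eq: "correlation f g (x, p) = f (x + (1/2) *\<^sub>R p) * qcnj (g (x - (1/2) *\<^sub>R p))"
  by (simp add: correlation_def tensor_def half_shift_def qcnj_mult)

lemma correlation_section:
  assumes f: "borel_L2 f" and g: "borel_L2 g"
  shows "integrable lborel (\<lambda>p. correlation f g (x, p))"
    and "(\<integral>p. norm (correlation f g (x, p)) \<partial>lborel) \<le> 4 * norm (abs_L2 f) * norm (abs_L2 g)"
proof -
  have Lf: "Lp_fun 2 f" and Lg: "Lp_fun 2 g" using f g by (simp_all add: borel_L2_imp_Lp_fun)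
  have m: "correlation f g \<in> borel_measurable borel"
    using f g by (intro correlation_measurable borel_L2_measurable)
  have m': "(\<lambda>p. correlation f g (x, p)) \<in> borel_measurable borel"
    by (rule measurable_compose[OF _ m]) (simp add: borel_prod[symmetric])
  \<comment> \<open>At frequency 0 both exponentials are 1, so integrability is inherited from the
    Wigner integrand.\<close>
  have eq: "wigner_integrand f g x 0 = (\<lambda>p. correlation f g (x, p))"
    by (simp add: wigner_integrand_def correlation_eq fun_eq_iff)
  show "integrable lborel (\<lambda>p. correlation f g (x, p))"
    using integrable_wigner_integrand[OF Lf Lg, of x 0] m' unfolding eq by (simp add: integrable_completion)
  have f2: "(\<integral>p. (norm (f (x + (1/2) *\<^sub>R p)))\<^sup>2 \<partial>lebesgue) = 4 * (\<integral>y. (norm (f y))\<^sup>2 \<partial>lebesgue)"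
    using Lp_fun_2_affine_scaleR(2) [OF _ Lf, of "1/2" x] by (simp add: power2_eq_square)
  have g2: "(\<integral>p. (norm (g (x - (1/2) *\<^sub>R p)))\<^sup>2 \<partial>lebesgue) = 4 * (\<integral>y. (norm (g y))\<^sup>2 \<partial>lebesgue)"
    using Lp_fun_2_affine_scaleR(2) [OF _ Lg, of "-1/2" x] by (simp add: power2_eq_square)
  have "(\<integral>p. norm (correlation f g (x, p)) \<partial>lborel) = (\<integral>p. norm (correlation f g (x, p)) \<partial>lebesgue)"
    using m' by (simp add: integral_completion)
  also have "\<dots> \<le> sqrt (\<integral>p. (norm (f (x + (1/2) *\<^sub>R p)))\<^sup>2 \<partial>lebesgue)
      * sqrt (\<integral>p. (norm (g (x - (1/2) *\<^sub>R p)))\<^sup>2 \<partial>lebesgue)"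
    unfolding correlation_eq norm_mult norm_qcnj
    by (rule Cauchy_Schwarz_Lp_fun_2 [OF Lp_fun_2_half_shift(1) [OF Lf] Lp_fun_2_half_shift(2) [OF Lg]])
  also have "\<dots> = 4 * norm (abs_L2 f) * norm (abs_L2 g)"
    unfolding f2 g2 using f g by (simp add: norm_L2.abs_eq borel_L2_rel real_sqrt_mult)
  finally show "(\<integral>p. norm (correlation f g (x, p)) \<partial>lborel) \<le> 4 * norm (abs_L2 f) * norm (abs_L2 g)" .
qed

lemma nn_integral_correlation:
  "(\<integral>\<^sup>+z. ennreal ((norm (correlation (rep f) (rep g) z))\<^sup>2) \<partial>lborel) = ennreal ((norm f * norm g)\<^sup>2)"
proof -
  have "(\<integral>\<^sup>+z. ennreal ((norm (correlation (rep f) (rep g) z))\<^sup>2) \<partial>lborel)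
      = (\<integral>\<^sup>+z. ennreal ((norm (tensor (rep f) (rep g) z))\<^sup>2) \<partial>lborel)"
    unfolding correlation_def norm_qcnj
    by (rule nn_integral_half_shift[of "\<lambda>z. ennreal ((norm (tensor (rep f) (rep g) z))\<^sup>2)"]) measurable
  also have "\<dots> = ennreal ((norm f * norm g)\<^sup>2)"
    by (simp add: tensor_nn_integral nn_integral_rep ennreal_mult power_mult_distrib)
  finally show ?thesis .
qed

text \<open>\<open>wigner\<close> depends only on the classes at every single point, so passing to
  Borel representatives costs no null set.\<close>

lemma wigner_eq_qft: "wigner f g (x, \<xi>) = qft (\<lambda>p. correlation (rep f) (rep g) (x, p)) \<xi>"
proof -
  have "wigner f g = wigner (abs_L2 (rep f)) (abs_L2 (rep g))" by simp
  also have "\<dots> = wigner_fun (rep f) (rep g)"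
    by (rule wigner.abs_eq) (simp_all add: borel_L2_rel)
  finally have "wigner f g (x, \<xi>) = (\<integral>p. wigner_integrand (rep f) (rep g) x \<xi> p \<partial>lebesgue)"
    by (simp add: wigner_fun_def)
  also have "wigner_integrand (rep f) (rep g) x \<xi> = (\<lambda>p. modulate \<xi> p (correlation (rep f) (rep g) (x, p)))"
    by (simp only: wigner_integrand_def modulate_def correlation_eq mult.assoc fun_eq_iff) simp
  also have "(\<integral>p. modulate \<xi> p (correlation (rep f) (rep g) (x, p)) \<partial>lebesgue) = qft (\<lambda>p. correlation (rep f) (rep g) (x, p)) \<xi>"
    unfolding qft_def
  proof (rule integral_completion)
    have "(\<lambda>p. correlation (rep f) (rep g) (x, p)) \<in> borel_measurable borel"
      using correlation_section(1)[OF borel_L2_rep[of f] borel_L2_rep[of g], of x] by auto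
    note [measurable] = this
    show "(\<lambda>p. modulate \<xi> p (correlation (rep f) (rep g) (x, p))) \<in> borel_measurable lborel"
      by measurable
  qed
  finally show ?thesis .
qed

lemma qft_section_measurable:
  fixes h :: "(real^2) \<times> (real^2) \<Rightarrow> quat"
  assumes "h \<in> borel_measurable borel"
  shows "(\<lambda>z. qft (\<lambda>p. h (fst z, p)) (snd z)) \<in> borel_measurable borel"
proof -
  have [measurable]: "h \<in> borel_measurable (borel \<Otimes>\<^sub>M borel)" using assms by (simp add: borel_prod)
  have "(\<lambda>w. modulate (snd (fst w)) (snd w) (h (fst (fst w), snd w))) \<in> borel_measurable ((borel \<Otimes>\<^sub>M borel) \<Otimes>\<^sub>M lborel)"
    by measurable
  then show ?thesis
    unfolding qft_def borel_prod[symmetric]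
    by (intro lborel.borel_measurable_lebesgue_integral) (simp add: split_beta')
qed

text \<open>Plancherel in the second variable only, integrated over the first by Tonelli.\<close>

lemma qft_section_nn_integral:
  fixes h :: "(real^2) \<times> (real^2) \<Rightarrow> quat"
  assumes h: "h \<in> borel_measurable borel"
  shows "(\<integral>\<^sup>+z. ennreal ((norm (qft (\<lambda>p. h (fst z, p)) (snd z)))\<^sup>2) \<partial>lborel) \<le> (\<integral>\<^sup>+z. ennreal ((norm (h z))\<^sup>2) \<partial>lborel)"
proof -
  note [measurable] = qft_section_measurable[OF h, unfolded borel_prod[symmetric]] h[unfolded borel_prod[symmetric]]
  have "(\<integral>\<^sup>+z. ennreal ((norm (qft (\<lambda>p. h (fst z, p)) (snd z)))\<^sup>2) \<partial>lborel)
      = (\<integral>\<^sup>+x. \<integral>\<^sup>+\<xi>. ennreal ((norm (qft (\<lambda>p. h (x, p)) \<xi>))\<^sup>2) \<partial>lborel \<partial>lborel)"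
    unfolding lborel_prod[symmetric] by (subst lborel.nn_integral_fst[symmetric]) simp_all
  also have "\<dots> \<le> (\<integral>\<^sup>+x. \<integral>\<^sup>+p. ennreal ((norm (h (x, p)))\<^sup>2) \<partial>lborel \<partial>lborel)"
    by (intro nn_integral_mono qft_Plancherel) measurable
  also have "\<dots> = (\<integral>\<^sup>+z. ennreal ((norm (h z))\<^sup>2) \<partial>lborel)"
    unfolding lborel_prod[symmetric] by (subst lborel.nn_integral_fst[symmetric]) simp_all
  finally show ?thesis .
qed

text \<open>The map is a composition of a tensor product, whose norm is multiplicative, the measure
  preserving \<open>half_shift\<close>, and a partial transform that does not increase the norm.
  Hence the constant 1.\<close>

lemma wigner_borel_L2: "borel_L2 (wigner f g)" and norm_wigner_L2: "norm (abs_L2 (wigner f g)) \<le> norm f * norm g"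
proof -
  have m: "correlation (rep f) (rep g) \<in> borel_measurable borel" by measurable
  have W: "wigner f g = (\<lambda>z. qft (\<lambda>p. correlation (rep f) (rep g) (fst z, p)) (snd z))"
    by (simp add: fun_eq_iff wigner_eq_qft)
  have le: "(\<integral>\<^sup>+z. ennreal ((norm (wigner f g z))\<^sup>2) \<partial>lborel) \<le> ennreal ((norm f * norm g)\<^sup>2)"
    using qft_section_nn_integral[OF m] unfolding W nn_integral_correlation .
  also have "\<dots> < \<infinity>" by simp
  finally show L2: "borel_L2 (wigner f g)"
    unfolding borel_L2_iff_nn_integral W using qft_section_measurable[OF m] by simp
  have "(norm (abs_L2 (wigner f g)))\<^sup>2 \<le> (norm f * norm g)\<^sup>2"
    using le unfolding ennreal_norm_abs_L2[OF L2, symmetric] by simp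
  then show "norm (abs_L2 (wigner f g)) \<le> norm f * norm g"
    by (rule power2_le_imp_le) simp
qed

section \<open>Weyl forms of $L^1$ and $L^2$ symbols\<close>

text \<open>The pairing of L^1 with L^\<infinity>; the 4 is that of
  \<open>wigner_bound\<close>.\<close>

lemma weyl_form_L1:
  fixes \<tau> :: "(real^2) \<times> (real^2) \<Rightarrow> quat"
  assumes \<tau>: "integrable lborel \<tau>"
  shows "integrable lborel (\<lambda>z. \<tau> z * wigner f g z)"
    and "norm (\<integral>z. \<tau> z * wigner f g z \<partial>lborel) \<le> 4 * (\<integral>z. norm (\<tau> z) \<partial>lborel) * norm f * norm g"
proof -
  have [measurable]: "\<tau> \<in> borel_measurable borel" "wigner f g \<in> borel_measurable borel"
    using \<tau> wigner_borel_L2 by auto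
  have le: "norm (\<tau> z * wigner f g z) \<le> norm (\<tau> z) * (4 * norm f * norm g)" for z
    using wigner_bound[of f g z] by (simp add: norm_mult mult_left_mono)
  have int: "integrable lborel (\<lambda>z. norm (\<tau> z) * (4 * norm f * norm g))" using \<tau> by simp
  show I: "integrable lborel (\<lambda>z. \<tau> z * wigner f g z)"
    by (rule Bochner_Integration.integrable_bound[OF int]) (use le in \<open>auto simp: norm_mult\<close>)
  have "norm (\<integral>z. \<tau> z * wigner f g z \<partial>lborel) \<le> (\<integral>z. norm (\<tau> z) * (4 * norm f * norm g) \<partial>lborel)"
    by (rule order_trans[OF integral_norm_bound integral_mono]) (use I int le in auto)
  then show "norm (\<integral>z. \<tau> z * wigner f g z \<partial>lborel) \<le> 4 * (\<integral>z. norm (\<tau> z) \<partial>lborel) * norm f * norm g"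
    by (simp add: mult_ac)
qed

text \<open>Cauchy-Schwarz together with \<open>norm_wigner_L2\<close>.\<close>

lemma weyl_form_L2:
  fixes \<tau> :: "(real^2) \<times> (real^2) \<Rightarrow> quat"
  assumes \<tau>: "borel_L2 \<tau>"
  shows "integrable lborel (\<lambda>z. \<tau> z * wigner f g z)"
    and "norm (\<integral>z. \<tau> z * wigner f g z \<partial>lborel) \<le> norm (abs_L2 \<tau>) * norm f * norm g"
proof -
  have L: "Lp_fun 2 \<tau>" "Lp_fun 2 (wigner f g)"
    by (simp_all add: borel_L2_imp_Lp_fun \<tau> wigner_borel_L2)
  have m [measurable]: "\<tau> \<in> borel_measurable borel" "wigner f g \<in> borel_measurable borel"
    using \<tau> wigner_borel_L2 by (simp_all add: borel_L2_measurable)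
  have mm: "(\<lambda>z. \<tau> z * wigner f g z) \<in> borel_measurable borel" by measurable
  have "integrable lebesgue (\<lambda>z. \<tau> z * wigner f g z)"
    by (rule integrable_Lp_fun_2_bound[OF L borel_imp_lebesgue_measurable[OF mm]]) (simp add: norm_mult)
  then show "integrable lborel (\<lambda>z. \<tau> z * wigner f g z)" using mm by (simp add: integrable_completion)
  have "norm (\<integral>z. \<tau> z * wigner f g z \<partial>lborel) \<le> (\<integral>z. norm (\<tau> z) * norm (wigner f g z) \<partial>lborel)"
    using integral_norm_bound[of lborel "\<lambda>z. \<tau> z * wigner f g z"] by (simp add: norm_mult)
  also have "\<dots> = (\<integral>z. norm (\<tau> z) * norm (wigner f g z) \<partial>lebesgue)"
    by (rule integral_completion[symmetric]) measurable
  also have "\<dots> \<le> norm (abs_L2 \<tau>) * norm (abs_L2 (wigner f g))"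
    using Cauchy_Schwarz_Lp_fun_2[OF L] \<tau> wigner_borel_L2[of f g]
    by (simp add: norm_L2.abs_eq borel_L2_rel)
  also have "\<dots> \<le> norm (abs_L2 \<tau>) * (norm f * norm g)"
    by (intro mult_left_mono norm_wigner_L2) simp
  finally show "norm (\<integral>z. \<tau> z * wigner f g z \<partial>lborel) \<le> norm (abs_L2 \<tau>) * norm f * norm g"
    by (simp add: mult.assoc)
qed

text \<open>The adjoint of modulation reverses the phases. As a phase is symmetric in frequency and
  position, the result is again a modulation, with the two exchanged and the sign put on
  \<open>p\<close>.\<close>

lemma q1_mult_modulate:
  "q1 (c * modulate \<xi> p a) = inner a (modulate (- p) \<xi> (qcnj c))"
proof -
  have E: "qcnj (exp (t *\<^sub>R quat_i)) = exp ((- t) *\<^sub>R quat_i)" "qcnj (exp (t *\<^sub>R quat_j)) = exp ((- t) *\<^sub>R quat_j)" for t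
    by (simp_all only: exp_quat_unit hamilton_relations) (simp_all add: quat_eq_iff)
  have neg: "- (- 2 * pi * \<xi> $ i * p $ i) = - 2 * pi * (- p) $ i * \<xi> $ i" for i
    by simp
  have "q1 (c * modulate \<xi> p a) = inner (qcnj c) (modulate \<xi> p a)"
    by (simp add: inner_quat_def)
  also have "\<dots> = inner (modulate (- p) \<xi> (qcnj c)) a"
    unfolding modulate_def inner_quat_mult E neg ..
  finally show ?thesis by (simp only: inner_commute)
qed

lemma q1_mult_qft:
  assumes "integrable lborel h"
  shows "q1 (c * qft h \<xi>) = (\<integral>p. inner (h p) (modulate (- p) \<xi> (qcnj c)) \<partial>lborel)"
proof -
  have int: "integrable lborel (\<lambda>p. modulate \<xi> p (h p))" by (rule integrable_modulate[OF assms])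
  have "bounded_linear (\<lambda>x. q1 (c * x))"
    by (rule bounded_linear_compose[OF bounded_linear_q1 bounded_linear_mult_right])
  from integral_bounded_linear[OF this int] show ?thesis
    unfolding qft_def q1_mult_modulate[symmetric] by (rule sym)
qed

text \<open>The two hypotheses have separate tasks: L^1 justifies exchanging the integrals over
  \<xi> and \<open>p\<close>, and L^2 makes the resulting kernel square integrable.\<close>

lemma compact_form_weyl_L1_L2:
  fixes \<tau> :: "(real^2) \<times> (real^2) \<Rightarrow> quat"
  assumes \<tau>1: "integrable lborel \<tau>" and \<tau>2: "borel_L2 \<tau>"
  shows "compact_form (\<lambda>f g. q1 (\<integral>z. \<tau> z * wigner f g z \<partial>lborel))"
proof -
  have \<tau>m: "\<tau> \<in> borel_measurable borel" using \<tau>1 by auto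
  define \<kappa> where "\<kappa> z = qcnj (\<tau> z)" for z
  have \<kappa>m: "\<kappa> \<in> borel_measurable borel"
    unfolding \<kappa>_def by (rule measurable_compose[OF \<tau>m]) measurable
  \<comment> \<open>The \<xi>-integral of the modulated symbol from \<open>q1_mult_modulate\<close>;
    the minus sign is the one placed on \<open>p\<close> there.\<close>
  define K where "K z = qft (\<lambda>\<xi>. \<kappa> (fst z, \<xi>)) (- snd z)" for z
  have "(\<lambda>z::(real^2) \<times> (real^2). (fst z, - snd z)) \<in> borel_measurable borel"
    by (intro borel_measurable_continuous_onI continuous_intros)
  from measurable_compose[OF this qft_section_measurable[OF \<kappa>m]]
  have Km: "K \<in> borel_measurable borel" by (simp add: K_def[abs_def])
  have "(\<integral>\<^sup>+z. ennreal ((norm (K z))\<^sup>2) \<partial>lborel)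
      = (\<integral>\<^sup>+x. \<integral>\<^sup>+p. ennreal ((norm (qft (\<lambda>\<xi>. \<kappa> (x, \<xi>)) (- p)))\<^sup>2) \<partial>lborel \<partial>lborel)"
  proof -
    note [measurable] = Km[unfolded borel_prod[symmetric]]
    have "(\<integral>\<^sup>+z. ennreal ((norm (K z))\<^sup>2) \<partial>lborel) = (\<integral>\<^sup>+x. \<integral>\<^sup>+p. ennreal ((norm (K (x, p)))\<^sup>2) \<partial>lborel \<partial>lborel)"
      unfolding lborel_prod[symmetric] by (subst lborel.nn_integral_fst[symmetric]) simp_all
    then show ?thesis by (simp add: K_def)
  qed
  also have "\<dots> \<le> (\<integral>\<^sup>+x. \<integral>\<^sup>+\<xi>. ennreal ((norm (\<kappa> (x, \<xi>)))\<^sup>2) \<partial>lborel \<partial>lborel)"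
  proof (rule nn_integral_mono)
    fix x :: "real^2"
    have m: "(\<lambda>\<xi>. \<kappa> (x, \<xi>)) \<in> borel_measurable borel"
      by (rule measurable_compose[OF _ \<kappa>m]) (simp add: borel_prod[symmetric])
    note [measurable] = qft_measurable[OF m]
    have "(\<integral>\<^sup>+p. ennreal ((norm (qft (\<lambda>\<xi>. \<kappa> (x, \<xi>)) (- p)))\<^sup>2) \<partial>lborel)
        = (\<integral>\<^sup>+p. ennreal ((norm (qft (\<lambda>\<xi>. \<kappa> (x, \<xi>)) p))\<^sup>2) \<partial>lborel)"
      by (subst (2) nn_integral_affine[of "-1" _ 0]) simp_all
    also have "\<dots> \<le> (\<integral>\<^sup>+\<xi>. ennreal ((norm (\<kappa> (x, \<xi>)))\<^sup>2) \<partial>lborel)" by (rule qft_Plancherel[OF m])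
    finally show "(\<integral>\<^sup>+p. ennreal ((norm (qft (\<lambda>\<xi>. \<kappa> (x, \<xi>)) (- p)))\<^sup>2) \<partial>lborel)
        \<le> (\<integral>\<^sup>+\<xi>. ennreal ((norm (\<kappa> (x, \<xi>)))\<^sup>2) \<partial>lborel)" .
  qed
  also have "\<dots> = (\<integral>\<^sup>+z. ennreal ((norm (\<tau> z))\<^sup>2) \<partial>lborel)"
  proof -
    note [measurable] = \<tau>m[unfolded borel_prod[symmetric]]
    show ?thesis
      unfolding lborel_prod[symmetric] \<kappa>_def norm_qcnj
      by (subst lborel.nn_integral_fst[symmetric]) simp_all
  qed
  also have "\<dots> < \<infinity>" using \<tau>2 by (simp add: borel_L2_iff_nn_integral)
  finally have K2: "borel_L2 K" using Km by (simp add: borel_L2_iff_nn_integral)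
  \<comment> \<open>The inverse of \<open>half_shift\<close>: midpoint and difference of the two
    arguments.\<close>
  define unshift where "unshift w = ((1/2) *\<^sub>R (fst w + snd w), fst w - snd w)" for w :: "(real^2) \<times> (real^2)"
  have um: "unshift \<in> borel_measurable borel"
    unfolding unshift_def[abs_def] by (intro borel_measurable_continuous_onI continuous_intros)
  have un: "unshift (half_shift z) = z" for z
    by (cases z) (simp add: unshift_def half_shift_def algebra_simps flip: scaleR_2)
  \<comment> \<open>Both \<open>correlation\<close> and \<open>k\<close> are conjugates in the
    shifted variables, and conjugation preserves \<open>inner\<close>; thus \<open>K\<close> against
    the correlation becomes \<open>k\<close> against the tensor.\<close>
  define k where "k w = qcnj (K (unshift w))" for w
  have km: "k \<in> borel_measurable borel"
    unfolding k_def by (rule measurable_compose[OF measurable_compose[OF um Km]]) measurable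
  have "(\<integral>\<^sup>+w. ennreal ((norm (k w))\<^sup>2) \<partial>lborel) = (\<integral>\<^sup>+z. ennreal ((norm (k (half_shift z)))\<^sup>2) \<partial>lborel)"
    using km by (intro nn_integral_half_shift[symmetric, of "\<lambda>w. ennreal ((norm (k w))\<^sup>2)"]) simp
  also have "\<dots> < \<infinity>" using K2 by (simp add: k_def un borel_L2_iff_nn_integral)
  finally have k2: "borel_L2 k" using km by (simp add: borel_L2_iff_nn_integral)
  have "q1 (\<integral>z. \<tau> z * wigner f g z \<partial>lborel) = inner (abs_L2 k) (tensor_L2 f g)" for f g
  proof -
    define F where "F = correlation (rep f) (rep g)"
    have F1: "integrable lborel (\<lambda>p. F (x, p))" for x
      unfolding F_def by (intro correlation_section borel_L2_rep)
    have F2: "borel_L2 F"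
      unfolding borel_L2_iff_nn_integral F_def by (simp add: nn_integral_correlation correlation_measurable)
    have "q1 (\<integral>z. \<tau> z * wigner f g z \<partial>lborel) = (\<integral>z. q1 (\<tau> z * wigner f g z) \<partial>lborel)"
      by (rule integral_bounded_linear[OF bounded_linear_q1 weyl_form_L1(1)[OF \<tau>1], symmetric])
    also have "\<dots> = (\<integral>x. \<integral>\<xi>. q1 (\<tau> (x, \<xi>) * wigner f g (x, \<xi>)) \<partial>lborel \<partial>lborel)"
      using lborel_pair.integral_fst'[of "\<lambda>z. q1 (\<tau> z * wigner f g z)"]
        integrable_bounded_linear[OF bounded_linear_q1 weyl_form_L1(1)[OF \<tau>1, of f g]]
      by (simp add: lborel_prod)
    also have "\<dots> = (\<integral>x. \<integral>p. inner (F (x, p)) (K (x, p)) \<partial>lborel \<partial>lborel)"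
    proof (rule integral_cong_AE)
      have qm: "(\<lambda>z. q1 (\<tau> z * wigner f g z)) \<in> borel_measurable (borel \<Otimes>\<^sub>M lborel)"
        using integrable_bounded_linear[OF bounded_linear_q1 weyl_form_L1(1)[OF \<tau>1, of f g]]
        by (auto simp: borel_prod[symmetric] dest!: borel_measurable_integrable)
      then show "(\<lambda>x. \<integral>\<xi>. q1 (\<tau> (x, \<xi>) * wigner f g (x, \<xi>)) \<partial>lborel) \<in> borel_measurable lborel"
        by (simp add: lborel.borel_measurable_lebesgue_integral split_beta')
      note [measurable] = Km[unfolded borel_prod[symmetric]] borel_L2_measurable[OF F2, unfolded borel_prod[symmetric]]
      have "(\<lambda>z. inner (F z) (K z)) \<in> borel_measurable (borel \<Otimes>\<^sub>M lborel)" by measurable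
      then show "(\<lambda>x. \<integral>p. inner (F (x, p)) (K (x, p)) \<partial>lborel) \<in> borel_measurable lborel"
        by (simp add: lborel.borel_measurable_lebesgue_integral split_beta')
      \<comment> \<open>The exchange of \<xi> and \<open>p\<close> needs an integrable section of
        the symbol, which exists only for almost every \<open>x\<close>.\<close>
      have "AE x in lborel. integrable lborel (\<lambda>\<xi>. \<tau> (x, \<xi>))"
        using lborel_pair.AE_integrable_fst'[of \<tau>] \<tau>1 by (simp add: lborel_prod)
      then show "AE x in lborel. (\<integral>\<xi>. q1 (\<tau> (x, \<xi>) * wigner f g (x, \<xi>)) \<partial>lborel)
          = (\<integral>p. inner (F (x, p)) (K (x, p)) \<partial>lborel)"
      proof eventually_elim
        case (elim x)
        have \<kappa>x: "integrable lborel (\<lambda>\<xi>. \<kappa> (x, \<xi>))"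
          unfolding \<kappa>_def using integrable_bounded_linear[OF bounded_linear_qcnj elim] .
        define J where "J \<xi> p = inner (F (x, p)) (modulate (- p) \<xi> (\<kappa> (x, \<xi>)))" for \<xi> p
        have [measurable]: "(\<lambda>p. F (x, p)) \<in> borel_measurable borel" "(\<lambda>\<xi>. \<kappa> (x, \<xi>)) \<in> borel_measurable borel"
          using F1[of x] \<kappa>x by auto
        have Jint: "integrable (lborel \<Otimes>\<^sub>M lborel) (\<lambda>(\<xi>, p). J \<xi> p)"
          unfolding lborel_prod
        proof (rule Bochner_Integration.integrable_bound)
          show "integrable lborel (\<lambda>z. norm (\<kappa> (x, fst z)) * norm (F (x, snd z)))"
            using \<kappa>x F1[of x] by (intro integral_product_fst_snd integrable_norm)
          show "(\<lambda>(\<xi>, p). J \<xi> p) \<in> borel_measurable lborel"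
            unfolding J_def measurable_lborel2 borel_prod[symmetric] by measurable
          show "AE z in lborel. norm (case z of (\<xi>, p) \<Rightarrow> J \<xi> p) \<le> norm (norm (\<kappa> (x, fst z)) * norm (F (x, snd z)))"
            by (auto simp: J_def split_beta intro!: order_trans[OF Cauchy_Schwarz_ineq2])
        qed
        have "(\<integral>\<xi>. q1 (\<tau> (x, \<xi>) * wigner f g (x, \<xi>)) \<partial>lborel) = (\<integral>\<xi>. \<integral>p. J \<xi> p \<partial>lborel \<partial>lborel)"
          using q1_mult_qft[OF F1[of x]] by (simp add: wigner_eq_qft F_def[symmetric] J_def \<kappa>_def)
        also have "\<dots> = (\<integral>p. \<integral>\<xi>. J \<xi> p \<partial>lborel \<partial>lborel)"
          by (rule lborel_pair.Fubini_integral[OF Jint, symmetric])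
        also have "\<dots> = (\<integral>p. inner (F (x, p)) (K (x, p)) \<partial>lborel)"
          using integrable_modulate[OF \<kappa>x] by (simp add: J_def K_def qft_def)
        finally show ?case .
      qed
    qed
    also have "\<dots> = (\<integral>z. inner (F z) (K z) \<partial>lborel)"
      using lborel_pair.integral_fst'[of "\<lambda>z. inner (F z) (K z)"] integrable_inner_borel_L2[OF F2 K2]
      by (simp add: lborel_prod)
    also have "\<dots> = (\<integral>z. inner (k (half_shift z)) (tensor (rep f) (rep g) (half_shift z)) \<partial>lborel)"
      by (simp add: F_def correlation_def k_def un inner_quat_def mult.commute)
    also have "\<dots> = (\<integral>z. inner (k z) (tensor (rep f) (rep g) z) \<partial>lborel)"
      using km tensor_measurable[OF rep_measurable rep_measurable]
      by (intro integral_half_shift[of "\<lambda>z. inner (k z) (tensor (rep f) (rep g) z)"]) simp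
    also have "\<dots> = inner (abs_L2 k) (tensor_L2 f g)"
      unfolding tensor_L2_def by (intro inner_abs_L2[symmetric] k2 borel_L2_tensor borel_L2_rep)
    finally show ?thesis .
  qed
  then show ?thesis by (simp add: compact_form_kernel)
qed

section \<open>Symbols between L^1 and L^2\<close>

lemma abs_q1_le_norm: "\<bar>q1 x\<bar> \<le> norm x"
  using Cauchy_Schwarz_ineq2[of x 1] by (simp add: inner_quat_def)

lemma compact_form_weyl_borel:
  fixes \<sigma> :: "(real^2) \<times> (real^2) \<Rightarrow> quat"
  assumes r: "1 \<le> r" "r \<le> 2" and \<sigma>m: "\<sigma> \<in> borel_measurable borel"
    and \<sigma>r: "integrable lborel (\<lambda>z. norm (\<sigma> z) powr r)"
  shows "compact_form (\<lambda>f g. q1 (\<integral>z. \<sigma> z * wigner f g z \<partial>lborel))"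
proof (rule compact_form_limit)
  fix e :: real assume e: "0 < e"
  note [measurable] = \<sigma>m
  define big where "big = {z. 1 < norm (\<sigma> z)}"
  define \<sigma>1 where "\<sigma>1 z = indicator big z *\<^sub>R \<sigma> z" for z
  define \<sigma>2 where "\<sigma>2 z = indicator (- big) z *\<^sub>R \<sigma> z" for z
  have bigm [measurable]: "big \<in> sets borel" unfolding big_def by measurable
  have m1 [measurable]: "\<sigma>1 \<in> borel_measurable borel" and m2 [measurable]: "\<sigma>2 \<in> borel_measurable borel"
    unfolding \<sigma>1_def[abs_def] \<sigma>2_def[abs_def] by measurable
  \<comment> \<open>Where the modulus exceeds 1, powers increase with the exponent and
    \<open>1 \<le> r\<close> applies; elsewhere they decrease and \<open>r \<le> 2\<close> applies
    in \<open>le2\<close>.\<close>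
  have le1: "norm (\<sigma>1 z) \<le> norm (\<sigma> z) powr r" for z
    using powr_mono[OF r(1), of "norm (\<sigma> z)"] by (auto simp: \<sigma>1_def big_def indicator_def)
  have le2: "(norm (\<sigma>2 z))\<^sup>2 \<le> norm (\<sigma> z) powr r" for z
    using powr_mono'[OF r(2), of "norm (\<sigma> z)"] by (auto simp: \<sigma>2_def big_def indicator_def)
  have int1: "integrable lborel \<sigma>1"
    by (rule Bochner_Integration.integrable_bound[OF \<sigma>r]) (use le1 in auto)
  have L2: "borel_L2 \<sigma>2"
    unfolding borel_L2_def
  proof
    show "integrable lborel (\<lambda>x. (norm (\<sigma>2 x))\<^sup>2)"
      by (rule Bochner_Integration.integrable_bound[OF \<sigma>r]) (use le2 in auto)
  qed simp
  \<comment> \<open>Cutting both the support and the height makes the truncated symbol bounded on a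
    ball, hence a member of L^1 and of L^2.\<close>
  define T where "T n = {z. norm z \<le> real n \<and> norm (\<sigma> z) \<le> real n}" for n
  have Tm [measurable]: "T n \<in> sets borel" for n unfolding T_def by measurable
  define \<rho>1 where "\<rho>1 n z = indicator (- T n) z *\<^sub>R \<sigma>1 z" for n z
  define \<rho>2 where "\<rho>2 n z = indicator (- T n) z *\<^sub>R \<sigma>2 z" for n z
  define \<tau> where "\<tau> n z = indicator (T n) z *\<^sub>R \<sigma> z" for n z
  have \<rho>m [measurable]: "\<rho>1 n \<in> borel_measurable borel" "\<rho>2 n \<in> borel_measurable borel" "\<tau> n \<in> borel_measurable borel" for n
    unfolding \<rho>1_def[abs_def] \<rho>2_def[abs_def] \<tau>_def[abs_def] by measurable
  have in_T: "\<exists>N. \<forall>n\<ge>N. z \<in> T n" for z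
  proof -
    obtain N where "max (norm z) (norm (\<sigma> z)) < real N" using reals_Archimedean2 by blast
    then show ?thesis by (intro exI[of _ N]) (auto simp: T_def)
  qed
  have lim1: "(\<lambda>n. \<rho>1 n z) \<longlonglongrightarrow> 0" and lim2: "(\<lambda>n. \<rho>2 n z) \<longlonglongrightarrow> 0" for z
  proof -
    have "\<forall>\<^sub>F n in sequentially. z \<in> T n"
      using in_T[of z] by (simp add: eventually_sequentially)
    then have "\<forall>\<^sub>F n in sequentially. \<rho>1 n z = 0" "\<forall>\<^sub>F n in sequentially. \<rho>2 n z = 0"
      by (eventually_elim, simp add: \<rho>1_def \<rho>2_def)+
    then show "(\<lambda>n. \<rho>1 n z) \<longlonglongrightarrow> 0" "(\<lambda>n. \<rho>2 n z) \<longlonglongrightarrow> 0"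
      by (simp_all add: tendsto_eventually)
  qed
  have \<rho>1: "integrable lborel (\<rho>1 n)" for n
    by (rule Bochner_Integration.integrable_bound[OF int1]) (auto simp: \<rho>1_def indicator_def)
  have le\<rho>2: "norm (\<rho>2 n z) \<le> 1 * norm (\<sigma>2 z)" for n z
    by (auto simp: \<rho>2_def indicator_def)
  have \<rho>2: "borel_L2 (\<rho>2 n)" for n
    by (rule borel_L2_bound[OF L2 \<rho>m(2) le\<rho>2])
  have "(\<lambda>n. \<integral>z. norm (\<rho>1 n z) \<partial>lborel) \<longlonglongrightarrow> (\<integral>z. 0 \<partial>(lborel :: ((real^2) \<times> (real^2)) measure))"
  proof (rule integral_dominated_convergence[where s="\<lambda>n z. norm (\<rho>1 n z)" and f="\<lambda>z. 0" and w="\<lambda>z. norm (\<sigma>1 z)"])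
    show "AE z in lborel. (\<lambda>n. norm (\<rho>1 n z)) \<longlonglongrightarrow> 0"
      using lim1 by (auto intro!: AE_I2 tendsto_norm_zero)
    show "AE z in lborel. norm (norm (\<rho>1 n z)) \<le> norm (\<sigma>1 z)" for n
      by (auto simp: \<rho>1_def indicator_def)
  qed (use int1 in auto)
  then have "(\<lambda>n. \<integral>z. norm (\<rho>1 n z) \<partial>lborel) \<longlonglongrightarrow> 0" by simp
  moreover have "(\<lambda>n. norm (abs_L2 (\<rho>2 n))) \<longlonglongrightarrow> norm (abs_L2 (\<lambda>z. 0 :: quat) :: ((real^2) \<times> (real^2)) L2)"
    by (intro tendsto_norm L2_tendsto_dominated(1)[OF L2 \<rho>m(2) _ le\<rho>2 lim2]) simp
  then have "(\<lambda>n. norm (abs_L2 (\<rho>2 n))) \<longlonglongrightarrow> 0" by (simp add: zero_L2.abs_eq[symmetric])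
  \<comment> \<open>The weights 4 and 1 are the constants of \<open>weyl_form_L1\<close> and
    \<open>weyl_form_L2\<close>, so this sum bounds the whole error form.\<close>
  ultimately have "(\<lambda>n. 4 * (\<integral>z. norm (\<rho>1 n z) \<partial>lborel) + norm (abs_L2 (\<rho>2 n))) \<longlonglongrightarrow> 4 * 0 + 0"
    by (intro tendsto_intros)
  then have "\<forall>\<^sub>F n in sequentially. 4 * (\<integral>z. norm (\<rho>1 n z) \<partial>lborel) + norm (abs_L2 (\<rho>2 n)) < e"
    using e by (intro order_tendstoD(2)) auto
  then obtain n where n: "4 * (\<integral>z. norm (\<rho>1 n z) \<partial>lborel) + norm (abs_L2 (\<rho>2 n)) < e"
    by (auto simp: eventually_sequentially)
  have \<tau>2: "borel_L2 (\<tau> n)" and \<tau>1: "integrable lborel (\<tau> n)"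
  proof -
    let ?h = "\<lambda>z::(real^2) \<times> (real^2). indicator (cball 0 (real n)) z *\<^sub>R (1 :: quat)"
    have le: "norm (\<tau> n z) \<le> real n * norm (?h z)" for z
      by (auto simp: \<tau>_def T_def indicator_def)
    have fin: "emeasure lborel (cball 0 (real n) :: ((real^2) \<times> (real^2)) set) < \<infinity>"
      by (rule emeasure_bounded_finite) simp
    have "borel_L2 ?h" using fin by (intro borel_L2_indicator) auto
    then show "borel_L2 (\<tau> n)" by (rule borel_L2_bound[OF _ \<rho>m(3) le])
    have "integrable lborel (\<lambda>z::(real^2) \<times> (real^2). real n * indicator (cball 0 (real n)) z)"
      using fin by simp
    then show "integrable lborel (\<tau> n)"
      by (rule Bochner_Integration.integrable_bound) (use le in \<open>auto simp: indicator_def split: if_splits\<close>)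
  qed
  show "\<exists>A. compact_form A \<and> (\<forall>f g. \<bar>q1 (\<integral>z. \<sigma> z * wigner f g z \<partial>lborel) - A f g\<bar> \<le> e * norm f * norm g)"
  proof (intro exI conjI allI)
    show "compact_form (\<lambda>f g. q1 (\<integral>z. \<tau> n z * wigner f g z \<partial>lborel))"
      by (rule compact_form_weyl_L1_L2[OF \<tau>1 \<tau>2])
    fix f g :: "(real^2) L2"
    have split: "\<sigma> z * wigner f g z = \<tau> n z * wigner f g z + (\<rho>1 n z * wigner f g z + \<rho>2 n z * wigner f g z)" for z
      by (auto simp: \<tau>_def \<rho>1_def \<rho>2_def \<sigma>1_def \<sigma>2_def indicator_def)
    have "(\<integral>z. \<sigma> z * wigner f g z \<partial>lborel) = (\<integral>z. \<tau> n z * wigner f g z \<partial>lborel)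
        + ((\<integral>z. \<rho>1 n z * wigner f g z \<partial>lborel) + (\<integral>z. \<rho>2 n z * wigner f g z \<partial>lborel))"
      unfolding split by (simp add: weyl_form_L1(1)[OF \<tau>1] weyl_form_L1(1)[OF \<rho>1] weyl_form_L2(1)[OF \<rho>2])
    then have "\<bar>q1 (\<integral>z. \<sigma> z * wigner f g z \<partial>lborel) - q1 (\<integral>z. \<tau> n z * wigner f g z \<partial>lborel)\<bar>
        \<le> norm ((\<integral>z. \<rho>1 n z * wigner f g z \<partial>lborel) + (\<integral>z. \<rho>2 n z * wigner f g z \<partial>lborel))"
      using abs_q1_le_norm[of "(\<integral>z. \<rho>1 n z * wigner f g z \<partial>lborel) + (\<integral>z. \<rho>2 n z * wigner f g z \<partial>lborel)"] by simp
    also have "\<dots> \<le> (4 * (\<integral>z. norm (\<rho>1 n z) \<partial>lborel) + norm (abs_L2 (\<rho>2 n))) * (norm f * norm g)"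
      using weyl_form_L1(2)[OF \<rho>1, of n f g] weyl_form_L2(2)[OF \<rho>2, of n f g]
      by (intro norm_triangle_le) (simp add: algebra_simps)
    also have "\<dots> \<le> e * (norm f * norm g)" using n by (intro mult_right_mono) auto
    finally show "\<bar>q1 (\<integral>z. \<sigma> z * wigner f g z \<partial>lborel) - q1 (\<integral>z. \<tau> n z * wigner f g z \<partial>lborel)\<bar> \<le> e * norm f * norm g"
      by (simp add: mult.assoc)
  qed
qed

text \<open>The form depends on the symbol only up to null sets, so a Borel version may take its
  place.\<close>

lemma compact_form_weyl_form:
  assumes r: "1 \<le> r" "r \<le> 2" and \<sigma>: "Lp_fun r \<sigma>"
  shows "compact_form (\<lambda>f g. q1 (weyl_form \<sigma> f g))"
proof -
  have \<sigma>m: "\<sigma> \<in> borel_measurable lebesgue" and \<sigma>r: "integrable lebesgue (\<lambda>z. norm (\<sigma> z) powr r)"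
    using \<sigma> by (simp_all add: Lp_fun_def)
  obtain \<sigma>' where \<sigma>'m: "\<sigma>' \<in> borel_measurable borel" and AE: "AE z in lebesgue. \<sigma> z = \<sigma>' z"
    using ex_borel_AE_eq[OF \<sigma>m] by blast
  note [measurable] = \<sigma>'m borel_imp_lebesgue_measurable[OF \<sigma>'m] \<sigma>m
  have "integrable lebesgue (\<lambda>z. norm (\<sigma>' z) powr r)"
  proof (rule Bochner_Integration.integrable_cong_AE_imp[OF \<sigma>r])
    show "(\<lambda>z. norm (\<sigma>' z) powr r) \<in> borel_measurable lebesgue" by measurable
    show "AE z in lebesgue. norm (\<sigma> z) powr r = norm (\<sigma>' z) powr r" using AE by eventually_elim simp
  qed
  then have "integrable lborel (\<lambda>z. norm (\<sigma>' z) powr r)" by (simp add: integrable_completion)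
  from compact_form_weyl_borel[OF r \<sigma>'m this]
  have "compact_form (\<lambda>f g. q1 (\<integral>z. \<sigma>' z * wigner f g z \<partial>lborel))" .
  moreover have "weyl_form \<sigma> f g = (\<integral>z. \<sigma>' z * wigner f g z \<partial>lborel)" for f g
  proof -
    have Wm: "wigner f g \<in> borel_measurable borel" by (rule borel_L2_measurable[OF wigner_borel_L2])
    note [measurable] = Wm borel_imp_lebesgue_measurable[OF Wm]
    have "weyl_form \<sigma> f g = (\<integral>z. \<sigma>' z * wigner f g z \<partial>lebesgue)"
      unfolding weyl_form_def
    proof (rule integral_cong_AE)
      show "AE z in lebesgue. \<sigma> z * wigner f g z = \<sigma>' z * wigner f g z" using AE by eventually_elim simp
    qed measurable
    also have "\<dots> = (\<integral>z. \<sigma>' z * wigner f g z \<partial>lborel)"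
      by (rule integral_completion) measurable
    finally show ?thesis .
  qed
  ultimately show ?thesis by simp
qed

text \<open>Compactness is obtained for the operator of the scalar identity. An operator satisfying
  the full quaternionic identity satisfies the scalar one as well, and uniqueness there makes the
  two equal.\<close>

theorem theorem3p8:
  fixes r :: real and \<sigma> :: "(real^2) \<times> (real^2) \<Rightarrow> quat"
  assumes "1 \<le> r" and "r \<le> 2"
    and "Lp_fun r \<sigma>"
    and "AE z in lebesgue. \<sigma> (fst z, - snd z) = \<sigma> z"
  shows "(\<forall>W. is_weyl_transform \<sigma> W \<longrightarrow> compact_operator W) \<and>
    (\<exists>W. is_scalar_weyl_transform \<sigma> W \<and> compact_operator W)"
proof -
  obtain T where T: "compact_operator T" and form: "\<And>f g. q1 (weyl_form \<sigma> f g) = inner (T f) g"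
    using compact_form_weyl_form[OF assms(1-3)] by (auto simp: compact_form_def)
  have scalar: "is_scalar_weyl_transform \<sigma> T"
    by (simp add: is_scalar_weyl_transform_def form inner_L2_eq_pairing)
  have "compact_operator W" if "is_weyl_transform \<sigma> W" for W
    using is_scalar_weyl_transform_unique[OF is_weyl_transform_imp_scalar[OF that] scalar] T by simp
  then show ?thesis using T scalar by blast
qed

end
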